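(* For every $K\ge1$, $$\max_{[\alpha]_{K\times K}\in\mathcal A_{\mathrm{CTIN}}}\frac{\mathcal D_{\Sigma,\mathrm{BC}}}{\mathcal D_{\Sigma,\mathrm{TINA}}}=\max_{[\alpha]_{K\times K}\in\mathcal A_{\mathrm{CTIN}}}\frac{\mathcal D_{\Sigma,\mathrm{BC}}}{\mathcal D_{\Sigma,\mathrm{IC}}}=2-\frac1K,$$ where the maxima are over matrices with nonzero denominators (i.e., not all $\alpha_{ii}=0$).
   Context: Channel model: for $k\in[K]$, $Y_k(t)=\sum_{i=1}^K \bar P^{\alpha_{ki}}G_{ki}(t)X_i(t)+Z_k(t)$, $\bar P=\sqrt P$, unit power constraints on $X_i(t)\in\mathbb C$, $Z_k(t)$ zero-mean unit-variance complex AWGN, $\alpha_{ki}\ge0$ known to all. $G_{ki}(t)$ are known perfectly at receivers and only to finite precision at transmitters (transmitters know only a distribution with joint/conditional densities bounded by a constant independent of $P$, magnitudes bounded above and away from zero independently of $P$; transmitted symbols are independent of the channel realizations). In the $K$ user interference channel (IC), message $k$ (for Receiver $k$) is encoded only by Transmitter $k$; in the $K$ user MISO broadcast channel (BC), all $K$ messages are jointly encoded by all $K$ transmitters. GDoF region: $\{(d_k): d_k=\lim_{P\to\infty}R_k(P)/\log P\text{ for achievable }(R_k(P))\}$. $\mathcal D_{\Sigma,\mathrm{IC}}$, $\mathcal D_{\Sigma,\mathrm{BC}}$ denote the maximum sum-GDoF of the IC and BC. CTIN regime: $\mathcal{A}_{\mathrm{CTIN}}=\{[\alpha]\in\mathbb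 R_+^{K\times K}:\ \alpha_{ii}\ge\max(\alpha_{ij}+\alpha_{ji},\ \alpha_{ik}+\alpha_{ji}-\alpha_{jk})\ \forall i,j,k\in[K],\ i\notin\{j,k\}\}$. Cycles: a cycle $\pi=(i_1\to\cdots\to i_M)$, $M\ge1$, is an ordered list of distinct indices of $[K]$, read cyclically ($i_{M+1}=i_1$); $\{\pi\}$ its set; $\Pi$ the set of all cycles. $\delta_{ij}=\alpha_{ii}-\alpha_{ji}$ ($i\neq j$), $\delta_{ii}=0$; $\Delta_\pi=\sum_{m=1}^M\delta_{i_mi_{m+1}}$ if $M>1$, $\Delta_\pi=\alpha_{i_1i_1}$ if $M=1$. For $S\subseteq[K]$, $\mathcal D_{\mathrm{P\text{-}TIN}}(S)=\{(d_k)_{k\in[K]}: d_k=0\ (k\notin S),\ d_k\ge0\ (k\in S),\ \sum_{k\in\{\pi\}}d_k\le\Delta_\pi\ \forall \pi\in\Pi,\ \{\pi\}\subseteq S\}$; $\mathcal D_{\mathrm{TINA}}=\bigcup_{S\subseteq[K]}\mathcal D_{\mathrm{P\text{-}TIN}}(S)$ and $\mathcal D_{\Sigma,\mathrm{TINA}}$ is its maximum coordinate sum. *)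

theory Defs
  imports "HOL-Probability.Probability"
begin

text \<open>Users/antennas are indexed by 0..K-1 (i.e. k < K) instead of 1..K.
  A K x K matrix alpha is a function nat => nat => real of which only the
  entries with indices < K matter.  Channel realisations over time are
  functions g :: nat => nat => nat => complex, g t k i = G_ki(t).\<close>

definition A_CTIN :: "nat \<Rightarrow> (nat \<Rightarrow> nat \<Rightarrow> real) set" where
  "A_CTIN K = {\<alpha>. (\<forall>i<K. \<forall>j<K. \<alpha> i j \<ge> 0) \<and>
     (\<forall>i<K. \<forall>j<K. \<forall>k<K. i \<noteq> j \<and> i \<noteq> k \<longrightarrow>
        \<alpha> i i \<ge> max (\<alpha> i j + \<alpha> j i) (\<alpha> i k + \<alpha> j i - \<alpha> j k))}"

definition is_cycle :: "nat \<Rightarrow> nat list \<Rightarrow> bool" where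
  "is_cycle K \<pi> \<longleftrightarrow> \<pi> \<noteq> [] \<and> distinct \<pi> \<and> set \<pi> \<subseteq> {..<K}"

definition delta :: "(nat \<Rightarrow> nat \<Rightarrow> real) \<Rightarrow> nat \<Rightarrow> nat \<Rightarrow> real" where
  "delta \<alpha> i j = (if i = j then 0 else \<alpha> i i - \<alpha> j i)"

definition Delta :: "(nat \<Rightarrow> nat \<Rightarrow> real) \<Rightarrow> nat list \<Rightarrow> real" where
  "Delta \<alpha> \<pi> = (if length \<pi> = 1 then \<alpha> (\<pi> ! 0) (\<pi> ! 0)
      else (\<Sum>m<length \<pi>. delta \<alpha> (\<pi> ! m) (\<pi> ! ((m + 1) mod length \<pi>))))"

definition D_PTIN :: "nat \<Rightarrow> (nat \<Rightarrow> nat \<Rightarrow> real) \<Rightarrow> nat set \<Rightarrow> (nat \<Rightarrow> real) set" where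
  "D_PTIN K \<alpha> S = {d. (\<forall>k. k \<ge> K \<longrightarrow> d k = 0) \<and>
      (\<forall>k<K. k \<notin> S \<longrightarrow> d k = 0) \<and> (\<forall>k\<in>S. d k \<ge> 0) \<and>
      (\<forall>\<pi>. is_cycle K \<pi> \<and> set \<pi> \<subseteq> S \<longrightarrow> (\<Sum>k\<in>set \<pi>. d k) \<le> Delta \<alpha> \<pi>)}"

definition D_TINA_region :: "nat \<Rightarrow> (nat \<Rightarrow> nat \<Rightarrow> real) \<Rightarrow> (nat \<Rightarrow> real) set" where
  "D_TINA_region K \<alpha> = (\<Union>S\<in>Pow {..<K}. D_PTIN K \<alpha> S)"

definition D_sum_TINA :: "nat \<Rightarrow> (nat \<Rightarrow> nat \<Rightarrow> real) \<Rightarrow> real" where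
  "D_sum_TINA K \<alpha> = Sup {(\<Sum>k<K. d k) | d. d \<in> D_TINA_region K \<alpha>}"

definition coords :: "nat \<Rightarrow> (nat \<times> nat \<times> nat) set" where
  "coords K = {(t, k, i). k < K \<and> i < K}"

definition chan_marg ::
  "(nat \<Rightarrow> nat \<Rightarrow> nat \<Rightarrow> complex) measure \<Rightarrow> (nat \<times> nat \<times> nat) set
     \<Rightarrow> ((nat \<times> nat \<times> nat) \<Rightarrow> complex) measure" where
  "chan_marg G S = distr G (PiM S (\<lambda>_. (borel :: complex measure)))
      (\<lambda>g. restrict (\<lambda>(t, k, i). g t k i) S)"

text \<open>Gm P is the law of the channel process (G_ki(t)) at power P.  Admissible:
  magnitudes bounded above and away from zero, and all joint and conditional
  densities (w.r.t. Lebesgue measure) bounded, with constants independent of P.\<close>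
definition admissible_channel ::
  "nat \<Rightarrow> (real \<Rightarrow> (nat \<Rightarrow> nat \<Rightarrow> nat \<Rightarrow> complex) measure) \<Rightarrow> bool" where
  "admissible_channel K Gm \<longleftrightarrow> (\<exists>fmax dmin dmax. fmax > 0 \<and> dmin > 0 \<and> dmin \<le> dmax \<and>
     (\<forall>P>1. prob_space (Gm P) \<and>
       (\<forall>t k i. k < K \<longrightarrow> i < K \<longrightarrow> (\<lambda>g. g t k i) \<in> borel_measurable (Gm P)) \<and>
       (\<forall>t k i. k < K \<longrightarrow> i < K \<longrightarrow>
          (AE g in Gm P. dmin \<le> cmod (g t k i) \<and> cmod (g t k i) \<le> dmax)) \<and>
       (\<forall>A B. finite A \<and> finite B \<and> A \<subseteq> coords K \<and> B \<subseteq> coords K \<and> A \<inter> B = {} \<longrightarrow>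
          (\<exists>f h. f \<in> borel_measurable (PiM (A \<union> B) (\<lambda>_. (lborel :: complex measure))) \<and>
                 h \<in> borel_measurable (PiM B (\<lambda>_. (lborel :: complex measure))) \<and>
                 chan_marg (Gm P) (A \<union> B) = density (PiM (A \<union> B) (\<lambda>_. lborel)) f \<and>
                 chan_marg (Gm P) B = density (PiM B (\<lambda>_. lborel)) h \<and>
                 (AE x in PiM (A \<union> B) (\<lambda>_. lborel).
                    f x \<le> ennreal (fmax ^ card A) * h (restrict x B))))))"

definition CN01 :: "complex measure" where
  "CN01 = density lborel (\<lambda>z. ennreal (exp (- (cmod z)\<^sup>2) / pi))"

definition noise :: "nat \<Rightarrow> nat \<Rightarrow> (nat \<times> nat \<Rightarrow> complex) measure" where
  "noise n K = PiM ({..<n} \<times> {..<K}) (\<lambda>_. CN01)"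

definition msg_set :: "nat \<Rightarrow> (nat \<Rightarrow> nat) \<Rightarrow> (nat \<Rightarrow> nat) set" where
  "msg_set K M = PiE {..<K} (\<lambda>k. {..<M k})"

text \<open>Received signal of receiver k over the block (zero outside the block).
  E w i t is the symbol X_i(t) sent by transmitter i for message tuple w.\<close>
definition rx_signal :: "nat \<Rightarrow> (nat \<Rightarrow> nat \<Rightarrow> real) \<Rightarrow> real \<Rightarrow> nat
    \<Rightarrow> ((nat \<Rightarrow> nat) \<Rightarrow> nat \<Rightarrow> nat \<Rightarrow> complex) \<Rightarrow> (nat \<Rightarrow> nat)
    \<Rightarrow> (nat \<Rightarrow> nat \<Rightarrow> nat \<Rightarrow> complex) \<Rightarrow> (nat \<times> nat \<Rightarrow> complex) \<Rightarrow> nat \<Rightarrow> nat \<Rightarrow> complex" where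
  "rx_signal K \<alpha> P n E w g z k = (\<lambda>t. if t < n then
      (\<Sum>i<K. complex_of_real (sqrt P powr \<alpha> k i) * g t k i * E w i t) + z (t, k) else 0)"

definition restrict_time :: "nat \<Rightarrow> (nat \<Rightarrow> nat \<Rightarrow> nat \<Rightarrow> complex) \<Rightarrow> nat \<Rightarrow> nat \<Rightarrow> nat \<Rightarrow> complex" where
  "restrict_time n g = (\<lambda>t. if t < n then g t else (\<lambda>_ _. 0))"

text \<open>Probability that all receivers decode correctly (uniform independent
  messages, independent channel and noise).  Receiver k's decoder sees its
  own output and the channel realisation.  The (lower) integral of the
  indicator is used, so no measurability of decoders has to be assumed.\<close>
definition success_prob :: "nat \<Rightarrow> (nat \<Rightarrow> nat \<Rightarrow> real) \<Rightarrow> real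
    \<Rightarrow> (nat \<Rightarrow> nat \<Rightarrow> nat \<Rightarrow> complex) measure \<Rightarrow> nat \<Rightarrow> (nat \<Rightarrow> nat)
    \<Rightarrow> ((nat \<Rightarrow> nat) \<Rightarrow> nat \<Rightarrow> nat \<Rightarrow> complex)
    \<Rightarrow> (nat \<Rightarrow> (nat \<Rightarrow> complex) \<Rightarrow> (nat \<Rightarrow> nat \<Rightarrow> nat \<Rightarrow> complex) \<Rightarrow> nat) \<Rightarrow> ennreal" where
  "success_prob K \<alpha> P G n M E dec =
     (\<Sum>w\<in>msg_set K M. \<integral>\<^sup>+ gz. indicator
         {gz. \<forall>k<K. dec k (rx_signal K \<alpha> P n E w (fst gz) (snd gz) k)
                          (restrict_time n (fst gz)) = w k} gz
       \<partial>(G \<Otimes>\<^sub>M noise n K)) / of_nat (card (msg_set K M))"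

text \<open>Achievability of rate tuple R (bits per channel use) at power P.
  is_bc = True: MISO BC (every transmitter may use all messages);
  is_bc = False: IC (transmitter i's symbols depend only on message i).\<close>
definition achievable :: "bool \<Rightarrow> nat \<Rightarrow> (nat \<Rightarrow> nat \<Rightarrow> real)
    \<Rightarrow> (nat \<Rightarrow> nat \<Rightarrow> nat \<Rightarrow> complex) measure \<Rightarrow> real \<Rightarrow> (nat \<Rightarrow> real) \<Rightarrow> bool" where
  "achievable is_bc K \<alpha> G P R \<longleftrightarrow> (\<forall>k<K. R k \<ge> 0) \<and>
     (\<forall>\<epsilon>>0. \<exists>N. \<forall>n\<ge>N. \<exists>M E dec.
        (\<forall>k<K. 2 powr (real n * R k) \<le> real (M k)) \<and>
        (\<forall>w\<in>msg_set K M. \<forall>i<K. (\<Sum>t<n. (cmod (E w i t))\<^sup>2) \<le> real n) \<and>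
        (\<not> is_bc \<longrightarrow> (\<forall>w\<in>msg_set K M. \<forall>w'\<in>msg_set K M. \<forall>i<K.
             w i = w' i \<longrightarrow> E w i = E w' i)) \<and>
        ennreal (1 - \<epsilon>) \<le> success_prob K \<alpha> P G n M E dec)"

definition GDoF_region :: "bool \<Rightarrow> nat \<Rightarrow> (nat \<Rightarrow> nat \<Rightarrow> real)
    \<Rightarrow> (real \<Rightarrow> (nat \<Rightarrow> nat \<Rightarrow> nat \<Rightarrow> complex) measure) \<Rightarrow> (nat \<Rightarrow> real) set" where
  "GDoF_region is_bc K \<alpha> Gm = {d. (\<forall>k. k \<ge> K \<longrightarrow> d k = 0) \<and>
     (\<exists>R :: real \<Rightarrow> nat \<Rightarrow> real. (\<forall>P>1. achievable is_bc K \<alpha> (Gm P) P (R P)) \<and>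
        (\<forall>k<K. ((\<lambda>P. R P k / log 2 P) \<longlongrightarrow> d k) at_top))}"

definition D_sum_BC :: "nat \<Rightarrow> (nat \<Rightarrow> nat \<Rightarrow> real)
    \<Rightarrow> (real \<Rightarrow> (nat \<Rightarrow> nat \<Rightarrow> nat \<Rightarrow> complex) measure) \<Rightarrow> real" where
  "D_sum_BC K \<alpha> Gm = Sup {(\<Sum>k<K. d k) | d. d \<in> GDoF_region True K \<alpha> Gm}"

definition D_sum_IC :: "nat \<Rightarrow> (nat \<Rightarrow> nat \<Rightarrow> real)
    \<Rightarrow> (real \<Rightarrow> (nat \<Rightarrow> nat \<Rightarrow> nat \<Rightarrow> complex) measure) \<Rightarrow> real" where
  "D_sum_IC K \<alpha> Gm = Sup {(\<Sum>k<K. d k) | d. d \<in> GDoF_region False K \<alpha> Gm}"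

definition is_max :: "real set \<Rightarrow> real \<Rightarrow> bool" where
  "is_max S m \<longleftrightarrow> m \<in> S \<and> (\<forall>x\<in>S. x \<le> m)"

end

theory Submission
  imports Defs "HOL-Real_Asymp.Real_Asymp"
begin

text \<open>Converse: fix a code and let the other codewords be weighted by their likelihood at a receiver;
  with high probability a receiver that decodes is confident, i.e. its own class of codewords carries most of the
  likelihood. Averaging the likelihood at receiver \<open>kb\<close> over its channel coefficients, whose conditional density is
  bounded, turns each Gaussian factor into a Cauchy-type factor in the difference of the codewords, and such a
  factor is dominated by a logarithmic number of Gaussians of the scale \<open>D\<close> by which receiver \<open>ka\<close> is stronger
  (aligned images). Hence passing from one receiver to the next along a path \<open>i\<^sub>1 \<rightarrow> \<dots> \<rightarrow> i\<^sub>M\<close> costs at most the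
  weights \<open>delta\<close> of its edges, and the sum of the broadcast GDoF over the path is at most \<open>\<alpha> i\<^sub>M i\<^sub>M\<close> plus its length.

  The CTIN conditions make \<open>delta\<close> a directed metric with \<open>\<alpha> i i \<le> delta i j + delta j i\<close>. A rotation of a cycle is a path
  that misses one edge of it; averaging its path bounds over all rotations bounds the broadcast sum over the cycle by
  \<open>2 - 1 / K\<close> times its weight. So a broadcast tuple divided by \<open>2 - 1 / K\<close> satisfies the inequalities of the TIN
  polyhedron, and these tuples are achieved in the interference channel by codes of large minimum distance with
  powers given by shortest-path potentials.

  Equality holds for the cyclic channel: its interference channel has sum GDoF 1, whereas a common codeword of
  GDoF \<open>1 - 1 / K\<close> above \<open>K\<close> private ones of GDoF \<open>1 / K\<close> reaches \<open>2 - 1 / K\<close> in the broadcast channel.\<close>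

subsection \<open>Gaussian densities on the complex plane\<close>

definition cnormal_density :: "real \<Rightarrow> complex \<Rightarrow> real" where
  "cnormal_density s z = exp (- (cmod z)\<^sup>2 / s) / (pi * s)"

lemma cnormal_density_pos [simp]: "s > 0 \<Longrightarrow> cnormal_density s z > 0"
  by (simp add: cnormal_density_def)

lemma cnormal_density_nonneg [simp]: "s > 0 \<Longrightarrow> cnormal_density s z \<ge> 0"
  by (rule less_imp_le) simp

lemma cnormal_density_1_le_1: "cnormal_density 1 z \<le> 1"
proof -
  have "exp (- (cmod z)\<^sup>2) \<le> 1" by simp
  also have "1 \<le> pi" using pi_gt3 by linarith
  finally show ?thesis by (simp add: cnormal_density_def)
qed

lemma borel_measurable_cnormal_density [measurable]: "cnormal_density s \<in> borel_measurable borel"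
  unfolding cnormal_density_def by measurable

lemma nn_integral_cnormal_density:
  assumes "s > 0"
  shows "(\<integral>\<^sup>+z. ennreal (cnormal_density s (z - c)) \<partial>lborel) = 1"
proof -
  define \<sigma> where "\<sigma> = sqrt (s / 2)"
  have \<sigma>: "\<sigma> > 0" "2 * \<sigma>\<^sup>2 = s" using assms by (auto simp: \<sigma>_def)
  let ?f = "\<lambda>b x. ennreal (normal_density (c \<bullet> b) \<sigma> x)"
  have "(\<integral>\<^sup>+x. ?f b x \<partial>lborel) = 1" for b
  proof -
    interpret prob_space "density lborel (normal_density (c \<bullet> b) \<sigma>)"
      using \<sigma>(1) by (rule prob_space_normal_density)
    show ?thesis using emeasure_space_1 by (simp add: emeasure_density)
  qed
  moreover have "cnormal_density s (z - c) = (\<Prod>b\<in>Basis. normal_density (c \<bullet> b) \<sigma> (z \<bullet> b))" for z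
  proof -
    have "(cmod (z - c))\<^sup>2 = (Re z - Re c)\<^sup>2 + (Im z - Im c)\<^sup>2"
      by (simp add: cmod_power2)
    moreover have "2 * pi * \<sigma>\<^sup>2 = pi * s" using \<sigma>(2) by simp
    ultimately show ?thesis
      using assms \<sigma>(2)
      by (simp add: cnormal_density_def normal_density_def Basis_complex_def inner_complex_def
          exp_add[symmetric] diff_divide_distrib)
  qed
  ultimately show ?thesis
    by (simp add: prod_ennreal[symmetric] nn_integral_lborel_prod[where f = ?f])
qed

lemma nn_integral_cnormal_density_affine:
  assumes "s > 0" and "h \<noteq> 0"
  shows "(\<integral>\<^sup>+x. ennreal (cnormal_density s (c - h * x)) \<partial>lborel) = ennreal (1 / (cmod h)\<^sup>2)"
proof -
  have "cnormal_density s (c - h * x) = 1 / (cmod h)\<^sup>2 * cnormal_density (s / (cmod h)\<^sup>2) (x - c / h)" for x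
  proof -
    have "c - h * x = - h * (x - c / h)" using assms by (simp add: field_simps)
    then have "(cmod (c - h * x))\<^sup>2 = (cmod (x - c / h))\<^sup>2 * (cmod h)\<^sup>2"
      by (simp only: norm_mult power_mult_distrib norm_minus_cancel mult.commute)
    then show ?thesis using assms by (simp add: cnormal_density_def)
  qed
  then have "(\<integral>\<^sup>+x. ennreal (cnormal_density s (c - h * x)) \<partial>lborel)
      = ennreal (1 / (cmod h)\<^sup>2) * (\<integral>\<^sup>+x. ennreal (cnormal_density (s / (cmod h)\<^sup>2) (x - c / h)) \<partial>lborel)"
    using assms by (simp only: ennreal_mult' zero_le_divide_1_iff zero_le_power2)
      (rule nn_integral_cmult, measurable)
  then show ?thesis using assms by (simp add: nn_integral_cnormal_density)
qed

lemma CN01_eq_density: "CN01 = density lborel (\<lambda>z. ennreal (cnormal_density 1 z))"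
  by (simp add: CN01_def cnormal_density_def)

lemma sets_CN01 [simp, measurable_cong]: "sets CN01 = sets borel"
  by (simp add: CN01_eq_density)

lemma prob_space_CN01: "prob_space CN01"
  using nn_integral_cnormal_density[of 1 0]
  by (intro prob_spaceI) (simp add: CN01_eq_density emeasure_density)

lemma nn_integral_CN01_exp_half: "(\<integral>\<^sup>+z. ennreal (exp ((cmod z)\<^sup>2 / 2)) \<partial>CN01) = 2"
proof -
  have "cnormal_density 1 z * exp ((cmod z)\<^sup>2 / 2) = 2 * cnormal_density 2 (z - 0)" for z
    by (simp add: cnormal_density_def exp_add[symmetric])
  then have "ennreal (cnormal_density 1 z) * ennreal (exp ((cmod z)\<^sup>2 / 2))
      = 2 * ennreal (cnormal_density 2 (z - 0))" for z
    by (metis cnormal_density_nonneg ennreal_mult' ennreal_numeral exp_ge_zero zero_le_numeral zero_less_one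
        ennreal_mult)
  then have "(\<integral>\<^sup>+z. ennreal (exp ((cmod z)\<^sup>2 / 2)) \<partial>CN01)
      = (\<integral>\<^sup>+z. 2 * ennreal (cnormal_density 2 (z - 0)) \<partial>lborel)"
    by (simp add: CN01_eq_density nn_integral_density)
  also have "\<dots> = 2 * (\<integral>\<^sup>+z. ennreal (cnormal_density 2 (z - 0)) \<partial>lborel)"
    by (rule nn_integral_cmult) measurable
  finally show ?thesis by (simp only: nn_integral_cnormal_density zero_less_numeral mult_1_right)
qed

subsection \<open>Finite products of measures\<close>

lemma PiM_density:
  fixes f :: "'i \<Rightarrow> 'a \<Rightarrow> ennreal"
  assumes [simp]: "finite J"
    and M: "product_sigma_finite M" and D: "product_sigma_finite (\<lambda>i. density (M i) (f i))"
    and [measurable]: "\<And>i. i \<in> J \<Longrightarrow> f i \<in> borel_measurable (M i)"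
  shows "PiM J (\<lambda>i. density (M i) (f i)) = density (PiM J M) (\<lambda>x. \<Prod>i\<in>J. f i (x i))"
proof (rule product_sigma_finite.PiM_eqI[OF D, symmetric])
  show "sets (density (PiM J M) (\<lambda>x. \<Prod>i\<in>J. f i (x i))) = sets (PiM J (\<lambda>i. density (M i) (f i)))"
    by (simp cong: sets_PiM_cong)
  fix A assume "\<And>i. i \<in> J \<Longrightarrow> A i \<in> sets (density (M i) (f i))"
  then have A [measurable]: "\<And>i. i \<in> J \<Longrightarrow> A i \<in> sets (M i)" by simp
  have "emeasure (density (PiM J M) (\<lambda>x. \<Prod>i\<in>J. f i (x i))) (Pi\<^sub>E J A)
      = (\<integral>\<^sup>+x. (\<Prod>i\<in>J. f i (x i)) * indicator (Pi\<^sub>E J A) x \<partial>PiM J M)"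
    by (intro emeasure_density) (auto intro!: sets_PiM_I_finite)
  also have "\<dots> = (\<integral>\<^sup>+x. (\<Prod>i\<in>J. f i (x i) * indicator (A i) (x i)) \<partial>PiM J M)"
  proof (intro nn_integral_cong)
    fix x assume "x \<in> space (PiM J M)"
    then have "indicator (Pi\<^sub>E J A) x = (\<Prod>i\<in>J. indicator (A i) (x i) :: ennreal)"
      by (auto simp: indicator_def space_PiM PiE_def Pi_def)
    then show "(\<Prod>i\<in>J. f i (x i)) * indicator (Pi\<^sub>E J A) x = (\<Prod>i\<in>J. f i (x i) * indicator (A i) (x i))"
      by (simp add: prod.distrib)
  qed
  also have "\<dots> = (\<Prod>i\<in>J. \<integral>\<^sup>+z. f i z * indicator (A i) z \<partial>M i)"
    by (rule product_sigma_finite.product_nn_integral_prod[OF M]) measurable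
  also have "\<dots> = (\<Prod>i\<in>J. emeasure (density (M i) (f i)) (A i))"
    by (intro prod.cong refl emeasure_density[symmetric]) auto
  finally show "emeasure (density (PiM J M) (\<lambda>x. \<Prod>i\<in>J. f i (x i))) (Pi\<^sub>E J A)
      = (\<Prod>i\<in>J. emeasure (density (M i) (f i)) (A i))" .
qed simp

lemma distr_PiM_componentwise:
  assumes [simp]: "finite J" and M: "product_sigma_finite M"
    and D: "product_sigma_finite (\<lambda>i. distr (M i) (N i) (T i))"
    and T [measurable]: "\<And>i. i \<in> J \<Longrightarrow> T i \<in> measurable (M i) (N i)"
  shows "distr (PiM J M) (PiM J N) (\<lambda>x. \<lambda>i\<in>J. T i (x i)) = PiM J (\<lambda>i. distr (M i) (N i) (T i))"
proof (rule product_sigma_finite.PiM_eqI[OF D])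
  let ?T = "\<lambda>x. \<lambda>i\<in>J. T i (x i)"
  show "sets (distr (PiM J M) (PiM J N) ?T) = sets (PiM J (\<lambda>i. distr (M i) (N i) (T i)))"
    by (simp cong: sets_PiM_cong)
  fix A assume "\<And>i. i \<in> J \<Longrightarrow> A i \<in> sets (distr (M i) (N i) (T i))"
  then have A: "\<And>i. i \<in> J \<Longrightarrow> A i \<in> sets (N i)" by simp
  have "?T -` (Pi\<^sub>E J A) \<inter> space (PiM J M) = Pi\<^sub>E J (\<lambda>i. T i -` A i \<inter> space (M i))"
    by (auto simp: space_PiM PiE_def Pi_def)
  then have "emeasure (distr (PiM J M) (PiM J N) ?T) (Pi\<^sub>E J A)
      = emeasure (PiM J M) (Pi\<^sub>E J (\<lambda>i. T i -` A i \<inter> space (M i)))"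
    using A by (subst emeasure_distr) (auto intro!: sets_PiM_I_finite measurable_restrict)
  also have "\<dots> = (\<Prod>i\<in>J. emeasure (M i) (T i -` A i \<inter> space (M i)))"
    using A by (intro product_sigma_finite.emeasure_PiM[OF M]) (auto intro!: measurable_sets[OF T])
  also have "\<dots> = (\<Prod>i\<in>J. emeasure (distr (M i) (N i) (T i)) (A i))"
    using A T by (intro prod.cong refl emeasure_distr[symmetric]) auto
  finally show "emeasure (distr (PiM J M) (PiM J N) ?T) (Pi\<^sub>E J A)
      = (\<Prod>i\<in>J. emeasure (distr (M i) (N i) (T i)) (A i))" .
qed simp

lemma nn_integral_PiM_subset_prod:
  assumes [simp]: "finite J" and A: "A \<subseteq> J" and M: "product_sigma_finite M"
    and prob: "\<And>j. j \<in> J - A \<Longrightarrow> prob_space (M j)"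
    and f: "\<And>j. j \<in> A \<Longrightarrow> f j \<in> borel_measurable (M j)"
  shows "(\<integral>\<^sup>+x. (\<Prod>j\<in>A. f j (x j)) \<partial>PiM J M) = (\<Prod>j\<in>A. \<integral>\<^sup>+u. f j u \<partial>M j)"
proof -
  let ?g = "\<lambda>j u. if j \<in> A then f j u else (1 :: ennreal)"
  have "(\<integral>\<^sup>+x. (\<Prod>j\<in>A. f j (x j)) \<partial>PiM J M) = (\<integral>\<^sup>+x. (\<Prod>j\<in>J. ?g j (x j)) \<partial>PiM J M)"
    using A by (intro nn_integral_cong prod.mono_neutral_cong_left) auto
  also have "\<dots> = (\<Prod>j\<in>J. \<integral>\<^sup>+u. ?g j u \<partial>M j)"
  proof (rule product_sigma_finite.product_nn_integral_prod[OF M])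
    show "?g j \<in> borel_measurable (M j)" for j
      using f by (cases "j \<in> A") auto
  qed simp
  also have "\<dots> = (\<Prod>j\<in>A. \<integral>\<^sup>+u. f j u \<partial>M j)"
    using A prob by (intro prod.mono_neutral_cong_right) (auto simp: prob_space.emeasure_space_1)
  finally show ?thesis .
qed

lemma nn_integral_PiM_Un_mult:
  assumes M: "product_sigma_finite M" and fin: "finite A" "finite B" and disj: "A \<inter> B = {}"
    and u: "u \<in> borel_measurable (PiM A M)" and v: "v \<in> borel_measurable (PiM B M)"
  shows "(\<integral>\<^sup>+x. u (restrict x A) * v (restrict x B) \<partial>PiM (A \<union> B) M)
    = (\<integral>\<^sup>+x. u x \<partial>PiM A M) * (\<integral>\<^sup>+y. v y \<partial>PiM B M)"
proof -
  have [measurable]: "(\<lambda>x. u (restrict x A)) \<in> borel_measurable (PiM (A \<union> B) M)"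
      "(\<lambda>x. v (restrict x B)) \<in> borel_measurable (PiM (A \<union> B) M)"
    by (rule measurable_compose[OF measurable_restrict_subset u] measurable_compose[OF measurable_restrict_subset v];
        simp)+
  have "(\<integral>\<^sup>+x. u (restrict x A) * v (restrict x B) \<partial>PiM (A \<union> B) M) = (\<integral>\<^sup>+x. \<integral>\<^sup>+y.
      u (restrict (merge A B (x, y)) A) * v (restrict (merge A B (x, y)) B) \<partial>PiM B M \<partial>PiM A M)"
    by (rule product_sigma_finite.product_nn_integral_fold[OF M disj fin]) measurable
  also have "\<dots> = (\<integral>\<^sup>+x. \<integral>\<^sup>+y. u x * v y \<partial>PiM B M \<partial>PiM A M)"
  proof (intro nn_integral_cong)
    fix x y assume "x \<in> space (PiM A M)" "y \<in> space (PiM B M)"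
    then have "x \<in> extensional A" "y \<in> extensional B" by (simp_all add: space_PiM PiE_def)
    then show "u (restrict (merge A B (x, y)) A) * v (restrict (merge A B (x, y)) B) = u x * v y"
      using disj by (simp add: extensional_restrict)
  qed
  also have "\<dots> = (\<integral>\<^sup>+x. u x \<partial>PiM A M) * (\<integral>\<^sup>+y. v y \<partial>PiM B M)"
    using u v by (simp add: nn_integral_cmult nn_integral_multc)
  finally show ?thesis .
qed

subsection \<open>Noise\<close>

text \<open>The noise law with the noise of receiver \<open>k\<close> replaced by Lebesgue measure, so that outputs of receiver \<open>k\<close>
  have densities with respect to it and it is invariant under adding a signal to the noise of receiver \<open>k\<close>.\<close>
definition noise_reference :: "nat \<Rightarrow> nat \<Rightarrow> nat \<Rightarrow> (nat \<times> nat \<Rightarrow> complex) measure" where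
  "noise_reference n K k = PiM ({..<n} \<times> {..<K}) (\<lambda>j. if snd j = k then lborel else CN01)"

definition add_signal :: "nat \<Rightarrow> nat \<Rightarrow> nat \<Rightarrow> (nat \<Rightarrow> complex) \<Rightarrow> (nat \<times> nat \<Rightarrow> complex) \<Rightarrow> nat \<times> nat \<Rightarrow> complex" where
  "add_signal n K k s z = (\<lambda>j\<in>{..<n} \<times> {..<K}. if snd j = k then s (fst j) + z j else z j)"

lemma add_signal_apply [simp]: "t < n \<Longrightarrow> k < K \<Longrightarrow> add_signal n K k s z (t, k) = s t + z (t, k)"
  by (simp add: add_signal_def)

lemma sigma_finite_CN01: "sigma_finite_measure CN01"
  using prob_space_CN01 by (simp add: prob_space_def finite_measure_def)

lemma product_sigma_finite_CN01: "product_sigma_finite (\<lambda>_. CN01)"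
  by (simp add: product_sigma_finite_def sigma_finite_CN01)

lemma product_sigma_finite_reference: "product_sigma_finite (\<lambda>j. if snd j = k then lborel else CN01)"
  by (simp add: product_sigma_finite_def sigma_finite_CN01 sigma_finite_lborel)

lemma prob_space_noise: "prob_space (noise n K)"
  unfolding noise_def by (rule prob_space_PiM) (rule prob_space_CN01)

lemma sets_noise_reference [measurable_cong]: "sets (noise_reference n K k) = sets (noise n K)"
  unfolding noise_def noise_reference_def by (rule sets_PiM_cong) auto

lemma measurable_noise_component:
  assumes "t < n" and "k < K"
  shows "(\<lambda>z. z (t, k)) \<in> borel_measurable (noise n K)"
  using measurable_component_singleton[of "(t, k)" "{..<n} \<times> {..<K}" "\<lambda>_. CN01"] assms
  by (simp add: noise_def cong: measurable_cong_sets)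

lemma measurable_noise_reference_component:
  assumes "k < K" and "t \<in> {..<n}"
  shows "(\<lambda>z. z (t, k)) \<in> borel_measurable (noise_reference n K k')"
  using measurable_noise_component[of t n k K] assms
  by (simp cong: measurable_cong_sets add: sets_noise_reference)

lemma measurable_add_signal: "add_signal n K k s \<in> measurable (noise_reference n K k) (noise n K)"
  unfolding add_signal_def noise_def
proof (rule measurable_restrict)
  fix j assume j: "j \<in> {..<n} \<times> {..<K}"
  then have [measurable]: "(\<lambda>z. z j) \<in> borel_measurable (noise_reference n K k)"
    using measurable_noise_reference_component[of "snd j" K "fst j" n k] by auto
  show "(\<lambda>z. if snd j = k then s (fst j) + z j else z j) \<in> measurable (noise_reference n K k) CN01"
    by measurable
qed

lemma prod_receiver_row:
  assumes "k < K"
  shows "(\<Prod>j\<in>{..<n} \<times> {k}. f (fst j) (x j)) = (\<Prod>t<n. f t (x (t, k)))"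
proof -
  have "{..<n} \<times> {k} = (\<lambda>t. (t, k)) ` {..<n}" by auto
  then show ?thesis by (simp add: prod.reindex inj_on_def)
qed

lemma nn_integral_receiver_prod:
  fixes f :: "nat \<Rightarrow> complex \<Rightarrow> ennreal" and M :: "nat \<times> nat \<Rightarrow> complex measure"
  assumes k: "k < K" and M: "product_sigma_finite M"
    and prob: "\<And>j. snd j \<noteq> k \<Longrightarrow> prob_space (M j)"
    and f: "\<And>t. t < n \<Longrightarrow> f t \<in> borel_measurable (M (t, k))"
  shows "(\<integral>\<^sup>+x. (\<Prod>t<n. f t (x (t, k))) \<partial>PiM ({..<n} \<times> {..<K}) M) = (\<Prod>t<n. \<integral>\<^sup>+u. f t u \<partial>M (t, k))"
proof -
  have "(\<integral>\<^sup>+x. (\<Prod>j\<in>{..<n} \<times> {k}. f (fst j) (x j)) \<partial>PiM ({..<n} \<times> {..<K}) M)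
      = (\<Prod>j\<in>{..<n} \<times> {k}. \<integral>\<^sup>+u. f (fst j) u \<partial>M j)"
    using k f by (intro nn_integral_PiM_subset_prod M) (auto intro: prob)
  also have "\<dots> = (\<Prod>t<n. \<integral>\<^sup>+u. f t u \<partial>M (t, k))"
    using prod_receiver_row[OF k, where f = "\<lambda>t j. \<integral>\<^sup>+u. f t u \<partial>M j" and x = id] by simp
  finally show ?thesis by (simp only: prod_receiver_row[OF k])
qed

lemma nn_integral_noise_reference_prod:
  assumes "k < K" and "\<And>t. t < n \<Longrightarrow> f t \<in> borel_measurable borel"
  shows "(\<integral>\<^sup>+y. (\<Prod>t<n. f t (y (t, k))) \<partial>noise_reference n K k) = (\<Prod>t<n. \<integral>\<^sup>+u. f t u \<partial>lborel)"
  unfolding noise_reference_def using assms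
  by (subst nn_integral_receiver_prod) (auto simp: product_sigma_finite_reference prob_space_CN01)

lemma noise_eq_density:
  assumes k: "k < K"
  shows "noise n K = density (noise_reference n K k) (\<lambda>y. ennreal (\<Prod>t<n. cnormal_density 1 (y (t, k))))"
proof -
  let ?M = "\<lambda>j. if snd j = k then lborel else CN01"
  let ?f = "\<lambda>j u. if snd j = k then ennreal (cnormal_density 1 u) else 1"
  have CN01: "CN01 = density (?M j) (?f j)" for j :: "nat \<times> nat"
    by (cases "snd j = k") (simp_all add: CN01_eq_density[symmetric] density_1)
  have "noise n K = PiM ({..<n} \<times> {..<K}) (\<lambda>j. density (?M j) (?f j))"
    by (simp add: noise_def CN01[symmetric])
  also have "\<dots> = density (noise_reference n K k) (\<lambda>y. \<Prod>j\<in>{..<n} \<times> {..<K}. ?f j (y j))"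
    unfolding noise_reference_def
    by (rule PiM_density) (auto simp: CN01[symmetric] product_sigma_finite_reference product_sigma_finite_CN01)
  also have "(\<lambda>y. \<Prod>j\<in>{..<n} \<times> {..<K}. ?f j (y j)) = (\<lambda>y. ennreal (\<Prod>t<n. cnormal_density 1 (y (t, k))))"
  proof
    fix y
    have "(\<Prod>j\<in>{..<n} \<times> {..<K}. ?f j (y j)) = (\<Prod>j\<in>{..<n} \<times> {k}. ennreal (cnormal_density 1 (y j)))"
      using k by (intro prod.mono_neutral_cong_right) auto
    then show "(\<Prod>j\<in>{..<n} \<times> {..<K}. ?f j (y j)) = ennreal (\<Prod>t<n. cnormal_density 1 (y (t, k)))"
      by (simp add: prod_receiver_row[OF k, where f = "\<lambda>_ u. ennreal (cnormal_density 1 u)"] prod_ennreal)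
  qed
  finally show ?thesis .
qed

lemma nn_integral_noise_reference_add_signal:
  assumes f: "f \<in> borel_measurable (noise n K)"
  shows "(\<integral>\<^sup>+y. f (add_signal n K k s y) \<partial>noise_reference n K k) = (\<integral>\<^sup>+y. f y \<partial>noise_reference n K k)"
proof -
  let ?M = "\<lambda>j. if snd j = k then lborel else CN01"
  define T where "T j = (\<lambda>u. if snd j = k then s (fst j) + u else u)" for j :: "nat \<times> nat"
  have T: "distr (?M j) (?M j) (T j) = ?M j" for j
  proof (cases "snd j = k")
    case True
    have "distr lborel lborel ((+) (s (fst j))) = distr lborel borel ((+) (s (fst j)))"
      by (rule distr_cong) auto
    with True show ?thesis by (simp add: T_def lborel_distr_plus)
  next
    case False
    then show ?thesis by (simp add: T_def distr_id)
  qed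
  have "distr (noise_reference n K k) (noise_reference n K k) (\<lambda>y. \<lambda>j\<in>{..<n} \<times> {..<K}. T j (y j))
      = PiM ({..<n} \<times> {..<K}) (\<lambda>j. distr (?M j) (?M j) (T j))"
    unfolding noise_reference_def
    by (rule distr_PiM_componentwise) (simp_all add: T product_sigma_finite_reference, simp_all add: T_def)
  then have "distr (noise_reference n K k) (noise_reference n K k) (add_signal n K k s) = noise_reference n K k"
    unfolding T by (simp add: noise_reference_def T_def add_signal_def[abs_def])
  then have "(\<integral>\<^sup>+y. f y \<partial>noise_reference n K k)
      = (\<integral>\<^sup>+y. f y \<partial>distr (noise_reference n K k) (noise_reference n K k) (add_signal n K k s))"
    by simp
  also have "\<dots> = (\<integral>\<^sup>+y. f (add_signal n K k s y) \<partial>noise_reference n K k)"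
    using measurable_add_signal f
    by (intro nn_integral_distr) (simp_all add: sets_noise_reference cong: measurable_cong_sets)
  finally show ?thesis ..
qed

lemma nn_integral_noise_eq_output:
  assumes k: "k < K" and [measurable]: "f \<in> borel_measurable (noise n K)"
  shows "(\<integral>\<^sup>+z. f z \<partial>noise n K) = (\<integral>\<^sup>+y. ennreal (\<Prod>t<n. cnormal_density 1 (y (t, k) - s t)) *
      f (add_signal n K k (\<lambda>t. - s t) y) \<partial>noise_reference n K k)"
proof -
  note [measurable] = measurable_noise_component[OF _ k] measurable_add_signal
  have "(\<integral>\<^sup>+z. f z \<partial>noise n K)
      = (\<integral>\<^sup>+y. ennreal (\<Prod>t<n. cnormal_density 1 (y (t, k))) * f y \<partial>noise_reference n K k)"
    using k by (subst noise_eq_density[OF k], subst nn_integral_density) measurable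
  also have "\<dots> = (\<integral>\<^sup>+y. ennreal (\<Prod>t<n. cnormal_density 1 (add_signal n K k (\<lambda>t. - s t) y (t, k))) *
      f (add_signal n K k (\<lambda>t. - s t) y) \<partial>noise_reference n K k)"
    using k by (intro nn_integral_noise_reference_add_signal[symmetric]) measurable
  finally show ?thesis using k by simp
qed

text \<open>Chernoff bound with exponent \<open>1 / 2\<close>.\<close>
lemma noise_energy_tail:
  assumes k: "k < K"
  shows "emeasure (noise n K) {z \<in> space (noise n K). (\<Sum>t<n. (cmod (z (t, k)))\<^sup>2) > c * real n}
     \<le> ennreal ((2 * exp (- c / 2)) ^ n)"
proof -
  define e where "e z = (\<Sum>t<n. (cmod (z (t, k)))\<^sup>2)" for z :: "nat \<times> nat \<Rightarrow> complex"
  have [measurable]: "(\<lambda>z. z (t, k)) \<in> borel_measurable (noise n K)" if "t \<in> {..<n}" for t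
    using that k by (intro measurable_noise_component) auto
  have e [measurable]: "e \<in> borel_measurable (noise n K)" unfolding e_def by measurable
  have "emeasure (noise n K) {z \<in> space (noise n K). e z > c * real n}
      \<le> emeasure (noise n K) {z \<in> space (noise n K). e z \<ge> c * real n}"
    by (intro emeasure_mono) auto
  also have "\<dots> \<le> ennreal (exp (- (1 / 2) * (c * real n))) *
      (\<integral>\<^sup>+z. ennreal (exp (1 / 2 * e z)) * indicator (space (noise n K)) z \<partial>noise n K)"
    by (rule Chernoff_ineq_nn_integral_ge) (auto intro: measurable_compose[OF e])
  also have "(\<integral>\<^sup>+z. ennreal (exp (1 / 2 * e z)) * indicator (space (noise n K)) z \<partial>noise n K)
      = (\<integral>\<^sup>+z. (\<Prod>t<n. ennreal (exp ((cmod (z (t, k)))\<^sup>2 / 2))) \<partial>noise n K)"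
    by (intro nn_integral_cong) (simp add: e_def sum_divide_distrib exp_sum prod_ennreal)
  also have "\<dots> = (\<Prod>t<n. \<integral>\<^sup>+u. ennreal (exp ((cmod u)\<^sup>2 / 2)) \<partial>CN01)"
    unfolding noise_def using k product_sigma_finite_CN01 prob_space_CN01
    by (subst nn_integral_receiver_prod[where f = "\<lambda>_ u. ennreal (exp ((cmod u)\<^sup>2 / 2))"])
      (auto cong: measurable_cong_sets)
  also have "\<dots> = ennreal (2 ^ n)"
    by (simp add: nn_integral_CN01_exp_half ennreal_power[symmetric])
  also have "ennreal (exp (- (1 / 2) * (c * real n))) * ennreal (2 ^ n) = ennreal ((2 * exp (- c / 2)) ^ n)"
    by (simp add: ennreal_mult[symmetric] power_mult_distrib exp_of_nat_mult[symmetric] mult_ac)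
  finally show ?thesis by (simp add: e_def)
qed

subsection \<open>Posterior weights\<close>

definition posterior :: "('w \<times> 'w) set \<Rightarrow> ('w \<Rightarrow> real) \<Rightarrow> 'w \<Rightarrow> real" where
  "posterior R p w = p w / (\<Sum>w'\<in>R `` {w}. p w')"

lemma sum_quotient:
  assumes "finite W" and "equiv W R"
  shows "(\<Sum>C\<in>W // R. \<Sum>w\<in>C. f w) = (\<Sum>w\<in>W. f w)"
proof -
  have "sum f (\<Union>(W // R)) = (\<Sum>C\<in>W // R. \<Sum>w\<in>C. f w)"
    using assms quotient_disj[OF assms(2)] finite_equiv_class[OF assms(1) equiv_type[OF assms(2)]]
    by (subst sum.Union_disjoint) auto
  then show ?thesis by (simp add: Union_quotient[OF assms(2)])
qed

lemma finite_Image_equiv: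
  assumes "finite W" and "equiv W R"
  shows "finite (R `` {w})"
  using equiv_type[OF assms(2)] by (intro finite_subset[OF _ assms(1)]) auto

lemma sum_class_pos:
  fixes p :: "'w \<Rightarrow> real"
  assumes "finite W" and R: "equiv W R" and pos: "\<And>w. p w > 0" and "w \<in> W"
  shows "(\<Sum>w'\<in>R `` {w}. p w') > 0"
proof (rule sum_pos)
  show "finite (R `` {w})" using assms by (intro finite_Image_equiv)
  show "R `` {w} \<noteq> {}" using equiv_class_self[OF R \<open>w \<in> W\<close>] by blast
qed (rule pos)

lemma sum_posterior_mult_class_sum:
  fixes h :: "'w \<Rightarrow> ennreal"
  assumes W: "finite W" and R: "equiv W R" and pos: "\<And>w. p w > 0"
  shows "(\<Sum>w\<in>W. ennreal (posterior R p w) * (\<Sum>w'\<in>R `` {w}. h w')) = (\<Sum>w\<in>W. h w)"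
proof -
  have "(\<Sum>w\<in>C. ennreal (posterior R p w) * (\<Sum>w'\<in>R `` {w}. h w')) = (\<Sum>w\<in>C. h w)" if C: "C \<in> W // R" for C
  proof -
    obtain v where v: "v \<in> W" "C = R `` {v}" using C by (auto elim: quotientE)
    have class_eq: "R `` {w} = C" if "w \<in> C" for w
      using that equiv_class_eq[OF R] v(2) by blast
    have class_sum_pos: "(\<Sum>w\<in>C. p w) > 0" unfolding v(2) by (rule sum_class_pos[OF W R pos v(1)])
    have "(\<Sum>w\<in>C. ennreal (posterior R p w)) = ennreal (\<Sum>w\<in>C. p w / (\<Sum>w'\<in>C. p w'))"
      using pos by (subst sum_ennreal[symmetric]) (auto simp: posterior_def class_eq less_imp_le sum_nonneg)
    also have "\<dots> = 1" using class_sum_pos by (simp add: sum_divide_distrib[symmetric])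
    finally show ?thesis by (simp add: class_eq sum_distrib_right[symmetric])
  qed
  then show ?thesis by (simp add: sum_quotient[OF W R, symmetric])
qed

lemma sum_low_posterior_le:
  fixes p :: "'w \<Rightarrow> real"
  assumes W: "finite W" and R: "equiv W R" and Q: "Q \<subseteq> R" and pos: "\<And>w. p w > 0" and c: "c \<ge> 0"
    and B: "B \<subseteq> W" "\<And>w w'. w \<in> B \<Longrightarrow> w' \<in> B \<Longrightarrow> (w, w') \<in> R \<Longrightarrow> (w, w') \<in> Q"
    and low: "\<And>w. w \<in> B \<Longrightarrow> (\<Sum>w'\<in>Q `` {w}. p w') < c * (\<Sum>w'\<in>R `` {w}. p w')"
  shows "(\<Sum>w\<in>B. p w) \<le> c * (\<Sum>w\<in>W. p w)"
proof -
  have "(\<Sum>w\<in>C. if w \<in> B then p w else 0) \<le> c * (\<Sum>w\<in>C. p w)" if "C \<in> W // R" for C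
  proof (cases "B \<inter> C = {}")
    case True
    then have "(\<Sum>w\<in>C. if w \<in> B then p w else 0) = 0" by (intro sum.neutral) auto
    then show ?thesis using c pos by (simp add: sum_nonneg less_imp_le)
  next
    case False
    then obtain v where v: "v \<in> B" "v \<in> C" by blast
    then have C: "C = R `` {v}" using that equiv_class_eq[OF R] by (auto elim!: quotientE)
    have finite_C: "finite C" unfolding C by (rule finite_Image_equiv[OF W R])
    have "(\<Sum>w\<in>C. if w \<in> B then p w else 0) = (\<Sum>w\<in>C \<inter> B. p w)"
      by (rule sum.inter_restrict[OF finite_C, symmetric])
    also have "\<dots> \<le> (\<Sum>w\<in>Q `` {v}. p w)"
    proof (rule sum_mono2)
      show "finite (Q `` {v})" using finite_C C Q by (meson Image_mono finite_subset order_refl)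
      show "C \<inter> B \<subseteq> Q `` {v}" using B(2)[OF v(1)] C by auto
    qed (simp add: pos less_imp_le)
    also have "\<dots> \<le> c * (\<Sum>w\<in>C. p w)" using low[OF v(1)] C by simp
    finally show ?thesis .
  qed
  then have "(\<Sum>w\<in>W. if w \<in> B then p w else 0) \<le> c * (\<Sum>w\<in>W. p w)"
    by (simp add: sum_quotient[OF W R, symmetric] sum_distrib_left sum_mono)
  then show ?thesis using B(1) W by (simp add: sum.inter_restrict[symmetric] Int_absorb1)
qed

lemma sum_nn_integral_posterior:
  fixes p :: "'w \<Rightarrow> 'a \<Rightarrow> real" and h :: "'w \<Rightarrow> 'a \<Rightarrow> ennreal"
  assumes W: "finite W" and R: "equiv W R" and pos: "\<And>w y. p w y > 0"
    and [measurable]: "\<And>w. p w \<in> borel_measurable M" and [measurable]: "\<And>w. h w \<in> borel_measurable M"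
  shows "(\<Sum>w\<in>W. \<integral>\<^sup>+y. ennreal (posterior R (\<lambda>w. p w y) w) * (\<Sum>w'\<in>R `` {w}. h w' y) \<partial>M)
    = (\<Sum>w\<in>W. \<integral>\<^sup>+y. h w y \<partial>M)"
proof -
  have [measurable]: "(\<lambda>y. posterior R (\<lambda>w. p w y) w) \<in> borel_measurable M" for w
    unfolding posterior_def by measurable
  show ?thesis
    by (simp add: nn_integral_sum[symmetric] sum_posterior_mult_class_sum[OF W R] pos)
qed

lemma sum_nn_integral_low_posterior_le:
  fixes p :: "'w \<Rightarrow> 'a \<Rightarrow> real"
  assumes W: "finite W" and R: "equiv W R" and Q: "Q \<subseteq> R" and pos: "\<And>w y. p w y > 0" and c: "c \<ge> 0"
    and [measurable]: "\<And>w. p w \<in> borel_measurable M" and T [measurable]: "\<And>w. w \<in> W \<Longrightarrow> T w \<in> sets M"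
    and dec: "\<And>w w' y. w \<in> W \<Longrightarrow> w' \<in> W \<Longrightarrow> y \<in> T w \<Longrightarrow> y \<in> T w' \<Longrightarrow> (w, w') \<in> R \<Longrightarrow> (w, w') \<in> Q"
  shows "(\<Sum>w\<in>W. \<integral>\<^sup>+y. ennreal (p w y) *
      indicator {y \<in> T w. (\<Sum>w'\<in>Q `` {w}. p w' y) < c * (\<Sum>w'\<in>R `` {w}. p w' y)} y \<partial>M)
    \<le> ennreal c * (\<Sum>w\<in>W. \<integral>\<^sup>+y. ennreal (p w y) \<partial>M)"
proof -
  define low where "low w y \<longleftrightarrow> (\<Sum>w'\<in>Q `` {w}. p w' y) < c * (\<Sum>w'\<in>R `` {w}. p w' y)" for w y
  have [measurable]: "Measurable.pred M (low w)" for w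
    unfolding low_def by measurable
  have sets: "{y \<in> T w. low w y} \<in> sets M" if "w \<in> W" for w
  proof -
    have "{y \<in> T w. low w y} = T w \<inter> {y \<in> space M. low w y}"
      using sets.sets_into_space[OF T[OF that]] by blast
    also have "\<dots> \<in> sets M" using T[OF that] by (rule sets.Int) measurable
    finally show ?thesis .
  qed
  have "(\<Sum>w\<in>W. \<integral>\<^sup>+y. ennreal (p w y) * indicator {y \<in> T w. low w y} y \<partial>M)
      = (\<integral>\<^sup>+y. (\<Sum>w\<in>W. ennreal (p w y) * indicator {y \<in> T w. low w y} y) \<partial>M)"
    using sets by (intro nn_integral_sum[symmetric]) measurable
  also have "\<dots> \<le> (\<integral>\<^sup>+y. ennreal c * (\<Sum>w\<in>W. ennreal (p w y)) \<partial>M)"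
  proof (rule nn_integral_mono)
    fix y
    define B where "B = {w \<in> W. y \<in> T w \<and> low w y}"
    have "(\<Sum>w\<in>W. ennreal (p w y) * indicator {y \<in> T w. low w y} y) = (\<Sum>w\<in>B. ennreal (p w y))"
      using W unfolding B_def by (intro sum.mono_neutral_cong_right) (auto simp: indicator_def)
    also have "\<dots> = ennreal (\<Sum>w\<in>B. p w y)"
      using pos by (intro sum_ennreal) (auto intro: less_imp_le)
    also have "\<dots> \<le> ennreal (c * (\<Sum>w\<in>W. p w y))"
      using dec by (intro ennreal_leI sum_low_posterior_le[OF W R Q pos c]) (auto simp: B_def low_def)
    also have "\<dots> = ennreal c * (\<Sum>w\<in>W. ennreal (p w y))"
      using c pos by (simp add: ennreal_mult' sum_ennreal less_imp_le)
    finally show "(\<Sum>w\<in>W. ennreal (p w y) * indicator {y \<in> T w. low w y} y)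
      \<le> ennreal c * (\<Sum>w\<in>W. ennreal (p w y))" .
  qed
  also have "\<dots> = ennreal c * (\<Sum>w\<in>W. \<integral>\<^sup>+y. ennreal (p w y) \<partial>M)"
    by (simp add: nn_integral_cmult nn_integral_sum)
  finally show ?thesis by (simp only: low_def)
qed

subsection \<open>Gaussian averages over a disc\<close>

lemma borel_measurable_indicator_cball [measurable]:
  "(indicator (cball c d) :: complex \<Rightarrow> ennreal) \<in> borel_measurable borel"
  by (intro borel_measurable_indicator borel_closed) simp

definition disc_lborel :: "real \<Rightarrow> complex measure" where
  "disc_lborel d = density lborel (indicator (cball 0 d))"

lemma sets_disc_lborel [simp, measurable_cong]: "sets (disc_lborel d) = sets borel"
  by (simp add: disc_lborel_def)

lemma emeasure_cball_complex:
  assumes "d \<ge> 0"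
  shows "emeasure lborel (cball (0 :: complex) d) = ennreal (pi * d\<^sup>2)"
  using assms by (simp add: emeasure_cball unit_ball_vol_2)

lemma emeasure_disc_lborel_space:
  assumes "d \<ge> 0"
  shows "emeasure (disc_lborel d) (space (disc_lborel d)) = ennreal (pi * d\<^sup>2)"
  using assms by (subst disc_lborel_def, subst emeasure_density)
    (simp_all add: disc_lborel_def emeasure_cball_complex)

lemma product_sigma_finite_disc_lborel:
  assumes "d \<ge> 0"
  shows "product_sigma_finite (\<lambda>_. disc_lborel d)"
proof -
  have "finite_measure (disc_lborel d)"
    by standard (simp add: emeasure_disc_lborel_space[OF assms])
  then show ?thesis by (simp add: product_sigma_finite_def finite_measure_def)
qed

lemma nn_integral_cnormal_density_disc_le:
  assumes d: "d \<ge> 0"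
  shows "(\<integral>\<^sup>+x. ennreal (cnormal_density 1 (c - h * x)) \<partial>disc_lborel d)
    \<le> ennreal ((pi * d\<^sup>2 + 1) / (1 + (cmod h)\<^sup>2))"
proof -
  let ?I = "\<integral>\<^sup>+x. ennreal (cnormal_density 1 (c - h * x)) \<partial>disc_lborel d"
  have [measurable]: "(\<lambda>x. cnormal_density 1 (c - h * x)) \<in> borel_measurable borel"
    by (rule measurable_compose[OF _ borel_measurable_cnormal_density]) simp
  have I: "?I = (\<integral>\<^sup>+x. indicator (cball 0 d) x * ennreal (cnormal_density 1 (c - h * x)) \<partial>lborel)"
    unfolding disc_lborel_def by (rule nn_integral_density) simp_all
  have "?I \<le> (\<integral>\<^sup>+x. 1 \<partial>disc_lborel d)"
    using cnormal_density_1_le_1 by (intro nn_integral_mono) simp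
  then have le: "?I \<le> ennreal (pi * d\<^sup>2)" using d by (simp add: emeasure_disc_lborel_space)
  then have "?I < top" by (rule le_less_trans) simp
  then obtain v where v: "?I = ennreal v" "0 \<le> v" by (cases ?I) auto
  with le have v_le: "v \<le> pi * d\<^sup>2" by simp
  have "v * (cmod h)\<^sup>2 \<le> 1"
  proof (cases "h = 0")
    case False
    have "?I \<le> (\<integral>\<^sup>+x. ennreal (cnormal_density 1 (c - h * x)) \<partial>lborel)"
      unfolding I by (intro nn_integral_mono) (auto simp: indicator_def)
    with False v have "v \<le> 1 / (cmod h)\<^sup>2"
      by (simp add: nn_integral_cnormal_density_affine)
    with False show ?thesis by (simp add: field_simps)
  qed simp
  with v_le have "v * (1 + (cmod h)\<^sup>2) \<le> pi * d\<^sup>2 + 1"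
    by (simp add: algebra_simps)
  then have "v \<le> (pi * d\<^sup>2 + 1) / (1 + (cmod h)\<^sup>2)"
    by (simp add: pos_le_divide_eq add_pos_nonneg)
  then show ?thesis using v(1) by (simp add: ennreal_leI)
qed

lemma product_sigma_finite_lborel: "product_sigma_finite (\<lambda>_. lborel :: 'a :: euclidean_space measure)"
  by (simp add: product_sigma_finite_def sigma_finite_lborel)

lemma borel_measurable_prod_indicator_cball:
  "(\<lambda>x. \<Prod>j\<in>A. indicator (cball c d) (x j) :: ennreal) \<in> borel_measurable (PiM A (\<lambda>_. lborel :: complex measure))"
  by (intro borel_measurable_prod_ennreal measurable_compose[OF measurable_component_singleton]) auto

lemma nn_integral_PiM_disc_lborel:
  assumes A: "finite A" and d: "d \<ge> 0" and u: "u \<in> borel_measurable (PiM A (\<lambda>_. lborel))"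
  shows "(\<integral>\<^sup>+x. u x \<partial>PiM A (\<lambda>_. disc_lborel d))
    = (\<integral>\<^sup>+x. (\<Prod>j\<in>A. indicator (cball 0 d) (x j)) * u x \<partial>PiM A (\<lambda>_. lborel))"
proof -
  have "PiM A (\<lambda>_. disc_lborel d) = density (PiM A (\<lambda>_. lborel)) (\<lambda>x. \<Prod>j\<in>A. indicator (cball 0 d) (x j))"
    using A product_sigma_finite_disc_lborel[OF d] product_sigma_finite_lborel
    unfolding disc_lborel_def by (subst PiM_density) auto
  then show ?thesis using u borel_measurable_prod_indicator_cball by (simp add: nn_integral_density)
qed

lemma nn_integral_PiM_disc_prod_le:
  assumes d: "d \<ge> 0" and T: "finite T" and \<sigma>: "inj_on \<sigma> T"
  shows "(\<integral>\<^sup>+y. (\<Prod>t\<in>T. ennreal (cnormal_density 1 (b t - h t * y (\<sigma> t)))) \<partial>PiM (\<sigma> ` T) (\<lambda>_. disc_lborel d))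
    \<le> (\<Prod>t\<in>T. ennreal ((pi * d\<^sup>2 + 1) / (1 + (cmod (h t))\<^sup>2)))"
proof -
  define f where "f t u = ennreal (cnormal_density 1 (b t - h t * u))" for t u
  have f: "f t \<in> borel_measurable (disc_lborel d)" for t
    unfolding f_def by measurable
  have "(\<integral>\<^sup>+y. (\<Prod>t\<in>T. f t (y (\<sigma> t))) \<partial>PiM (\<sigma> ` T) (\<lambda>_. disc_lborel d))
      = (\<integral>\<^sup>+y. (\<Prod>j\<in>\<sigma> ` T. f (the_inv_into T \<sigma> j) (y j)) \<partial>PiM (\<sigma> ` T) (\<lambda>_. disc_lborel d))"
    using \<sigma> by (simp add: prod.reindex the_inv_into_f_f)
  also have "\<dots> = (\<Prod>j\<in>\<sigma> ` T. \<integral>\<^sup>+u. f (the_inv_into T \<sigma> j) u \<partial>disc_lborel d)"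
    using f T by (intro product_sigma_finite.product_nn_integral_prod[OF product_sigma_finite_disc_lborel[OF d]]) auto
  also have "\<dots> = (\<Prod>t\<in>T. \<integral>\<^sup>+u. f t u \<partial>disc_lborel d)"
    using \<sigma> by (simp add: prod.reindex the_inv_into_f_f)
  also have "\<dots> \<le> (\<Prod>t\<in>T. ennreal ((pi * d\<^sup>2 + 1) / (1 + (cmod (h t))\<^sup>2)))"
    unfolding f_def by (intro prod_mono_ennreal nn_integral_cnormal_density_disc_le d)
  finally show ?thesis by (simp only: f_def)
qed

lemma prod_divide_mult_power_le:
  fixes V :: real
  assumes "V \<ge> 0" and "\<And>t. t \<in> T \<Longrightarrow> q t \<ge> 0"
  shows "(\<Prod>t\<in>T. (V + 1) / q t) * V ^ m \<le> (V + 1) ^ (m + card T) * (\<Prod>t\<in>T. 1 / q t)"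
proof -
  have "(\<Prod>t\<in>T. (V + 1) / q t) = (V + 1) ^ card T * (\<Prod>t\<in>T. 1 / q t)"
    by (simp add: prod_dividef)
  moreover have "V ^ m \<le> (V + 1) ^ m" using assms(1) by (intro power_mono) auto
  ultimately show ?thesis
    using assms by (simp add: power_add mult_ac mult_left_mono mult_right_mono prod_nonneg)
qed

lemma sum_mult_merge:
  fixes c :: "'j \<Rightarrow> 'a :: comm_semiring_0"
  assumes "finite A" "finite B" "A \<inter> B = {}"
  shows "(\<Sum>j\<in>A \<union> B. c j * merge A B (x, y) j) = (\<Sum>j\<in>A. c j * x j) + (\<Sum>j\<in>B. c j * y j)"
  unfolding sum.union_disjoint[OF assms] using assms(3)
  by (intro arg_cong2[where f = "(+)"] sum.cong) auto

lemma nn_integral_PiM_disc_affine_le: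
  fixes c :: "'t \<Rightarrow> 'j \<Rightarrow> complex"
  assumes d: "d \<ge> 0" and T: "finite T" and J: "finite J" and \<sigma>: "inj_on \<sigma> T" "\<sigma> ` T \<subseteq> J"
    and diag: "\<And>t t'. t \<in> T \<Longrightarrow> t' \<in> T \<Longrightarrow> t \<noteq> t' \<Longrightarrow> c t (\<sigma> t') = 0"
  shows "(\<integral>\<^sup>+x. (\<Prod>t\<in>T. ennreal (cnormal_density 1 (z t - (\<Sum>j\<in>J. c t j * x j)))) \<partial>PiM J (\<lambda>_. disc_lborel d))
    \<le> ennreal ((pi * d\<^sup>2 + 1) ^ card J * (\<Prod>t\<in>T. 1 / (1 + (cmod (c t (\<sigma> t)))\<^sup>2)))"
proof -
  define A where "A = J - \<sigma> ` T"
  have J_eq: "J = A \<union> \<sigma> ` T" and disj: "A \<inter> \<sigma> ` T = {}" and fin: "finite A" "finite (\<sigma> ` T)"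
    using \<sigma> T J by (auto simp: A_def)
  define F where "F x = (\<Prod>t\<in>T. ennreal (cnormal_density 1 (z t - (\<Sum>j\<in>J. c t j * x j))))" for x
  define V where "V = pi * d\<^sup>2"
  have V: "V \<ge> 0" by (simp add: V_def)
  have F: "F \<in> borel_measurable (PiM J (\<lambda>_. disc_lborel d))"
    unfolding F_def by measurable
  have sum_eq: "(\<Sum>j\<in>J. c t j * merge A (\<sigma> ` T) (x, y) j) = (\<Sum>j\<in>A. c t j * x j) + c t (\<sigma> t) * y (\<sigma> t)"
    if t: "t \<in> T" for x y t
  proof -
    have "(\<Sum>j\<in>J. c t j * merge A (\<sigma> ` T) (x, y) j) = (\<Sum>j\<in>A. c t j * x j) + (\<Sum>j\<in>\<sigma> ` T. c t j * y j)"
      unfolding J_eq by (rule sum_mult_merge[OF fin disj])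
    also have "(\<Sum>j\<in>\<sigma> ` T. c t j * y j) = (\<Sum>j\<in>{\<sigma> t}. c t j * y j)"
      using t T diag[OF t] by (intro sum.mono_neutral_right) auto
    finally show ?thesis by simp
  qed
  have inner: "(\<integral>\<^sup>+y. F (merge A (\<sigma> ` T) (x, y)) \<partial>PiM (\<sigma> ` T) (\<lambda>_. disc_lborel d))
      \<le> (\<Prod>t\<in>T. ennreal ((V + 1) / (1 + (cmod (c t (\<sigma> t)))\<^sup>2)))" for x
  proof -
    have "F (merge A (\<sigma> ` T) (x, y))
        = (\<Prod>t\<in>T. ennreal (cnormal_density 1 ((z t - (\<Sum>j\<in>A. c t j * x j)) - c t (\<sigma> t) * y (\<sigma> t))))" for y
      by (simp add: F_def sum_eq diff_diff_add)
    then show ?thesis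
      unfolding V_def by (simp only: nn_integral_PiM_disc_prod_le[OF d T \<sigma>(1)])
  qed
  have "(\<integral>\<^sup>+x. F x \<partial>PiM J (\<lambda>_. disc_lborel d))
      = (\<integral>\<^sup>+x. \<integral>\<^sup>+y. F (merge A (\<sigma> ` T) (x, y)) \<partial>PiM (\<sigma> ` T) (\<lambda>_. disc_lborel d) \<partial>PiM A (\<lambda>_. disc_lborel d))"
    using F unfolding J_eq
    by (rule product_sigma_finite.product_nn_integral_fold[OF product_sigma_finite_disc_lborel[OF d] disj fin])
  also have "\<dots> \<le> (\<integral>\<^sup>+x. (\<Prod>t\<in>T. ennreal ((V + 1) / (1 + (cmod (c t (\<sigma> t)))\<^sup>2))) \<partial>PiM A (\<lambda>_. disc_lborel d))"
    by (intro nn_integral_mono inner)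
  also have "\<dots> = (\<Prod>t\<in>T. ennreal ((V + 1) / (1 + (cmod (c t (\<sigma> t)))\<^sup>2))) * (\<Prod>j\<in>A. ennreal V)"
    using product_sigma_finite.product_nn_integral_prod[OF product_sigma_finite_disc_lborel[OF d] fin(1),
      of "\<lambda>_ _. 1"]
    by (simp add: emeasure_disc_lborel_space[OF d] V_def)
  also have "\<dots> = ennreal ((\<Prod>t\<in>T. (V + 1) / (1 + (cmod (c t (\<sigma> t)))\<^sup>2)) * V ^ card A)"
    using V by (simp add: prod_ennreal ennreal_power ennreal_mult prod_nonneg)
  also have "\<dots> \<le> ennreal ((V + 1) ^ (card A + card T) * (\<Prod>t\<in>T. 1 / (1 + (cmod (c t (\<sigma> t)))\<^sup>2)))"
    using V by (intro ennreal_leI prod_divide_mult_power_le) simp_all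
  also have "card A + card T = card J"
    using J_eq disj fin \<sigma>(1) by (simp add: card_Un_disjoint card_image)
  finally show ?thesis by (simp add: F_def V_def)
qed

subsection \<open>Channels of bounded conditional density\<close>

definition gain_family :: "(nat \<Rightarrow> nat \<Rightarrow> nat \<Rightarrow> complex) \<Rightarrow> nat \<times> nat \<times> nat \<Rightarrow> complex" where
  "gain_family g = (\<lambda>(t, k, i). g t k i)"

definition gain_process :: "(nat \<times> nat \<times> nat \<Rightarrow> complex) \<Rightarrow> nat \<Rightarrow> nat \<Rightarrow> nat \<Rightarrow> complex" where
  "gain_process x t k i = x (t, k, i)"

lemma gain_process_restrict [simp]:
  "(t, k, i) \<in> S \<Longrightarrow> gain_process (restrict (gain_family g) S) t k i = g t k i"
  by (simp add: gain_process_def gain_family_def)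

lemma measurable_gain_process:
  "(t, k, i) \<in> S \<Longrightarrow> (\<lambda>x. gain_process x t k i) \<in> borel_measurable (PiM S (\<lambda>_. borel))"
  unfolding gain_process_def by (rule measurable_component_singleton)

locale fading_law = prob_space G
  for K :: nat and fmax dmin dmax :: real and G :: "(nat \<Rightarrow> nat \<Rightarrow> nat \<Rightarrow> complex) measure" +
  assumes fmax_pos: "fmax > 0" and dmin_pos: "dmin > 0" and dmin_le_dmax: "dmin \<le> dmax"
    and measurable_gain: "\<And>t k i. k < K \<Longrightarrow> i < K \<Longrightarrow> (\<lambda>g. g t k i) \<in> borel_measurable G"
    and AE_gain: "\<And>t k i. k < K \<Longrightarrow> i < K \<Longrightarrow> AE g in G. dmin \<le> cmod (g t k i) \<and> cmod (g t k i) \<le> dmax"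
    and bounded_density: "\<And>A B. finite A \<Longrightarrow> finite B \<Longrightarrow> A \<subseteq> coords K \<Longrightarrow> B \<subseteq> coords K \<Longrightarrow> A \<inter> B = {} \<Longrightarrow>
       \<exists>f h. f \<in> borel_measurable (PiM (A \<union> B) (\<lambda>_. (lborel :: complex measure))) \<and>
             h \<in> borel_measurable (PiM B (\<lambda>_. (lborel :: complex measure))) \<and>
             chan_marg G (A \<union> B) = density (PiM (A \<union> B) (\<lambda>_. lborel)) f \<and>
             chan_marg G B = density (PiM B (\<lambda>_. lborel)) h \<and>
             (AE x in PiM (A \<union> B) (\<lambda>_. lborel). f x \<le> ennreal (fmax ^ card A) * h (restrict x B))"

lemma admissible_channelE:
  assumes "admissible_channel K Gm"
  obtains fmax dmin dmax where "\<And>P. P > 1 \<Longrightarrow> fading_law K fmax dmin dmax (Gm P)"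
proof -
  from assms obtain fmax dmin dmax where pos: "fmax > 0" "dmin > 0" "dmin \<le> dmax"
    and law: "\<forall>P>1. prob_space (Gm P) \<and>
       (\<forall>t k i. k < K \<longrightarrow> i < K \<longrightarrow> (\<lambda>g. g t k i) \<in> borel_measurable (Gm P)) \<and>
       (\<forall>t k i. k < K \<longrightarrow> i < K \<longrightarrow> (AE g in Gm P. dmin \<le> cmod (g t k i) \<and> cmod (g t k i) \<le> dmax)) \<and>
       (\<forall>A B. finite A \<and> finite B \<and> A \<subseteq> coords K \<and> B \<subseteq> coords K \<and> A \<inter> B = {} \<longrightarrow>
          (\<exists>f h. f \<in> borel_measurable (PiM (A \<union> B) (\<lambda>_. (lborel :: complex measure))) \<and>
                 h \<in> borel_measurable (PiM B (\<lambda>_. (lborel :: complex measure))) \<and>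
                 chan_marg (Gm P) (A \<union> B) = density (PiM (A \<union> B) (\<lambda>_. lborel)) f \<and>
                 chan_marg (Gm P) B = density (PiM B (\<lambda>_. lborel)) h \<and>
                 (AE x in PiM (A \<union> B) (\<lambda>_. lborel).
                    f x \<le> ennreal (fmax ^ card A) * h (restrict x B))))"
    unfolding admissible_channel_def by (elim exE conjE) (rule that)
  show ?thesis
  proof (rule that)
    fix P :: real assume "P > 1"
    with pos law show "fading_law K fmax dmin dmax (Gm P)"
      unfolding fading_law_def fading_law_axioms_def by (intro conjI allI impI) simp_all
  qed
qed

context fading_law
begin

lemma dmax_pos: "dmax > 0"
  using dmin_pos dmin_le_dmax by linarith

lemma AE_gain_le: "k < K \<Longrightarrow> i < K \<Longrightarrow> AE g in G. cmod (g t k i) \<le> dmax"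
  by (rule AE_mp[OF AE_gain[where t = t and k = k and i = i]]) auto

lemma measurable_restrict_gain_family:
  assumes "S \<subseteq> coords K"
  shows "(\<lambda>g. restrict (gain_family g) S) \<in> measurable G (PiM S (\<lambda>_. borel))"
  using assms measurable_gain by (intro measurable_restrict) (auto simp: gain_family_def coords_def)

lemma nn_integral_chan_marg:
  assumes "S \<subseteq> coords K" and "f \<in> borel_measurable (PiM S (\<lambda>_. borel))"
  shows "(\<integral>\<^sup>+x. f x \<partial>chan_marg G S) = (\<integral>\<^sup>+g. f (restrict (gain_family g) S) \<partial>G)"
  unfolding chan_marg_def gain_family_def[symmetric]
  using assms measurable_restrict_gain_family by (intro nn_integral_distr) auto

lemma AE_gain_family_le:
  assumes "finite A" "A \<subseteq> coords K"
  shows "AE g in G. \<forall>j\<in>A. cmod (gain_family g j) \<le> dmax"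
  using assms AE_gain_le
  by (subst AE_finite_all) (auto simp: gain_family_def coords_def split: prod.splits)

lemma nn_integral_gains_mult_le:
  assumes fin: "finite A" "finite B" and coords: "A \<subseteq> coords K" "B \<subseteq> coords K" and disj: "A \<inter> B = {}"
    and [measurable]: "u \<in> borel_measurable (PiM A (\<lambda>_. borel))"
    and [measurable]: "v \<in> borel_measurable (PiM B (\<lambda>_. borel))"
  shows "(\<integral>\<^sup>+g. u (restrict (gain_family g) A) * v (restrict (gain_family g) B) \<partial>G)
    \<le> ennreal (fmax ^ card A) * (\<integral>\<^sup>+x. u x \<partial>PiM A (\<lambda>_. disc_lborel dmax)) *
      (\<integral>\<^sup>+g. v (restrict (gain_family g) B) \<partial>G)"
proof -
  let ?L = "\<lambda>S. PiM S (\<lambda>_. lborel :: complex measure)"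
  have lborel: "measurable (?L S) N = measurable (PiM S (\<lambda>_. borel)) N" for S :: "(nat \<times> nat \<times> nat) set"
    and N :: "'z measure"
    by (intro measurable_cong_sets sets_PiM_cong) simp_all
  obtain f h where f [measurable]: "f \<in> borel_measurable (?L (A \<union> B))"
    and h [measurable]: "h \<in> borel_measurable (?L B)"
    and density_f: "chan_marg G (A \<union> B) = density (?L (A \<union> B)) f"
    and density_h: "chan_marg G B = density (?L B) h"
    and f_le: "AE x in ?L (A \<union> B). f x \<le> ennreal (fmax ^ card A) * h (restrict x B)"
    using bounded_density[OF fin coords disj] by blast
  define I where "I x = (\<Prod>j\<in>A. indicator (cball 0 dmax) (x j) :: ennreal)" for x :: "nat \<times> nat \<times> nat \<Rightarrow> complex"
  have I [measurable]: "I \<in> borel_measurable (?L A)"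
    unfolding I_def by (rule borel_measurable_prod_indicator_cball)
  have measurable_lborel [measurable]: "u \<in> borel_measurable (?L A)" "v \<in> borel_measurable (?L B)"
    by (simp_all add: lborel)
  have [measurable]: "(\<lambda>x. restrict x A) \<in> measurable (?L (A \<union> B)) (?L A)"
      "(\<lambda>x. restrict x B) \<in> measurable (?L (A \<union> B)) (?L B)"
    by (rule measurable_restrict_subset; simp)+
  let ?F = "\<lambda>x. I (restrict x A) * u (restrict x A) * v (restrict x B)"
  have "(\<integral>\<^sup>+g. u (restrict (gain_family g) A) * v (restrict (gain_family g) B) \<partial>G)
      = (\<integral>\<^sup>+g. ?F (restrict (gain_family g) (A \<union> B)) \<partial>G)"
    using AE_gain_family_le[OF fin(1) coords(1)]
    by (intro nn_integral_cong_AE) (auto elim!: eventually_mono simp: I_def Int_absorb1)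
  also have "\<dots> = (\<integral>\<^sup>+x. ?F x \<partial>chan_marg G (A \<union> B))"
    using coords by (intro nn_integral_chan_marg[symmetric]) (simp_all add: lborel[symmetric])
  also have "\<dots> = (\<integral>\<^sup>+x. f x * ?F x \<partial>?L (A \<union> B))"
    unfolding density_f by (rule nn_integral_density) measurable
  also have "\<dots> \<le> (\<integral>\<^sup>+x. ennreal (fmax ^ card A) * h (restrict x B) * ?F x \<partial>?L (A \<union> B))"
    using f_le by (intro nn_integral_mono_AE) (auto elim!: eventually_mono intro!: mult_right_mono)
  also have "\<dots> = (\<integral>\<^sup>+x. ennreal (fmax ^ card A) *
      ((I (restrict x A) * u (restrict x A)) * (h (restrict x B) * v (restrict x B))) \<partial>?L (A \<union> B))"
    by (simp only: mult_ac)
  also have "\<dots> = ennreal (fmax ^ card A) * ((\<integral>\<^sup>+x. I x * u x \<partial>?L A) * (\<integral>\<^sup>+x. h x * v x \<partial>?L B))"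
    using nn_integral_PiM_Un_mult[OF product_sigma_finite_lborel fin disj, of "\<lambda>x. I x * u x" "\<lambda>x. h x * v x"]
    by (subst nn_integral_cmult) simp_all
  also have "(\<integral>\<^sup>+x. I x * u x \<partial>?L A) = (\<integral>\<^sup>+x. u x \<partial>PiM A (\<lambda>_. disc_lborel dmax))"
    using nn_integral_PiM_disc_lborel[OF fin(1) _ measurable_lborel(1), of dmax] dmax_pos by (simp add: I_def)
  also have "(\<integral>\<^sup>+x. h x * v x \<partial>?L B) = (\<integral>\<^sup>+g. v (restrict (gain_family g) B) \<partial>G)"
    using coords density_h by (simp add: nn_integral_chan_marg[symmetric] nn_integral_density)
  finally show ?thesis by (simp only: mult.assoc)
qed

end

subsection \<open>Typical channel and noise realisations\<close>

locale fading_block = fading_law K fmax dmin dmax G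
  for K :: nat and fmax dmin dmax :: real and G :: "(nat \<Rightarrow> nat \<Rightarrow> nat \<Rightarrow> complex) measure" +
  fixes n :: nat
begin

abbreviation Om :: "((nat \<Rightarrow> nat \<Rightarrow> nat \<Rightarrow> complex) \<times> (nat \<times> nat \<Rightarrow> complex)) measure" where
  "Om \<equiv> G \<Otimes>\<^sub>M noise n K"

sublocale noise: prob_space "noise n K"
  by (rule prob_space_noise)

sublocale block: pair_prob_space G "noise n K" ..

definition bounded_gains :: "nat \<Rightarrow> (nat \<Rightarrow> nat \<Rightarrow> nat \<Rightarrow> complex) \<Rightarrow> bool" where
  "bounded_gains k g \<longleftrightarrow> (\<forall>t<n. \<forall>i<K. dmin \<le> cmod (g t k i) \<and> cmod (g t k i) \<le> dmax)"

definition bounded_noise :: "real \<Rightarrow> nat \<Rightarrow> (nat \<times> nat \<Rightarrow> complex) \<Rightarrow> bool" where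
  "bounded_noise c k z \<longleftrightarrow> (\<Sum>t<n. (cmod (z (t, k)))\<^sup>2) \<le> c * real n"

definition typical :: "real \<Rightarrow> ((nat \<Rightarrow> nat \<Rightarrow> nat \<Rightarrow> complex) \<times> (nat \<times> nat \<Rightarrow> complex)) set" where
  "typical c = {gz \<in> space Om. \<forall>k<K. bounded_gains k (fst gz) \<and> bounded_noise c k (snd gz)}"

lemma measurable_gain_Om: "k < K \<Longrightarrow> i < K \<Longrightarrow> (\<lambda>gz. fst gz t k i) \<in> borel_measurable Om"
  by (rule measurable_compose[OF measurable_fst measurable_gain])

lemma measurable_noise_Om: "t < n \<Longrightarrow> k < K \<Longrightarrow> (\<lambda>gz. snd gz (t, k)) \<in> borel_measurable Om"
  by (rule measurable_compose[OF measurable_snd measurable_noise_component])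

lemma pred_bounded_gains:
  assumes "\<And>t i. t < n \<Longrightarrow> i < K \<Longrightarrow> (\<lambda>x. f x t k i) \<in> borel_measurable M"
  shows "Measurable.pred M (\<lambda>x. bounded_gains k (f x))"
proof -
  have [measurable]: "(\<lambda>x. f x t k i) \<in> borel_measurable M" if "t \<in> {..<n}" "i \<in> {..<K}" for t i
    using assms that by simp
  have "Measurable.pred M (\<lambda>x. \<forall>t\<in>{..<n}. \<forall>i\<in>{..<K}. dmin \<le> cmod (f x t k i) \<and> cmod (f x t k i) \<le> dmax)"
    by measurable
  then show ?thesis by (simp add: bounded_gains_def Ball_def)
qed

lemma pred_bounded_noise:
  assumes "\<And>t. t < n \<Longrightarrow> (\<lambda>x. f x (t, k)) \<in> borel_measurable M"
  shows "Measurable.pred M (\<lambda>x. bounded_noise c k (f x))"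
proof -
  have [measurable]: "(\<lambda>x. f x (t, k)) \<in> borel_measurable M" if "t \<in> {..<n}" for t
    using assms that by simp
  show ?thesis unfolding bounded_noise_def by measurable
qed

lemma sets_typical: "typical c \<in> sets Om"
proof -
  have [measurable]: "Measurable.pred Om (\<lambda>gz. bounded_gains k (fst gz))"
      "Measurable.pred Om (\<lambda>gz. bounded_noise c k (snd gz))" if "k \<in> {..<K}" for k
    using that measurable_gain_Om measurable_noise_Om
    by (auto intro!: pred_bounded_gains pred_bounded_noise)
  have "typical c = {gz \<in> space Om. \<forall>k\<in>{..<K}. bounded_gains k (fst gz) \<and> bounded_noise c k (snd gz)}"
    by (auto simp: typical_def)
  also have "\<dots> \<in> sets Om" by measurable
  finally show ?thesis .
qed

lemma AE_bounded_gains: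
  assumes "k < K"
  shows "AE g in G. bounded_gains k g"
proof -
  have "AE g in G. \<forall>t\<in>{..<n}. \<forall>i\<in>{..<K}. dmin \<le> cmod (g t k i) \<and> cmod (g t k i) \<le> dmax"
    using assms AE_gain by (simp add: AE_finite_all)
  then show ?thesis by eventually_elim (simp add: bounded_gains_def)
qed

lemma emeasure_Om_times:
  "A \<in> sets G \<Longrightarrow> B \<in> sets (noise n K) \<Longrightarrow> emeasure Om (A \<times> B) = emeasure G A * emeasure (noise n K) B"
  by (rule noise.emeasure_pair_measure_Times)

lemma emeasure_not_typical_le:
  "emeasure Om (space Om - typical c) \<le> ennreal (real K * (2 * exp (- c / 2)) ^ n)"
proof -
  define X where "X k = {z \<in> space (noise n K). \<not> bounded_noise c k z}" for k
  define Y where "Y k = {g \<in> space G. \<not> bounded_gains k g}" for k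
  have X: "X k \<in> sets (noise n K)" if "k < K" for k
  proof -
    have [measurable]: "Measurable.pred (noise n K) (bounded_noise c k)"
      using pred_bounded_noise[of "\<lambda>z. z"] measurable_noise_component that by simp
    show ?thesis unfolding X_def by measurable
  qed
  have Y: "Y k \<in> sets G" if "k < K" for k
  proof -
    have [measurable]: "Measurable.pred G (bounded_gains k)"
      using pred_bounded_gains[of "\<lambda>g. g"] measurable_gain that by simp
    show ?thesis unfolding Y_def by measurable
  qed
  have "emeasure Om (space Om - typical c) \<le> emeasure Om (\<Union>k\<in>{..<K}. space G \<times> X k \<union> Y k \<times> space (noise n K))"
    using X Y by (intro emeasure_mono)
      (auto simp: typical_def X_def Y_def space_pair_measure intro!: sets.finite_UN sets.Un pair_measureI)
  also have "\<dots> \<le> (\<Sum>k<K. emeasure Om (space G \<times> X k \<union> Y k \<times> space (noise n K)))"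
    using X Y by (intro emeasure_subadditive_finite) auto
  also have "\<dots> \<le> (\<Sum>k<K. ennreal ((2 * exp (- c / 2)) ^ n))"
  proof (rule sum_mono)
    fix k assume "k \<in> {..<K}"
    then have k: "k < K" by simp
    have "emeasure G (Y k) = 0"
      using AE_bounded_gains[OF k] Y[OF k] unfolding Y_def by (subst (asm) AE_iff_measurable[OF _ refl]) auto
    moreover have "emeasure (noise n K) (X k) \<le> ennreal ((2 * exp (- c / 2)) ^ n)"
      using noise_energy_tail[OF k] by (simp add: X_def bounded_noise_def not_le)
    moreover have "emeasure Om (space G \<times> X k \<union> Y k \<times> space (noise n K))
        \<le> emeasure Om (space G \<times> X k) + emeasure Om (Y k \<times> space (noise n K))"
      using X[OF k] Y[OF k] by (intro emeasure_subadditive) auto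
    ultimately show "emeasure Om (space G \<times> X k \<union> Y k \<times> space (noise n K)) \<le> ennreal ((2 * exp (- c / 2)) ^ n)"
      using X[OF k] Y[OF k] by (simp add: emeasure_Om_times emeasure_space_1)
  qed
  also have "\<dots> = ennreal (real K * (2 * exp (- c / 2)) ^ n)"
    by (subst sum_ennreal) auto
  finally show ?thesis .
qed

end

subsection \<open>Likelihoods of a code\<close>

locale fading_code = fading_block K fmax dmin dmax G n
  for K :: nat and fmax dmin dmax :: real and G :: "(nat \<Rightarrow> nat \<Rightarrow> nat \<Rightarrow> complex) measure" and n :: nat +
  fixes a :: "nat \<Rightarrow> nat \<Rightarrow> real" and W :: "'w set" and E :: "'w \<Rightarrow> nat \<Rightarrow> nat \<Rightarrow> complex"
  assumes amplitude_nonneg: "\<And>k i. a k i \<ge> 0"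
    and finite_W: "finite W"
    and power_le: "\<And>w i. w \<in> W \<Longrightarrow> i < K \<Longrightarrow> (\<Sum>t<n. (cmod (E w i t))\<^sup>2) \<le> real n"
begin

definition signal :: "nat \<Rightarrow> (nat \<Rightarrow> nat \<Rightarrow> nat \<Rightarrow> complex) \<Rightarrow> 'w \<Rightarrow> nat \<Rightarrow> complex" where
  "signal k g w t = (\<Sum>i<K. complex_of_real (a k i) * g t k i * E w i t)"

text \<open>The total likelihood at receiver \<open>k\<close> of the class of the sent codeword \<open>w\<close>, for gains and noise \<open>gz\<close>, if only
  the inputs in \<open>I\<close> could differ from those of \<open>w\<close>.\<close>
definition lik :: "nat \<Rightarrow> nat set \<Rightarrow> ('w \<times> 'w) set \<Rightarrow> 'w
    \<Rightarrow> (nat \<Rightarrow> nat \<Rightarrow> nat \<Rightarrow> complex) \<times> (nat \<times> nat \<Rightarrow> complex) \<Rightarrow> real" where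
  "lik k I R w gz = (\<Sum>w'\<in>R `` {w}. \<Prod>t<n. cnormal_density 1
      (snd gz (t, k) - (\<Sum>i\<in>I. complex_of_real (a k i) * fst gz t k i * (E w' i t - E w i t))))"

lemma lik_eq_signal:
  "lik k {..<K} R w (g, z)
    = (\<Sum>w'\<in>R `` {w}. \<Prod>t<n. cnormal_density 1 (signal k g w t + z (t, k) - signal k g w' t))"
proof -
  have "z (t, k) - (\<Sum>i<K. complex_of_real (a k i) * g t k i * (E w' i t - E w i t))
      = signal k g w t + z (t, k) - signal k g w' t" for w' t
    by (simp add: signal_def algebra_simps sum_subtractf)
  then show ?thesis by (simp only: lik_def fst_conv snd_conv)
qed

lemma lik_pos:
  assumes "equiv W R" and "w \<in> W"
  shows "lik k I R w gz > 0"
  unfolding lik_def using finite_W assms by (intro sum_class_pos) (auto intro!: prod_pos)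

lemma lik_cong:
  assumes "\<And>t i. t < n \<Longrightarrow> i \<in> I \<Longrightarrow> g t k i = g' t k i"
  shows "lik k I R w (g, z) = lik k I R w (g', z)"
  unfolding lik_def using assms by (intro sum.cong prod.cong refl arg_cong[where f = "cnormal_density 1"]) simp

lemma measurable_signal:
  assumes "\<And>i. i < K \<Longrightarrow> (\<lambda>x. f x t k i) \<in> borel_measurable M"
  shows "(\<lambda>x. signal k (f x) w t) \<in> borel_measurable M"
  unfolding signal_def using assms
  by (intro borel_measurable_sum borel_measurable_times borel_measurable_const) auto

lemma measurable_lik:
  assumes "\<And>t i. t < n \<Longrightarrow> i \<in> I \<Longrightarrow> (\<lambda>x. f x t k i) \<in> borel_measurable M"
    and "\<And>t. t < n \<Longrightarrow> (\<lambda>x. h x (t, k)) \<in> borel_measurable M"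
  shows "(\<lambda>x. lik k I R w (f x, h x)) \<in> borel_measurable M"
  unfolding lik_def using assms
  by (intro borel_measurable_sum borel_measurable_prod measurable_compose[OF _ borel_measurable_cnormal_density]
      borel_measurable_diff borel_measurable_times borel_measurable_const) auto

lemma measurable_lik_Om:
  assumes "k < K" and "I \<subseteq> {..<K}"
  shows "lik k I R w \<in> borel_measurable Om"
proof -
  have "(\<lambda>gz. lik k I R w (fst gz, snd gz)) \<in> borel_measurable Om"
    using assms by (intro measurable_lik measurable_gain_Om measurable_noise_Om) auto
  then show ?thesis by simp
qed

end

subsection \<open>A dyadic mixture of Gaussians\<close>

text \<open>Dominates the truncated Cauchy-type kernel \<open>exp (- \<bar>u\<bar>\<^sup>2 / R\<^sup>2) / (1 + \<bar>u\<bar>\<^sup>2 / D\<^sup>2)\<close> for \<open>R \<le> 2 ^ J * D\<close>, although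
  its integral exceeds \<open>D\<^sup>2\<close> only by a factor linear in \<open>J\<close>.\<close>
definition dyadic_mixture :: "real \<Rightarrow> nat \<Rightarrow> complex \<Rightarrow> real" where
  "dyadic_mixture D J u = (\<Sum>j\<le>J. 4 * exp 1 * pi * D\<^sup>2 * cnormal_density (4 ^ j * D\<^sup>2) u)"

lemma dyadic_mixture_nonneg: "D > 0 \<Longrightarrow> dyadic_mixture D J u \<ge> 0"
  unfolding dyadic_mixture_def by (intro sum_nonneg mult_nonneg_nonneg) auto

lemma measurable_dyadic_mixture [measurable]: "dyadic_mixture D J \<in> borel_measurable borel"
  unfolding dyadic_mixture_def by measurable

lemma truncated_Cauchy_le_dyadic:
  fixes x r :: real
  assumes x: "x \<ge> 0" and r: "0 < r" "r \<le> 4 ^ J"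
  shows "\<exists>j\<le>J. exp (- x / r) / (1 + x) \<le> 4 * exp 1 / 4 ^ j * exp (- x / 4 ^ j)"
proof (cases "x \<le> 4 ^ J")
  case True
  define j where "j = (LEAST j. x \<le> 4 ^ j)"
  have x_le: "x \<le> 4 ^ j" and "j \<le> J"
    unfolding j_def using True by (rule LeastI, rule Least_le)
  have "exp (- x / r) / (1 + x) \<le> 1 / (1 + x)"
    using x r by (intro divide_right_mono) auto
  also have "\<dots> \<le> 4 / 4 ^ j"
  proof (cases j)
    case 0
    then show ?thesis using x by (simp add: divide_simps)
  next
    case (Suc i)
    then have "\<not> x \<le> 4 ^ i" using not_less_Least[of i "\<lambda>j. x \<le> 4 ^ j"] by (simp add: j_def)
    then have "1 / (1 + x) \<le> 1 / 4 ^ i" by (intro divide_left_mono) (auto intro!: mult_pos_pos add_pos_nonneg x)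
    then show ?thesis using Suc by simp
  qed
  also have "\<dots> = 4 * exp 1 / 4 ^ j * exp (- 1)"
    by (simp add: exp_minus)
  also have "\<dots> \<le> 4 * exp 1 / 4 ^ j * exp (- x / 4 ^ j)"
    using x_le by (intro mult_left_mono) (auto simp: divide_simps)
  finally show ?thesis using \<open>j \<le> J\<close> by blast
next
  case False
  have "x / 4 ^ J \<le> x / r" using x r by (intro divide_left_mono) auto
  then have "exp (- x / r) / (1 + x) \<le> exp (- x / 4 ^ J) / 4 ^ J"
    using False x by (intro frac_le) auto
  also have "\<dots> = 1 / 4 ^ J * exp (- x / 4 ^ J)" by simp
  also have "\<dots> \<le> 4 * exp 1 / 4 ^ J * exp (- x / 4 ^ J)"
    using exp_ge_add_one_self[of 1] by (intro mult_right_mono divide_right_mono) auto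
  finally show ?thesis by blast
qed

lemma truncated_Cauchy_le_dyadic_mixture:
  assumes D: "D > 0" and R: "R > 0" and J: "R\<^sup>2 \<le> 4 ^ J * D\<^sup>2"
  shows "exp (- (cmod u)\<^sup>2 / R\<^sup>2) / (1 + (cmod u)\<^sup>2 / D\<^sup>2) \<le> dyadic_mixture D J u"
proof -
  let ?T = "\<lambda>j. 4 * exp 1 * pi * D\<^sup>2 * cnormal_density (4 ^ j * D\<^sup>2) u"
  have "R\<^sup>2 / D\<^sup>2 \<le> 4 ^ J" using D J by (simp add: divide_simps)
  with D R obtain j where j: "j \<le> J" and
    "exp (- ((cmod u)\<^sup>2 / D\<^sup>2) / (R\<^sup>2 / D\<^sup>2)) / (1 + (cmod u)\<^sup>2 / D\<^sup>2)
      \<le> 4 * exp 1 / 4 ^ j * exp (- ((cmod u)\<^sup>2 / D\<^sup>2) / 4 ^ j)"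
    using truncated_Cauchy_le_dyadic[of "(cmod u)\<^sup>2 / D\<^sup>2" "R\<^sup>2 / D\<^sup>2" J] by auto
  then have "exp (- (cmod u)\<^sup>2 / R\<^sup>2) / (1 + (cmod u)\<^sup>2 / D\<^sup>2) \<le> ?T j"
    using D R by (simp add: cnormal_density_def mult_ac)
  also have "\<dots> \<le> dyadic_mixture D J u"
    unfolding dyadic_mixture_def using j D by (intro member_le_sum) auto
  finally show ?thesis .
qed

lemma nn_integral_dyadic_mixture:
  assumes D: "D > 0"
  shows "(\<integral>\<^sup>+u. ennreal (dyadic_mixture D J (u - c)) \<partial>lborel) = ennreal (4 * exp 1 * pi * (real J + 1) * D\<^sup>2)"
proof -
  let ?k = "4 * exp 1 * pi * D\<^sup>2"
  have "ennreal (dyadic_mixture D J (u - c))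
      = (\<Sum>j\<le>J. ennreal ?k * ennreal (cnormal_density (4 ^ j * D\<^sup>2) (u - c)))" for u
    using D by (simp add: dyadic_mixture_def sum_ennreal[symmetric] ennreal_mult')
  then have "(\<integral>\<^sup>+u. ennreal (dyadic_mixture D J (u - c)) \<partial>lborel)
      = (\<Sum>j\<le>J. ennreal ?k * (\<integral>\<^sup>+u. ennreal (cnormal_density (4 ^ j * D\<^sup>2) (u - c)) \<partial>lborel))"
    by (simp add: nn_integral_sum nn_integral_cmult)
  also have "\<dots> = (\<Sum>j\<le>J. ennreal ?k)"
    using D by (simp add: nn_integral_cnormal_density)
  also have "\<dots> = ennreal (4 * exp 1 * pi * (real J + 1) * D\<^sup>2)"
    by (subst sum_ennreal) (auto simp: algebra_simps)
  finally show ?thesis .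
qed

lemma power2_sum_le: "(x + y)\<^sup>2 \<le> 2 * x\<^sup>2 + 2 * y\<^sup>2" for x y :: real
  using sum_squares_bound[of x y] by (simp add: power2_sum)

lemma Cauchy_le_dyadic_mixture:
  fixes u :: complex
  assumes D: "D > 0" and R: "R > 0" and J: "R\<^sup>2 \<le> 4 ^ J * D\<^sup>2"
    and u: "cmod u / D \<le> \<zeta> + d * (\<kappa> * m + e)"
  shows "1 / (1 + m\<^sup>2)
      \<le> (2 + 4 * d\<^sup>2 * \<kappa>\<^sup>2 + 4 * d\<^sup>2) * exp (\<zeta>\<^sup>2 + e\<^sup>2 + (cmod u)\<^sup>2 / R\<^sup>2) * dyadic_mixture D J u"
proof -
  define L where "L = 2 + 4 * d\<^sup>2 * \<kappa>\<^sup>2 + 4 * d\<^sup>2"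
  have L: "L > 0" unfolding L_def by (intro add_pos_nonneg) auto
  have "(cmod u / D)\<^sup>2 \<le> (\<zeta> + d * (\<kappa> * m + e))\<^sup>2"
    using D u by (intro power_mono) auto
  also have "\<dots> \<le> 2 * \<zeta>\<^sup>2 + 2 * (d * (\<kappa> * m + e))\<^sup>2" by (rule power2_sum_le)
  also have "(d * (\<kappa> * m + e))\<^sup>2 \<le> d\<^sup>2 * (2 * (\<kappa> * m)\<^sup>2 + 2 * e\<^sup>2)"
    unfolding power_mult_distrib[of d] by (intro mult_left_mono power2_sum_le) simp
  finally have "1 + (cmod u)\<^sup>2 / D\<^sup>2 \<le> 1 + 2 * \<zeta>\<^sup>2 + 4 * d\<^sup>2 * \<kappa>\<^sup>2 * m\<^sup>2 + 4 * d\<^sup>2 * e\<^sup>2"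
    by (simp add: power_divide power_mult_distrib algebra_simps)
  also have "\<dots> \<le> L * 1 + L * \<zeta>\<^sup>2 + L * m\<^sup>2 + L * e\<^sup>2"
    unfolding L_def by (intro add_mono mult_right_mono) auto
  also have "\<dots> \<le> L * ((1 + m\<^sup>2) * (1 + \<zeta>\<^sup>2 + e\<^sup>2))"
    using L by (simp add: algebra_simps)
  also have "\<dots> \<le> L * ((1 + m\<^sup>2) * exp (\<zeta>\<^sup>2 + e\<^sup>2))"
    using L exp_ge_add_one_self[of "\<zeta>\<^sup>2 + e\<^sup>2"] by (intro mult_left_mono) (auto simp: add.assoc)
  finally have "1 * (1 + (cmod u)\<^sup>2 / D\<^sup>2) \<le> L * exp (\<zeta>\<^sup>2 + e\<^sup>2) * (1 + m\<^sup>2)"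
    by (simp add: mult_ac)
  moreover have "0 < 1 + (cmod u)\<^sup>2 / D\<^sup>2" "0 < 1 + m\<^sup>2" by (auto intro!: add_pos_nonneg)
  ultimately have "1 / (1 + m\<^sup>2) \<le> L * exp (\<zeta>\<^sup>2 + e\<^sup>2) / (1 + (cmod u)\<^sup>2 / D\<^sup>2)"
    by (simp add: pos_divide_le_eq pos_le_divide_eq del: times_divide_eq_right)
  also have "\<dots> = L * exp (\<zeta>\<^sup>2 + e\<^sup>2 + (cmod u)\<^sup>2 / R\<^sup>2) * (exp (- (cmod u)\<^sup>2 / R\<^sup>2) / (1 + (cmod u)\<^sup>2 / D\<^sup>2))"
    by (simp add: exp_add exp_minus)
  also have "\<dots> \<le> L * exp (\<zeta>\<^sup>2 + e\<^sup>2 + (cmod u)\<^sup>2 / R\<^sup>2) * dyadic_mixture D J u"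
    using D R J L by (intro mult_left_mono truncated_Cauchy_le_dyadic_mixture) auto
  finally show ?thesis by (simp add: L_def)
qed

subsection \<open>Rare events\<close>

lemma emeasure_less_le_nn_integral_ratio:
  fixes f h :: "'a \<Rightarrow> real"
  assumes [measurable]: "f \<in> borel_measurable M" "h \<in> borel_measurable M" and pos: "\<And>x. f x > 0"
  shows "emeasure M {x \<in> space M. f x < h x} \<le> (\<integral>\<^sup>+x. ennreal (h x / f x) \<partial>M)"
proof -
  have "emeasure M {x \<in> space M. f x < h x} = (\<integral>\<^sup>+x. indicator {x \<in> space M. f x < h x} x \<partial>M)"
    by (rule nn_integral_indicator[symmetric]) measurable
  also have "\<dots> \<le> (\<integral>\<^sup>+x. ennreal (h x / f x) \<partial>M)"
  proof (rule nn_integral_mono)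
    fix x
    have "1 \<le> h x / f x" if "f x < h x" using that pos[of x] by simp
    then show "indicator {x \<in> space M. f x < h x} x \<le> ennreal (h x / f x)"
      by (auto simp: indicator_def simp flip: ennreal_1 intro: ennreal_leI)
  qed
  finally show ?thesis .
qed

context fading_code
begin

definition rare :: "real \<Rightarrow> ('w \<Rightarrow> ((nat \<Rightarrow> nat \<Rightarrow> nat \<Rightarrow> complex) \<times> (nat \<times> nat \<Rightarrow> complex)) set) \<Rightarrow> bool" where
  "rare c B \<longleftrightarrow> (\<forall>w\<in>W. B w \<in> sets Om) \<and> (\<Sum>w\<in>W. emeasure Om (B w)) \<le> ennreal (c * real (card W))"

lemma ex_avoiding_rare:
  assumes W: "W \<noteq> {}" and half: "ennreal (real (card W) / 2) \<le> (\<Sum>w\<in>W. emeasure Om (S w))"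
    and fin: "finite \<B>" and rare: "\<And>B. B \<in> \<B> \<Longrightarrow> rare c B"
    and c: "c \<ge> 0" "real (card \<B>) * c < 1 / 2"
  obtains w gz where "w \<in> W" "gz \<in> S w" "\<And>B. B \<in> \<B> \<Longrightarrow> gz \<notin> B w"
proof -
  have sets: "B w \<in> sets Om" if "B \<in> \<B>" "w \<in> W" for B w
    using rare[OF that(1)] that(2) by (simp add: rare_def)
  have "\<exists>w\<in>W. \<exists>gz\<in>S w. \<forall>B\<in>\<B>. gz \<notin> B w"
  proof (rule ccontr)
    assume "\<not> ?thesis"
    then have covered: "S w \<subseteq> (\<Union>B\<in>\<B>. B w)" if "w \<in> W" for w
      using that by blast
    have card_W: "card W > 0" using W finite_W by (simp add: card_gt_0_iff)
    have "ennreal (real (card W) / 2) \<le> (\<Sum>w\<in>W. emeasure Om (S w))" by (rule half)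
    also have "\<dots> \<le> (\<Sum>w\<in>W. \<Sum>B\<in>\<B>. emeasure Om (B w))"
    proof (rule sum_mono)
      fix w assume w: "w \<in> W"
      have "emeasure Om (S w) \<le> emeasure Om (\<Union>B\<in>\<B>. B w)"
        using w sets covered fin by (intro emeasure_mono sets.finite_UN) auto
      also have "\<dots> \<le> (\<Sum>B\<in>\<B>. emeasure Om (B w))"
        using w sets fin by (intro emeasure_subadditive_finite) auto
      finally show "emeasure Om (S w) \<le> (\<Sum>B\<in>\<B>. emeasure Om (B w))" .
    qed
    also have "\<dots> = (\<Sum>B\<in>\<B>. \<Sum>w\<in>W. emeasure Om (B w))" by (rule sum.swap)
    also have "\<dots> \<le> (\<Sum>B\<in>\<B>. ennreal (c * real (card W)))"
      using rare by (intro sum_mono) (simp add: rare_def)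
    also have "\<dots> = ennreal (real (card \<B>) * c * real (card W))"
      using c by (subst sum_ennreal) (auto simp: mult_ac)
    finally have "real (card W) / 2 \<le> real (card \<B>) * c * real (card W)"
      using c by (subst (asm) ennreal_le_iff) auto
    moreover have "real (card \<B>) * c * real (card W) < 1 / 2 * real (card W)"
      using c(2) card_W by (intro mult_strict_right_mono) auto
    ultimately show False by simp
  qed
  then show ?thesis using that by blast
qed

definition output_density :: "nat \<Rightarrow> (nat \<Rightarrow> nat \<Rightarrow> nat \<Rightarrow> complex) \<Rightarrow> 'w \<Rightarrow> (nat \<times> nat \<Rightarrow> complex) \<Rightarrow> real" where
  "output_density k g w y = (\<Prod>t<n. cnormal_density 1 (y (t, k) - signal k g w t))"

definition output_noise ::
  "nat \<Rightarrow> (nat \<Rightarrow> nat \<Rightarrow> nat \<Rightarrow> complex) \<Rightarrow> 'w \<Rightarrow> (nat \<times> nat \<Rightarrow> complex) \<Rightarrow> nat \<times> nat \<Rightarrow> complex" where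
  "output_noise k g w = add_signal n K k (\<lambda>t. - signal k g w t)"

lemma signal_add_output_noise:
  "k < K \<Longrightarrow> t < n \<Longrightarrow> signal k g w t + output_noise k g w y (t, k) = y (t, k)"
  by (simp add: output_noise_def)

lemma lik_output_noise:
  assumes "k < K"
  shows "lik k {..<K} R w (g, output_noise k g w y) = (\<Sum>w'\<in>R `` {w}. output_density k g w' y)"
  unfolding lik_eq_signal output_density_def using assms
  by (intro sum.cong prod.cong refl) (simp add: signal_add_output_noise)

lemma output_density_pos: "output_density k g w y > 0"
  unfolding output_density_def by (intro prod_pos) simp

lemma measurable_output_density [measurable]:
  assumes "k < K"
  shows "output_density k g w \<in> borel_measurable (noise_reference n K k)"
proof -
  have [measurable]: "(\<lambda>y. y (t, k)) \<in> borel_measurable (noise_reference n K k)" if "t \<in> {..<n}" for t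
    using that assms by (intro measurable_noise_reference_component)
  show ?thesis unfolding output_density_def by measurable
qed

lemma nn_integral_output_density:
  assumes "k < K"
  shows "(\<integral>\<^sup>+y. ennreal (output_density k g w y) \<partial>noise_reference n K k) = 1"
proof -
  have "(\<integral>\<^sup>+y. ennreal (output_density k g w y) \<partial>noise_reference n K k)
      = (\<Prod>t<n. \<integral>\<^sup>+u. ennreal (cnormal_density 1 (u - signal k g w t)) \<partial>lborel)"
    using nn_integral_noise_reference_prod[OF assms,
      of n "\<lambda>t u. ennreal (cnormal_density 1 (u - signal k g w t))"]
    by (simp add: output_density_def prod_ennreal)
  then show ?thesis by (simp add: nn_integral_cnormal_density)
qed

lemma nn_integral_noise_eq_output_density:
  assumes "k < K" and "f \<in> borel_measurable (noise n K)"
  shows "(\<integral>\<^sup>+z. f z \<partial>noise n K)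
    = (\<integral>\<^sup>+y. ennreal (output_density k g w y) * f (output_noise k g w y) \<partial>noise_reference n K k)"
  unfolding output_density_def output_noise_def using assms by (rule nn_integral_noise_eq_output)

lemma sum_nn_integral_noise_posterior:
  fixes \<kappa> :: "'w \<Rightarrow> nat \<Rightarrow> complex \<Rightarrow> real"
  assumes k: "k < K" and R: "equiv W R"
    and [measurable]: "\<And>w t. \<kappa> w t \<in> borel_measurable borel" and \<kappa>_nonneg: "\<And>w t u. \<kappa> w t u \<ge> 0"
  shows "(\<Sum>w\<in>W. \<integral>\<^sup>+z. ennreal ((\<Sum>w'\<in>R `` {w}. \<Prod>t<n. \<kappa> w' t (signal k g w t + z (t, k)))
       / lik k {..<K} R w (g, z)) \<partial>noise n K)
     = (\<Sum>w\<in>W. \<Prod>t<n. \<integral>\<^sup>+u. ennreal (\<kappa> w t u) \<partial>lborel)"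
proof -
  let ?L = "noise_reference n K k" and ?p = "\<lambda>y w. output_density k g w y"
  define F where "F w z
      = ennreal ((\<Sum>w'\<in>R `` {w}. \<Prod>t<n. \<kappa> w' t (signal k g w t + z (t, k))) / lik k {..<K} R w (g, z))"
    for w z
  define h where "h w y = (\<Prod>t<n. \<kappa> w t (y (t, k)))" for w and y :: "nat \<times> nat \<Rightarrow> complex"
  have [measurable]: "(\<lambda>y. y (t, k)) \<in> borel_measurable ?L" "(\<lambda>y. y (t, k)) \<in> borel_measurable (noise n K)"
    if "t \<in> {..<n}" for t
    using that k by (auto intro: measurable_noise_reference_component measurable_noise_component)
  have h [measurable]: "h w \<in> borel_measurable ?L" for w
    unfolding h_def by measurable
  have h_nonneg: "h w y \<ge> 0" for w y
    unfolding h_def by (intro prod_nonneg) (simp add: \<kappa>_nonneg)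
  have F: "F w \<in> borel_measurable (noise n K)" for w
    unfolding F_def lik_eq_signal by measurable
  have "(\<integral>\<^sup>+z. F w z \<partial>noise n K)
      = (\<integral>\<^sup>+y. ennreal (posterior R (?p y) w) * (\<Sum>w'\<in>R `` {w}. ennreal (h w' y)) \<partial>?L)" for w
  proof -
    have "(\<Prod>t<n. \<kappa> w' t (signal k g w t + output_noise k g w y (t, k))) = h w' y" for w' y
      unfolding h_def using k by (intro prod.cong refl) (simp add: signal_add_output_noise)
    then have "F w (output_noise k g w y) = ennreal ((\<Sum>w'\<in>R `` {w}. h w' y) / (\<Sum>w'\<in>R `` {w}. ?p y w'))" for y
      using k by (simp add: F_def lik_output_noise)
    then have "(\<integral>\<^sup>+z. F w z \<partial>noise n K)
        = (\<integral>\<^sup>+y. ennreal (?p y w) * ennreal ((\<Sum>w'\<in>R `` {w}. h w' y) / (\<Sum>w'\<in>R `` {w}. ?p y w')) \<partial>?L)"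
      using nn_integral_noise_eq_output_density[OF k F, where g = g and w = w] by simp
    also have "\<dots> = (\<integral>\<^sup>+y. ennreal (posterior R (?p y) w) * (\<Sum>w'\<in>R `` {w}. ennreal (h w' y)) \<partial>?L)"
      using output_density_pos h_nonneg
      by (intro nn_integral_cong) (simp add: posterior_def sum_nonneg less_imp_le ennreal_mult[symmetric])
    finally show ?thesis .
  qed
  then have "(\<Sum>w\<in>W. \<integral>\<^sup>+z. F w z \<partial>noise n K) = (\<Sum>w\<in>W. \<integral>\<^sup>+y. ennreal (h w y) \<partial>?L)"
    using k output_density_pos by (simp add: sum_nn_integral_posterior[OF finite_W R])
  also have "\<dots> = (\<Sum>w\<in>W. \<Prod>t<n. \<integral>\<^sup>+u. ennreal (\<kappa> w t u) \<partial>lborel)"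
    using k \<kappa>_nonneg unfolding h_def
    by (simp add: prod_ennreal[symmetric] nn_integral_noise_reference_prod[where f = "\<lambda>t u. ennreal (\<kappa> _ t u)"])
  finally show ?thesis by (simp only: F_def)
qed

lemma sum_nn_integral_Om_posterior:
  fixes \<kappa> :: "(nat \<Rightarrow> nat \<Rightarrow> nat \<Rightarrow> complex) \<Rightarrow> 'w \<Rightarrow> nat \<Rightarrow> complex \<Rightarrow> real"
  assumes k: "k < K" and R: "equiv W R"
    and \<kappa>: "\<And>g w t. \<kappa> g w t \<in> borel_measurable borel" "\<And>g w t u. \<kappa> g w t u \<ge> 0"
    and total: "\<And>g w. w \<in> W \<Longrightarrow> (\<Prod>t<n. \<integral>\<^sup>+u. ennreal (\<kappa> g w t u) \<partial>lborel) = C"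
    and [measurable]:
      "\<And>w. (\<lambda>gz. \<Sum>w'\<in>R `` {w}. \<Prod>t<n. \<kappa> (fst gz) w' t (signal k (fst gz) w t + snd gz (t, k)))
      \<in> borel_measurable Om"
  shows "(\<Sum>w\<in>W. \<integral>\<^sup>+gz. ennreal ((\<Sum>w'\<in>R `` {w}. \<Prod>t<n. \<kappa> (fst gz) w' t (signal k (fst gz) w t + snd gz (t, k)))
      / lik k {..<K} R w gz) \<partial>Om) = C * of_nat (card W)"
proof -
  define U where "U w gz
      = ennreal ((\<Sum>w'\<in>R `` {w}. \<Prod>t<n. \<kappa> (fst gz) w' t (signal k (fst gz) w t + snd gz (t, k)))
      / lik k {..<K} R w gz)" for w gz
  have [measurable]: "lik k {..<K} R w \<in> borel_measurable Om" for w
    using k by (rule measurable_lik_Om) simp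
  have U: "U w \<in> borel_measurable Om" for w
    unfolding U_def by measurable
  have "(\<Sum>w\<in>W. \<integral>\<^sup>+gz. U w gz \<partial>Om) = (\<Sum>w\<in>W. \<integral>\<^sup>+g. \<integral>\<^sup>+z. U w (g, z) \<partial>noise n K \<partial>G)"
    using noise.nn_integral_fst[OF U] by simp
  also have "\<dots> = (\<integral>\<^sup>+g. (\<Sum>w\<in>W. \<integral>\<^sup>+z. U w (g, z) \<partial>noise n K) \<partial>G)"
    using noise.borel_measurable_nn_integral_fst[OF U] by (intro nn_integral_sum[symmetric])
  also have "\<dots> = (\<integral>\<^sup>+g. C * of_nat (card W) \<partial>G)"
    using sum_nn_integral_noise_posterior[OF k R \<kappa>] total
    by (intro nn_integral_cong) (simp add: U_def mult.commute)
  also have "\<dots> = C * of_nat (card W)"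
    by (simp add: emeasure_space_1)
  finally show ?thesis by (simp add: U_def)
qed

lemma rare_atypical_output:
  assumes k: "k < K" and R: "equiv W R" and c: "c \<ge> 0" and s: "s > 0"
  shows "rare c (\<lambda>w. {gz \<in> space Om. lik k {..<K} R w gz
      < c * (real (card (R `` {w})) * (\<Prod>t<n. cnormal_density s (signal k (fst gz) w t + snd gz (t, k))))})"
proof -
  define d where "d w gz = (\<Prod>t<n. cnormal_density s (signal k (fst gz) w t + snd gz (t, k)))"
    for w and gz :: "(nat \<Rightarrow> nat \<Rightarrow> nat \<Rightarrow> complex) \<times> (nat \<times> nat \<Rightarrow> complex)"
  have [measurable]: "(\<lambda>gz. snd gz (t, k)) \<in> borel_measurable Om" if "t \<in> {..<n}" for t
    using that k by (intro measurable_noise_Om) auto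
  have [measurable]: "(\<lambda>gz. signal k (fst gz) w t) \<in> borel_measurable Om" for w t
    using k by (intro measurable_signal measurable_gain_Om) auto
  have [measurable]: "lik k {..<K} R w \<in> borel_measurable Om" for w
    using k by (rule measurable_lik_Om) simp
  have d [measurable]: "d w \<in> borel_measurable Om" for w
    unfolding d_def by measurable
  have "(\<Sum>w\<in>W. emeasure Om {gz \<in> space Om. lik k {..<K} R w gz < c * (real (card (R `` {w})) * d w gz)})
      \<le> (\<Sum>w\<in>W. \<integral>\<^sup>+gz. ennreal (c * (real (card (R `` {w})) * d w gz) / lik k {..<K} R w gz) \<partial>Om)"
    by (intro sum_mono emeasure_less_le_nn_integral_ratio) (auto intro: lik_pos[OF R])
  also have "\<dots> = (\<Sum>w\<in>W. ennreal c * (\<integral>\<^sup>+gz. ennreal ((\<Sum>w'\<in>R `` {w}. d w gz) / lik k {..<K} R w gz) \<partial>Om))"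
    using c by (intro sum.cong refl, subst nn_integral_cmult[symmetric])
      (simp_all add: ennreal_mult'[symmetric])
  also have "\<dots> = ennreal c * (\<Sum>w\<in>W. \<integral>\<^sup>+gz. ennreal ((\<Sum>w'\<in>R `` {w}. d w gz) / lik k {..<K} R w gz) \<partial>Om)"
    by (rule sum_distrib_left[symmetric])
  also have "(\<Sum>w\<in>W. \<integral>\<^sup>+gz. ennreal ((\<Sum>w'\<in>R `` {w}. d w gz) / lik k {..<K} R w gz) \<partial>Om) = 1 * of_nat (card W)"
    unfolding d_def
  proof (rule sum_nn_integral_Om_posterior[OF k R])
    show "(\<Prod>t<n. \<integral>\<^sup>+u. ennreal (cnormal_density s u) \<partial>lborel) = 1"
      using nn_integral_cnormal_density[OF s, of 0] by simp
  qed (use s in simp_all)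
  also have "ennreal c * (1 * of_nat (card W)) = ennreal (c * real (card W))"
    using c by (simp add: ennreal_mult ennreal_of_nat_eq_real_of_nat)
  finally show ?thesis by (simp add: rare_def d_def[abs_def])
qed

lemma sets_unconfident:
  assumes "k < K" and "S \<in> sets Om"
  shows "{gz \<in> S. lik k {..<K} Q w gz < c * lik k {..<K} R w gz} \<in> sets Om"
proof -
  have [measurable]: "lik k {..<K} R w \<in> borel_measurable Om" for R
    using assms(1) by (rule measurable_lik_Om) simp
  have "{gz \<in> S. lik k {..<K} Q w gz < c * lik k {..<K} R w gz}
      = S \<inter> {gz \<in> space Om. lik k {..<K} Q w gz < c * lik k {..<K} R w gz}"
    using sets.sets_into_space[OF assms(2)] by blast
  also have "\<dots> \<in> sets Om" using assms(2) by (rule sets.Int) measurable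
  finally show ?thesis .
qed

lemma sum_nn_integral_unconfident_le:
  assumes k: "k < K" and R: "equiv W R" and Q: "Q \<subseteq> R" and c: "c \<ge> 0" and g: "g \<in> space G"
    and S: "\<And>w. w \<in> W \<Longrightarrow> S w \<in> sets Om"
    and dec: "\<And>w w' z z'. (w, w') \<in> R \<Longrightarrow> (g, z) \<in> S w \<Longrightarrow> (g, z') \<in> S w' \<Longrightarrow>
      (\<And>t. t < n \<Longrightarrow> signal k g w t + z (t, k) = signal k g w' t + z' (t, k)) \<Longrightarrow> (w, w') \<in> Q"
  shows "(\<Sum>w\<in>W. \<integral>\<^sup>+z. indicator {gz \<in> S w. lik k {..<K} Q w gz < c * lik k {..<K} R w gz} (g, z) \<partial>noise n K)
    \<le> ennreal (c * real (card W))"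
proof -
  let ?L = "noise_reference n K k" and ?p = "output_density k g"
  let ?X = "\<lambda>w. {gz \<in> S w. lik k {..<K} Q w gz < c * lik k {..<K} R w gz}"
  define T where "T w = {y \<in> space ?L. (g, output_noise k g w y) \<in> S w}" for w
  let ?low = "\<lambda>w. {y \<in> T w. (\<Sum>w'\<in>Q `` {w}. ?p w' y) < c * (\<Sum>w'\<in>R `` {w}. ?p w' y)}"
  have T: "T w \<in> sets ?L" if "w \<in> W" for w
  proof -
    have "(\<lambda>y. (g, output_noise k g w y)) \<in> measurable ?L Om"
      using g unfolding output_noise_def by (intro measurable_Pair measurable_const measurable_add_signal)
    from measurable_sets[OF this S[OF that]] show ?thesis
      by (simp add: T_def vimage_def Int_def conj_commute)
  qed
  have "(\<integral>\<^sup>+z. indicator (?X w) (g, z) \<partial>noise n K) = (\<integral>\<^sup>+y. ennreal (?p w y) * indicator (?low w) y \<partial>?L)"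
    if w: "w \<in> W" for w
  proof -
    have "(\<lambda>z. indicator (?X w) (g, z) :: ennreal) \<in> borel_measurable (noise n K)"
      using sets_unconfident[OF k S[OF w]] g
      by (intro measurable_Pair2[of _ _ "noise n K"] borel_measurable_indicator)
    then have "(\<integral>\<^sup>+z. indicator (?X w) (g, z) \<partial>noise n K)
        = (\<integral>\<^sup>+y. ennreal (?p w y) * indicator (?X w) (g, output_noise k g w y) \<partial>?L)"
      by (rule nn_integral_noise_eq_output_density[OF k])
    also have "\<dots> = (\<integral>\<^sup>+y. ennreal (?p w y) * indicator (?low w) y \<partial>?L)"
      using k by (intro nn_integral_cong) (simp add: T_def lik_output_noise indicator_def)
    finally show ?thesis .
  qed
  then have "(\<Sum>w\<in>W. \<integral>\<^sup>+z. indicator (?X w) (g, z) \<partial>noise n K)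
      = (\<Sum>w\<in>W. \<integral>\<^sup>+y. ennreal (?p w y) * indicator (?low w) y \<partial>?L)"
    by simp
  also have "\<dots> \<le> ennreal c * (\<Sum>w\<in>W. \<integral>\<^sup>+y. ennreal (?p w y) \<partial>?L)"
  proof (rule sum_nn_integral_low_posterior_le[OF finite_W R Q output_density_pos c measurable_output_density[OF k] T])
    fix w w' y assume "y \<in> T w" "y \<in> T w'" "(w, w') \<in> R"
    then show "(w, w') \<in> Q"
      using k by (intro dec[of w w' "output_noise k g w y" "output_noise k g w' y"])
        (auto simp: T_def signal_add_output_noise)
  qed
  also have "\<dots> = ennreal (c * real (card W))"
    using c k by (simp add: nn_integral_output_density ennreal_mult ennreal_of_nat_eq_real_of_nat)
  finally show ?thesis .
qed

lemma rare_unconfident: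
  assumes k: "k < K" and R: "equiv W R" and Q: "Q \<subseteq> R" and c: "c \<ge> 0"
    and S: "\<And>w. w \<in> W \<Longrightarrow> S w \<in> sets Om"
    and dec: "\<And>w w' g z z'. (w, w') \<in> R \<Longrightarrow> (g, z) \<in> S w \<Longrightarrow> (g, z') \<in> S w' \<Longrightarrow>
      (\<And>t. t < n \<Longrightarrow> signal k g w t + z (t, k) = signal k g w' t + z' (t, k)) \<Longrightarrow> (w, w') \<in> Q"
  shows "rare c (\<lambda>w. {gz \<in> S w. lik k {..<K} Q w gz < c * lik k {..<K} R w gz})"
proof -
  let ?X = "\<lambda>w. {gz \<in> S w. lik k {..<K} Q w gz < c * lik k {..<K} R w gz}"
  have X: "?X w \<in> sets Om" if "w \<in> W" for w
    using sets_unconfident[OF k S[OF that]] .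
  have measurable_ind: "(indicator (?X w) :: _ \<Rightarrow> ennreal) \<in> borel_measurable Om" if "w \<in> W" for w
    using X[OF that] by simp
  have "(\<Sum>w\<in>W. emeasure Om (?X w)) = (\<Sum>w\<in>W. \<integral>\<^sup>+g. \<integral>\<^sup>+z. indicator (?X w) (g, z) \<partial>noise n K \<partial>G)"
    using X by (intro sum.cong refl) (simp add: noise.nn_integral_fst[OF measurable_ind])
  also have "\<dots> = (\<integral>\<^sup>+g. (\<Sum>w\<in>W. \<integral>\<^sup>+z. indicator (?X w) (g, z) \<partial>noise n K) \<partial>G)"
    using noise.borel_measurable_nn_integral_fst[OF measurable_ind] by (intro nn_integral_sum[symmetric])
  also have "\<dots> \<le> (\<integral>\<^sup>+g. ennreal (c * real (card W)) \<partial>G)"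
    using dec by (intro nn_integral_mono sum_nn_integral_unconfident_le k R Q c S) blast+
  also have "\<dots> = ennreal (c * real (card W))" by (simp add: emeasure_space_1)
  finally show ?thesis using X by (simp add: rare_def)
qed

end

subsection \<open>Aligned images\<close>

definition pointwise_const :: "nat \<Rightarrow> real \<Rightarrow> real \<Rightarrow> real" where
  "pointwise_const K d c
      = (2 + 4 * d\<^sup>2 * (real K)\<^sup>2 + 4 * d\<^sup>2) * exp (3 * c + 4 * (real K)\<^sup>2 + 8 * d\<^sup>2 * (real K)\<^sup>2)"

lemma pointwise_const_pos: "pointwise_const K d c > 0"
  unfolding pointwise_const_def by (intro mult_pos_pos add_pos_nonneg) auto

definition align_const :: "nat \<Rightarrow> real \<Rightarrow> real \<Rightarrow> real \<Rightarrow> real" where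
  "align_const K f d c = (f * (pi * d\<^sup>2 + 1)) ^ K * pointwise_const K d c * (4 * exp 1 * pi)"

lemma align_const_pos: "f > 0 \<Longrightarrow> align_const K f d c > 0"
  unfolding align_const_def
  by (intro mult_pos_pos pointwise_const_pos zero_less_power add_nonneg_pos) auto

context fading_code
begin

lemma gain_sum_le:
  assumes "bounded_gains k g" and "t < n"
  shows "cmod (\<Sum>i<K. complex_of_real (a k i) * g t k i * v i) \<le> dmax * (\<Sum>i<K. a k i * cmod (v i))"
proof -
  have "cmod (\<Sum>i<K. complex_of_real (a k i) * g t k i * v i) \<le> (\<Sum>i<K. dmax * (a k i * cmod (v i)))"
  proof (rule sum_norm_le)
    fix i assume "i \<in> {..<K}"
    then have "cmod (g t k i) * (a k i * cmod (v i)) \<le> dmax * (a k i * cmod (v i))"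
      using assms amplitude_nonneg by (intro mult_right_mono) (auto simp: bounded_gains_def)
    then show "cmod (complex_of_real (a k i) * g t k i * v i) \<le> dmax * (a k i * cmod (v i))"
      using amplitude_nonneg[of k i] by (simp add: norm_mult mult_ac)
  qed
  then show ?thesis by (simp add: sum_distrib_left)
qed

lemma received_energy_le:
  assumes g: "bounded_gains k g" "t < n" and R: "R \<ge> 1" "\<And>i. i < K \<Longrightarrow> a k i \<le> R"
  shows "(cmod (x + (\<Sum>i<K. complex_of_real (a k i) * g t k i * v i)))\<^sup>2 / R\<^sup>2
    \<le> 2 * (cmod x)\<^sup>2 + 2 * dmax\<^sup>2 * real K * (\<Sum>i<K. (cmod (v i))\<^sup>2)"
proof -
  let ?y = "x + (\<Sum>i<K. complex_of_real (a k i) * g t k i * v i)" and ?e = "\<Sum>i<K. cmod (v i)"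
  have "cmod ?y \<le> cmod x + dmax * (\<Sum>i<K. a k i * cmod (v i))"
    using gain_sum_le[OF g] by (rule norm_triangle_mono[OF order_refl])
  also have "\<dots> \<le> R * cmod x + dmax * (\<Sum>i<K. R * cmod (v i))"
    using R dmax_pos by (intro add_mono mult_left_mono sum_mono mult_right_mono)
      (auto simp: mult_le_cancel_right1)
  also have "\<dots> = R * (cmod x + dmax * ?e)"
    by (simp add: algebra_simps sum_distrib_left)
  finally have "cmod ?y / R \<le> cmod x + dmax * ?e"
    using R(1) by (simp add: divide_le_eq mult.commute)
  then have "(cmod ?y / R)\<^sup>2 \<le> (cmod x + dmax * ?e)\<^sup>2"
    using R(1) by (intro power_mono) auto
  also have "\<dots> \<le> 2 * (cmod x)\<^sup>2 + 2 * (dmax * ?e)\<^sup>2" by (rule power2_sum_le)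
  also have "(dmax * ?e)\<^sup>2 \<le> dmax\<^sup>2 * ((\<Sum>i<K. (cmod (v i))\<^sup>2) * real K)"
    unfolding power_mult_distrib using sum_squared_le_sum_of_squares[of "\<lambda>i. cmod (v i)" "{..<K}"]
    by (intro mult_left_mono) auto
  finally show ?thesis by (simp add: power_divide mult_ac)
qed

lemma codeword_diff_energy_le:
  assumes "w \<in> W" and "w' \<in> W"
  shows "(\<Sum>t<n. \<Sum>i<K. (cmod (E w i t - E w' i t))\<^sup>2) \<le> 4 * real K * real n"
proof -
  have "(cmod (E w i t - E w' i t))\<^sup>2 \<le> 2 * (cmod (E w i t))\<^sup>2 + 2 * (cmod (E w' i t))\<^sup>2" for i t
    by (rule order_trans[OF power_mono[OF norm_triangle_ineq4] power2_sum_le]) simp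
  then have "(\<Sum>t<n. \<Sum>i<K. (cmod (E w i t - E w' i t))\<^sup>2)
      \<le> (\<Sum>t<n. \<Sum>i<K. 2 * (cmod (E w i t))\<^sup>2 + 2 * (cmod (E w' i t))\<^sup>2)"
    by (intro sum_mono)
  also have "\<dots> = (\<Sum>i<K. 2 * (\<Sum>t<n. (cmod (E w i t))\<^sup>2) + 2 * (\<Sum>t<n. (cmod (E w' i t))\<^sup>2))"
    by (simp only: sum_distrib_left sum.distrib[symmetric] sum.swap[of _ "{..<K}" "{..<n}"])
  also have "\<dots> \<le> (\<Sum>i<K. 2 * real n + 2 * real n)"
    using power_le assms by (intro sum_mono add_mono mult_left_mono) auto
  finally show ?thesis by simp
qed

definition max_gap :: "nat \<Rightarrow> nat set \<Rightarrow> 'w \<Rightarrow> 'w \<Rightarrow> nat \<Rightarrow> real" where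
  "max_gap k I w w' t = Max ((\<lambda>i. a k i * cmod (E w' i t - E w i t)) ` I)"

lemma max_gap_ge: "finite I \<Longrightarrow> i \<in> I \<Longrightarrow> a k i * cmod (E w' i t - E w i t) \<le> max_gap k I w w' t"
  unfolding max_gap_def by (intro Max_ge) auto

lemma max_gap_attained:
  assumes "finite I" and "I \<noteq> {}"
  obtains i where "i \<in> I" "max_gap k I w w' t = a k i * cmod (E w' i t - E w i t)"
proof -
  have "max_gap k I w w' t \<in> (\<lambda>i. a k i * cmod (E w' i t - E w i t)) ` I"
    unfolding max_gap_def using assms by (intro Max_in) auto
  then show ?thesis using that by auto
qed

lemma max_gap_nonneg:
  assumes "finite I" and "I \<noteq> {}"
  shows "max_gap k I w w' t \<ge> 0"
  by (rule max_gap_attained[OF assms, of k w w' t]) (simp add: amplitude_nonneg)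

text \<open>In each time slot it is enough to average over the gain of the input with the largest gap.\<close>
lemma nn_integral_codeword_disc_le:
  assumes I: "I \<subseteq> {..<K}" "I \<noteq> {}"
  shows "(\<integral>\<^sup>+x. (\<Prod>t<n. ennreal (cnormal_density 1
        (z (t, k) - (\<Sum>i\<in>I. complex_of_real (a k i) * x (t, k, i) * (E w' i t - E w i t)))))
      \<partial>PiM ({..<n} \<times> {k} \<times> {..<K}) (\<lambda>_. disc_lborel dmax))
    \<le> ennreal ((pi * dmax\<^sup>2 + 1) ^ (n * K) * (\<Prod>t<n. 1 / (1 + (max_gap k I w w' t)\<^sup>2)))"
proof -
  let ?J = "{..<n} \<times> {k} \<times> {..<K}" and ?v = "\<lambda>i t. E w' i t - E w i t"
  have "finite I" using I finite_subset by blast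
  then have "\<exists>i. i \<in> I \<and> max_gap k I w w' t = a k i * cmod (?v i t)" for t
    using max_gap_attained[OF _ I(2)] by metis
  then obtain \<iota> where \<iota>: "\<And>t. \<iota> t \<in> I" "\<And>t. max_gap k I w w' t = a k (\<iota> t) * cmod (?v (\<iota> t) t)" by metis
  define c :: "nat \<Rightarrow> nat \<times> nat \<times> nat \<Rightarrow> complex"
    where "c t = (\<lambda>(t', k', i). if t' = t \<and> i \<in> I then complex_of_real (a k i) * ?v i t else 0)" for t
  have "(\<Sum>i\<in>I. complex_of_real (a k i) * x (t, k, i) * ?v i t) = (\<Sum>j\<in>?J. c t j * x j)" if "t < n" for t x
  proof -
    have "(\<Sum>j\<in>?J. c t j * x j) = (\<Sum>j\<in>{t} \<times> {k} \<times> I. c t j * x j)"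
    proof (rule sum.mono_neutral_right)
      show "\<forall>j\<in>?J - {t} \<times> {k} \<times> I. c t j * x j = 0"
        unfolding c_def by clarsimp
    qed (use that I in auto)
    also have "{t} \<times> {k} \<times> I = (\<lambda>i. (t, k, i)) ` I" by auto
    also have "(\<Sum>j\<in>(\<lambda>i. (t, k, i)) ` I. c t j * x j) = (\<Sum>i\<in>I. c t (t, k, i) * x (t, k, i))"
      by (simp add: sum.reindex inj_on_def)
    also have "\<dots> = (\<Sum>i\<in>I. complex_of_real (a k i) * x (t, k, i) * ?v i t)"
      by (intro sum.cong) (simp_all add: c_def)
    finally show ?thesis ..
  qed
  moreover have "(\<integral>\<^sup>+x. (\<Prod>t<n. ennreal (cnormal_density 1 (z (t, k) - (\<Sum>j\<in>?J. c t j * x j))))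
        \<partial>PiM ?J (\<lambda>_. disc_lborel dmax))
      \<le> ennreal ((pi * dmax\<^sup>2 + 1) ^ card ?J * (\<Prod>t<n. 1 / (1 + (cmod (c t (t, k, \<iota> t)))\<^sup>2)))"
    using \<iota> I dmax_pos by (intro nn_integral_PiM_disc_affine_le) (auto simp: inj_on_def c_def)
  ultimately show ?thesis
    using \<iota> amplitude_nonneg by (simp add: c_def norm_mult card_cartesian_product)
qed

lemma nn_integral_lik_disc_le:
  assumes I: "I \<subseteq> {..<K}" "I \<noteq> {}"
  shows "(\<integral>\<^sup>+x. ennreal (lik k I R w (gain_process x, z)) \<partial>PiM ({..<n} \<times> {k} \<times> {..<K}) (\<lambda>_. disc_lborel dmax))
    \<le> (\<Sum>w'\<in>R `` {w}. ennreal ((pi * dmax\<^sup>2 + 1) ^ (n * K) * (\<Prod>t<n. 1 / (1 + (max_gap k I w w' t)\<^sup>2))))"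
proof -
  let ?M = "PiM ({..<n} \<times> {k} \<times> {..<K}) (\<lambda>_. disc_lborel dmax)"
  define f where "f w' x = (\<Prod>t<n. ennreal (cnormal_density 1
      (z (t, k) - (\<Sum>i\<in>I. complex_of_real (a k i) * x (t, k, i) * (E w' i t - E w i t)))))"
    for w' and x :: "nat \<times> nat \<times> nat \<Rightarrow> complex"
  have "(\<integral>\<^sup>+x. f w' x \<partial>?M) \<le> ennreal ((pi * dmax\<^sup>2 + 1) ^ (n * K) * (\<Prod>t<n. 1 / (1 + (max_gap k I w w' t)\<^sup>2)))"
    for w'
    unfolding f_def by (rule nn_integral_codeword_disc_le[OF I])
  moreover have "f w' \<in> borel_measurable ?M" for w'
  proof -
    have [measurable]: "(\<lambda>x. x (t, k, i)) \<in> borel_measurable ?M" if "t \<in> {..<n}" "i \<in> I" for t i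
      using that I measurable_component_singleton[of "(t, k, i)" "{..<n} \<times> {k} \<times> {..<K}" "\<lambda>_. disc_lborel dmax"]
      by (auto cong: measurable_cong_sets)
    show ?thesis unfolding f_def by measurable
  qed
  moreover have "ennreal (lik k I R w (gain_process x, z)) = (\<Sum>w'\<in>R `` {w}. f w' x)" for x
    unfolding f_def by (simp add: lik_def gain_process_def prod_ennreal prod_nonneg)
  ultimately show ?thesis by (simp only: nn_integral_sum sum_mono)
qed

lemma nn_integral_lik_mult_le:
  assumes k: "ka < K" "kb < K" "ka \<noteq> kb" and I: "I \<subseteq> {..<K}" "I \<noteq> {}"
    and v: "(\<lambda>x. v (gain_process x)) \<in> borel_measurable (PiM ({..<n} \<times> {ka} \<times> {..<K}) (\<lambda>_. borel))"
    and v_restrict: "\<And>g. v (gain_process (restrict (gain_family g) ({..<n} \<times> {ka} \<times> {..<K}))) = v g"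
  shows "(\<integral>\<^sup>+g. ennreal (lik kb I R w (g, z)) * v g \<partial>G)
    \<le> ennreal ((fmax * (pi * dmax\<^sup>2 + 1)) ^ (n * K) * (\<Sum>w'\<in>R `` {w}. \<Prod>t<n. 1 / (1 + (max_gap kb I w w' t)\<^sup>2))) *
      (\<integral>\<^sup>+g. v g \<partial>G)"
proof -
  let ?A = "{..<n} \<times> {kb} \<times> {..<K}" and ?B = "{..<n} \<times> {ka} \<times> {..<K}"
  let ?q = "\<lambda>w'. \<Prod>t<n. 1 / (1 + (max_gap kb I w w' t)\<^sup>2)"
  define u where "u x = ennreal (lik kb I R w (gain_process x, z))" for x
  define V where "V = pi * dmax\<^sup>2 + 1"
  have V: "V > 0" by (simp add: V_def add_nonneg_pos)
  have card_A: "card ?A = n * K" by (simp add: card_cartesian_product)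
  have u: "u \<in> borel_measurable (PiM ?A (\<lambda>_. borel))"
    unfolding u_def using I
    by (intro measurable_compose[OF _ measurable_ennreal] measurable_lik) (auto intro!: measurable_gain_process)
  have u_restrict: "u (restrict (gain_family g) ?A) = ennreal (lik kb I R w (g, z))" for g
    unfolding u_def using I by (intro arg_cong[where f = ennreal] lik_cong) auto
  have "(\<integral>\<^sup>+g. ennreal (lik kb I R w (g, z)) * v g \<partial>G)
      = (\<integral>\<^sup>+g. u (restrict (gain_family g) ?A) * v (gain_process (restrict (gain_family g) ?B)) \<partial>G)"
    by (simp only: u_restrict v_restrict)
  also have "\<dots> \<le> ennreal (fmax ^ (n * K)) * (\<integral>\<^sup>+x. u x \<partial>PiM ?A (\<lambda>_. disc_lborel dmax)) * (\<integral>\<^sup>+g. v g \<partial>G)"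
    using k nn_integral_gains_mult_le[OF _ _ _ _ _ u v] unfolding v_restrict card_A by (auto simp: coords_def)
  also have "\<dots> \<le> ennreal (fmax ^ (n * K)) * (\<Sum>w'\<in>R `` {w}. ennreal (V ^ (n * K) * ?q w')) * (\<integral>\<^sup>+g. v g \<partial>G)"
    unfolding u_def V_def by (intro mult_right_mono mult_left_mono nn_integral_lik_disc_le[OF I]) simp_all
  also have "(\<Sum>w'\<in>R `` {w}. ennreal (V ^ (n * K) * ?q w')) = ennreal (V ^ (n * K) * (\<Sum>w'\<in>R `` {w}. ?q w'))"
    using V unfolding sum_distrib_left by (intro sum_ennreal mult_nonneg_nonneg prod_nonneg) auto
  also have "ennreal (fmax ^ (n * K)) * \<dots> = ennreal ((fmax * V) ^ (n * K) * (\<Sum>w'\<in>R `` {w}. ?q w'))"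
    using fmax_pos by (simp add: ennreal_mult'[symmetric] power_mult_distrib mult.assoc)
  finally show ?thesis by (simp only: V_def)
qed

lemma sets_misaligned:
  assumes "ka < K" and "kb < K" and "I \<subseteq> {..<K}"
  shows "{gz \<in> typical c. \<Lambda> * lik ka {..<K} R w gz < lik kb I R w gz} \<in> sets Om"
proof -
  have [measurable]: "lik ka {..<K} R w \<in> borel_measurable Om" "lik kb I R w \<in> borel_measurable Om"
    using assms by (auto intro: measurable_lik_Om)
  have "{gz \<in> typical c. \<Lambda> * lik ka {..<K} R w gz < lik kb I R w gz}
      = typical c \<inter> {gz \<in> space Om. \<Lambda> * lik ka {..<K} R w gz < lik kb I R w gz}"
    using sets.sets_into_space[OF sets_typical] by blast
  also have "\<dots> \<in> sets Om" using sets_typical by (rule sets.Int) measurable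
  finally show ?thesis .
qed

end

locale aligned_receivers = fading_code K fmax dmin dmax G n a W E
  for K :: nat and fmax dmin dmax :: real and G :: "(nat \<Rightarrow> nat \<Rightarrow> nat \<Rightarrow> complex) measure" and n :: nat
    and a :: "nat \<Rightarrow> nat \<Rightarrow> real" and W :: "'w set" and E :: "'w \<Rightarrow> nat \<Rightarrow> nat \<Rightarrow> complex" +
  fixes ka kb :: nat and I :: "nat set" and D \<rho> :: real and J :: nat
  assumes receivers: "ka < K" "kb < K" "ka \<noteq> kb" and I: "I \<subseteq> {..<K}" "I \<noteq> {}"
    and D: "D \<ge> 1" and \<rho>: "\<rho> \<ge> 1"
    and le_D: "\<And>i. i \<in> I \<Longrightarrow> a ka i \<le> D * a kb i" "\<And>i. i < K \<Longrightarrow> i \<notin> I \<Longrightarrow> a ka i \<le> D"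
    and le_\<rho>: "\<And>i. i < K \<Longrightarrow> a ka i \<le> \<rho>" and J: "\<rho>\<^sup>2 \<le> 4 ^ J * D\<^sup>2"
begin

lemma D_pos: "D > 0"
  using D by simp

lemma finite_I: "finite I"
  using I(1) finite_subset by blast

definition output_diff ::
  "(nat \<Rightarrow> nat \<Rightarrow> nat \<Rightarrow> complex) \<times> (nat \<times> nat \<Rightarrow> complex) \<Rightarrow> 'w \<Rightarrow> 'w \<Rightarrow> nat \<Rightarrow> complex" where
  "output_diff gz w w' t = signal ka (fst gz) w t + snd gz (t, ka) - signal ka (fst gz) w' t"

definition mixture_lik ::
  "('w \<times> 'w) set \<Rightarrow> 'w \<Rightarrow> (nat \<Rightarrow> nat \<Rightarrow> nat \<Rightarrow> complex) \<times> (nat \<times> nat \<Rightarrow> complex) \<Rightarrow> real" where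
  "mixture_lik R w gz = (\<Sum>w'\<in>R `` {w}. \<Prod>t<n. dyadic_mixture D J (output_diff gz w w' t))"

lemma output_diff_eq:
  "output_diff (g, z) w w' t = z (t, ka) + (\<Sum>i<K. complex_of_real (a ka i) * g t ka i * (E w i t - E w' i t))"
  by (simp add: output_diff_def signal_def algebra_simps sum_subtractf)

lemma prod_dyadic_mixture_nonneg: "(\<Prod>t<n. dyadic_mixture D J (u t)) \<ge> 0"
  using D_pos by (intro prod_nonneg dyadic_mixture_nonneg) simp

lemma measurable_mixture_lik: "mixture_lik R w \<in> borel_measurable Om"
proof -
  have [measurable]: "(\<lambda>gz. snd gz (t, ka)) \<in> borel_measurable Om" if "t \<in> {..<n}" for t
    using that receivers by (intro measurable_noise_Om) auto
  have [measurable]: "(\<lambda>gz. signal ka (fst gz) w t) \<in> borel_measurable Om" for w t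
    using receivers by (intro measurable_signal measurable_gain_Om)
  show ?thesis unfolding mixture_lik_def output_diff_def by measurable
qed

lemma scaled_codeword_diff_le:
  assumes "i < K"
  shows "a ka i * cmod (E w i t - E w' i t) \<le> D * max_gap kb I w w' t + D * cmod (E w i t - E w' i t)"
proof (cases "i \<in> I")
  case True
  have "a ka i * cmod (E w i t - E w' i t) \<le> D * (a kb i * cmod (E w i t - E w' i t))"
    using le_D(1)[OF True] by (simp add: mult.assoc[symmetric] mult_right_mono)
  also have "\<dots> \<le> D * max_gap kb I w w' t"
    using max_gap_ge[OF finite_I True, of kb w' t w] D by (simp add: norm_minus_commute)
  finally show ?thesis using D by (simp add: add_increasing2)
next
  case False
  then have "a ka i * cmod (E w i t - E w' i t) \<le> D * cmod (E w i t - E w' i t)"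
    using le_D(2) assms by (intro mult_right_mono) auto
  then show ?thesis using D max_gap_nonneg[OF finite_I I(2)] by (simp add: add_increasing)
qed

lemma output_diff_le:
  assumes g: "bounded_gains ka g" and t: "t < n"
  shows "cmod (output_diff (g, z) w w' t) / D
    \<le> cmod (z (t, ka)) + dmax * (real K * max_gap kb I w w' t + (\<Sum>i<K. cmod (E w i t - E w' i t)))"
    (is "_ \<le> _ + dmax * (?m + ?e)")
proof -
  have "(\<Sum>i<K. a ka i * cmod (E w i t - E w' i t))
      \<le> (\<Sum>i<K. D * max_gap kb I w w' t + D * cmod (E w i t - E w' i t))"
    by (intro sum_mono scaled_codeword_diff_le) simp
  also have "\<dots> = D * (?m + ?e)"
    by (simp add: sum.distrib sum_distrib_left algebra_simps)
  finally have "cmod (output_diff (g, z) w w' t) \<le> cmod (z (t, ka)) + dmax * (D * (?m + ?e))"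
    using gain_sum_le[OF g t, of "\<lambda>i. E w i t - E w' i t"] dmax_pos unfolding output_diff_eq
    by (intro norm_triangle_mono[OF order_refl]) (auto intro: order_trans mult_left_mono)
  also have "\<dots> \<le> D * cmod (z (t, ka)) + dmax * (D * (?m + ?e))"
    using D by (simp add: mult_le_cancel_right1)
  finally show ?thesis using D by (simp add: divide_le_eq algebra_simps)
qed

lemma output_diff_energy_le:
  assumes w: "w \<in> W" "w' \<in> W" and g: "bounded_gains ka g" and z: "bounded_noise c ka z"
  shows "(\<Sum>t<n. (cmod (output_diff (g, z) w w' t))\<^sup>2 / \<rho>\<^sup>2) \<le> real n * (2 * c + 8 * dmax\<^sup>2 * (real K)\<^sup>2)"
proof -
  have "(\<Sum>t<n. (cmod (output_diff (g, z) w w' t))\<^sup>2 / \<rho>\<^sup>2)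
      \<le> (\<Sum>t<n. 2 * (cmod (z (t, ka)))\<^sup>2 + 2 * dmax\<^sup>2 * real K * (\<Sum>i<K. (cmod (E w i t - E w' i t))\<^sup>2))"
    unfolding output_diff_eq using g \<rho> le_\<rho> by (intro sum_mono received_energy_le) auto
  also have "\<dots> \<le> 2 * (c * real n) + 2 * dmax\<^sup>2 * real K * (4 * real K * real n)"
    unfolding sum.distrib sum_distrib_left[symmetric]
    using z by (intro add_mono mult_left_mono codeword_diff_energy_le w) (auto simp: bounded_noise_def)
  finally show ?thesis by (simp add: power2_eq_square algebra_simps)
qed

lemma codeword_diff_norm_energy_le:
  assumes "w \<in> W" "w' \<in> W"
  shows "(\<Sum>t<n. (\<Sum>i<K. cmod (E w i t - E w' i t))\<^sup>2) \<le> real n * (4 * (real K)\<^sup>2)"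
proof -
  have "(\<Sum>t<n. (\<Sum>i<K. cmod (E w i t - E w' i t))\<^sup>2) \<le> (\<Sum>t<n. real K * (\<Sum>i<K. (cmod (E w i t - E w' i t))\<^sup>2))"
    using sum_squared_le_sum_of_squares[of "\<lambda>i. cmod (E w i _ - E w' i _)" "{..<K}"]
    by (intro sum_mono) (simp add: mult.commute)
  also have "\<dots> \<le> real K * (4 * real K * real n)"
    unfolding sum_distrib_left[symmetric] by (intro mult_left_mono codeword_diff_energy_le assms) simp
  finally show ?thesis by (simp add: power2_eq_square mult_ac)
qed

lemma prod_Cauchy_le_dyadic_mixture:
  assumes w: "w \<in> W" "w' \<in> W" and g: "bounded_gains ka g" and z: "bounded_noise c ka z"
  shows "(\<Prod>t<n. 1 / (1 + (max_gap kb I w w' t)\<^sup>2))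
    \<le> pointwise_const K dmax c ^ n * (\<Prod>t<n. dyadic_mixture D J (output_diff (g, z) w w' t))"
proof -
  define e where "e t = (\<Sum>i<K. cmod (E w i t - E w' i t))" for t
  define u where "u = output_diff (g, z) w w'"
  define s where "s t = (cmod (z (t, ka)))\<^sup>2 + (e t)\<^sup>2 + (cmod (u t))\<^sup>2 / \<rho>\<^sup>2" for t
  define L where "L = 2 + 4 * dmax\<^sup>2 * (real K)\<^sup>2 + 4 * dmax\<^sup>2"
  have L: "L > 0" unfolding L_def by (intro add_pos_nonneg) auto
  have "(\<Sum>t<n. (cmod (z (t, ka)))\<^sup>2) \<le> real n * c"
    using z by (simp add: bounded_noise_def mult.commute)
  then have exp_le: "exp (\<Sum>t<n. s t) \<le> exp (real n * (3 * c + 4 * (real K)\<^sup>2 + 8 * dmax\<^sup>2 * (real K)\<^sup>2))"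
    using codeword_diff_norm_energy_le[OF w] output_diff_energy_le[OF w g z]
    by (simp add: s_def e_def u_def sum.distrib algebra_simps)
  have "(\<Prod>t<n. 1 / (1 + (max_gap kb I w w' t)\<^sup>2)) \<le> (\<Prod>t<n. L * exp (s t) * dyadic_mixture D J (u t))"
    unfolding L_def s_def using D_pos \<rho> J output_diff_le[OF g]
    by (intro prod_mono conjI Cauchy_le_dyadic_mixture) (auto simp: u_def e_def)
  also have "\<dots> = L ^ n * exp (\<Sum>t<n. s t) * (\<Prod>t<n. dyadic_mixture D J (u t))"
    by (simp add: prod.distrib exp_sum)
  also have "\<dots> \<le> L ^ n * exp (real n * (3 * c + 4 * (real K)\<^sup>2 + 8 * dmax\<^sup>2 * (real K)\<^sup>2)) *
      (\<Prod>t<n. dyadic_mixture D J (u t))"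
    using exp_le L by (intro mult_right_mono mult_left_mono prod_dyadic_mixture_nonneg) auto
  also have "\<dots> = pointwise_const K dmax c ^ n * (\<Prod>t<n. dyadic_mixture D J (u t))"
    by (simp add: pointwise_const_def L_def power_mult_distrib exp_of_nat_mult)
  finally show ?thesis by (simp add: u_def)
qed

lemma sum_prod_Cauchy_le_mixture_lik:
  assumes R: "equiv W R" and w: "w \<in> W" and g: "bounded_gains ka g" and z: "bounded_noise c ka z"
  shows "(\<Sum>w'\<in>R `` {w}. \<Prod>t<n. 1 / (1 + (max_gap kb I w w' t)\<^sup>2))
      \<le> pointwise_const K dmax c ^ n * mixture_lik R w (g, z)"
  unfolding mixture_lik_def sum_distrib_left
  using equiv_type[OF R] by (intro sum_mono prod_Cauchy_le_dyadic_mixture w g z) auto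

definition truncated_inverse_lik ::
  "('w \<times> 'w) set \<Rightarrow> 'w \<Rightarrow> (nat \<times> nat \<Rightarrow> complex) \<Rightarrow> (nat \<Rightarrow> nat \<Rightarrow> nat \<Rightarrow> complex) \<Rightarrow> ennreal" where
  "truncated_inverse_lik R w z g = (if bounded_gains ka g then ennreal (1 / lik ka {..<K} R w (g, z)) else 0)"

lemma truncated_inverse_lik_restrict:
  "truncated_inverse_lik R w z (gain_process (restrict (gain_family g) ({..<n} \<times> {ka} \<times> {..<K})))
    = truncated_inverse_lik R w z g"
proof -
  let ?g = "gain_process (restrict (gain_family g) ({..<n} \<times> {ka} \<times> {..<K}))"
  have "lik ka {..<K} R w (?g, z) = lik ka {..<K} R w (g, z)"
    by (rule lik_cong) simp
  moreover have "bounded_gains ka ?g = bounded_gains ka g"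
    by (simp add: bounded_gains_def)
  ultimately show ?thesis by (simp add: truncated_inverse_lik_def)
qed

lemma measurable_truncated_inverse_lik_process:
  "(\<lambda>x. truncated_inverse_lik R w z (gain_process x)) \<in> borel_measurable (PiM ({..<n} \<times> {ka} \<times> {..<K}) (\<lambda>_. borel))"
proof -
  let ?M = "PiM ({..<n} \<times> {ka} \<times> {..<K}) (\<lambda>_. borel :: complex measure)"
  have [measurable]: "Measurable.pred ?M (\<lambda>x. bounded_gains ka (gain_process x))"
      "(\<lambda>x. lik ka {..<K} R w (gain_process x, z)) \<in> borel_measurable ?M"
    by (auto intro!: pred_bounded_gains measurable_lik measurable_gain_process)
  show ?thesis unfolding truncated_inverse_lik_def by measurable
qed

lemma measurable_truncated_inverse_lik: "truncated_inverse_lik R w z \<in> borel_measurable G"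
proof -
  have "{..<n} \<times> {ka} \<times> {..<K} \<subseteq> coords K" using receivers by (auto simp: coords_def)
  from measurable_compose[OF measurable_restrict_gain_family[OF this] measurable_truncated_inverse_lik_process]
  show ?thesis by (simp add: truncated_inverse_lik_restrict)
qed

text \<open>Averaging the likelihood at \<open>kb\<close> over its gains turns it into a product of Cauchy-type kernels in the gaps,
  which are at most mixtures of Gaussians around the output of \<open>ka\<close>.\<close>
lemma nn_integral_lik_ratio_le:
  assumes R: "equiv W R" and w: "w \<in> W" and z: "bounded_noise c ka z"
  shows "(\<integral>\<^sup>+g. ennreal (if bounded_gains ka g then lik kb I R w (g, z) / lik ka {..<K} R w (g, z) else 0) \<partial>G)
    \<le> (\<integral>\<^sup>+g. ennreal (((fmax * (pi * dmax\<^sup>2 + 1)) ^ K * pointwise_const K dmax c) ^ n *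
        (mixture_lik R w (g, z) / lik ka {..<K} R w (g, z))) \<partial>G)"
proof -
  let ?L = "\<lambda>g. lik ka {..<K} R w (g, z)" and ?v = "truncated_inverse_lik R w z"
  define C where "C = (fmax * (pi * dmax\<^sup>2 + 1)) ^ K"
  define S where "S = (\<Sum>w'\<in>R `` {w}. \<Prod>t<n. 1 / (1 + (max_gap kb I w w' t)\<^sup>2))"
  have C: "C \<ge> 0" using fmax_pos by (simp add: C_def)
  have S: "S \<ge> 0" unfolding S_def by (intro sum_nonneg prod_nonneg) auto
  have L: "?L g > 0" for g using R w by (rule lik_pos)
  have "(\<integral>\<^sup>+g. ennreal (if bounded_gains ka g then lik kb I R w (g, z) / ?L g else 0) \<partial>G)
      = (\<integral>\<^sup>+g. ennreal (lik kb I R w (g, z)) * ?v g \<partial>G)"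
    using L by (intro nn_integral_cong)
      (simp add: truncated_inverse_lik_def ennreal_mult''[symmetric] less_imp_le)
  also have "\<dots> \<le> ennreal (C ^ n * S) * (\<integral>\<^sup>+g. ?v g \<partial>G)"
    using nn_integral_lik_mult_le[OF receivers I measurable_truncated_inverse_lik_process truncated_inverse_lik_restrict]
    by (simp add: C_def S_def power_mult[symmetric] mult.commute[of n K])
  also have "\<dots> = (\<integral>\<^sup>+g. ennreal (C ^ n * S) * ?v g \<partial>G)"
    by (rule nn_integral_cmult[symmetric, OF measurable_truncated_inverse_lik])
  also have "\<dots> \<le> (\<integral>\<^sup>+g. ennreal ((C * pointwise_const K dmax c) ^ n * (mixture_lik R w (g, z) / ?L g)) \<partial>G)"
  proof (rule nn_integral_mono)
    fix g
    show "ennreal (C ^ n * S) * ?v g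
        \<le> ennreal ((C * pointwise_const K dmax c) ^ n * (mixture_lik R w (g, z) / ?L g))"
    proof (cases "bounded_gains ka g")
      case True
      then have "C ^ n * S / ?L g \<le> C ^ n * (pointwise_const K dmax c ^ n * mixture_lik R w (g, z)) / ?L g"
        unfolding S_def using C L[of g]
        by (intro divide_right_mono mult_left_mono sum_prod_Cauchy_le_mixture_lik[OF R w _ z]) auto
      moreover have "ennreal (C ^ n * S) * ?v g = ennreal (C ^ n * S / ?L g)"
        using True C S L[of g] by (simp add: truncated_inverse_lik_def ennreal_mult[symmetric])
      ultimately show ?thesis by (simp add: ennreal_leI power_mult_distrib mult.assoc)
    qed (simp add: truncated_inverse_lik_def)
  qed
  finally show ?thesis by (simp only: C_def)
qed

lemma nn_integral_Om_lik_ratio_le: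
  assumes R: "equiv W R" and w: "w \<in> W"
  shows "(\<integral>\<^sup>+gz. ennreal ((if gz \<in> typical c then lik kb I R w gz else 0) / lik ka {..<K} R w gz) \<partial>Om)
    \<le> ennreal (((fmax * (pi * dmax\<^sup>2 + 1)) ^ K * pointwise_const K dmax c) ^ n) *
      (\<integral>\<^sup>+gz. ennreal (mixture_lik R w gz / lik ka {..<K} R w gz) \<partial>Om)"
    (is "_ \<le> ennreal (?C ^ n) * (\<integral>\<^sup>+gz. ?T gz \<partial>Om)")
proof -
  let ?L = "lik ka {..<K} R w"
  define U where "U gz = ennreal ((if gz \<in> typical c then lik kb I R w gz else 0) / ?L gz)" for gz
  have [measurable]: "?L \<in> borel_measurable Om" "lik kb I R w \<in> borel_measurable Om"
    using receivers I by (auto intro: measurable_lik_Om)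
  have [measurable]: "mixture_lik R w \<in> borel_measurable Om" "typical c \<in> sets Om"
    by (rule measurable_mixture_lik, rule sets_typical)
  have U [measurable]: "U \<in> borel_measurable Om"
    unfolding U_def by measurable
  have "(\<integral>\<^sup>+gz. U gz \<partial>Om) = (\<integral>\<^sup>+z. \<integral>\<^sup>+g. U (g, z) \<partial>G \<partial>noise n K)"
    using U by (rule block.nn_integral_snd[symmetric])
  also have "\<dots> \<le> (\<integral>\<^sup>+z. \<integral>\<^sup>+g. ennreal (?C ^ n) * ?T (g, z) \<partial>G \<partial>noise n K)"
  proof (rule nn_integral_mono)
    fix z
    show "(\<integral>\<^sup>+g. U (g, z) \<partial>G) \<le> (\<integral>\<^sup>+g. ennreal (?C ^ n) * ?T (g, z) \<partial>G)"
    proof (cases "bounded_noise c ka z")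
      case True
      have "(\<integral>\<^sup>+g. U (g, z) \<partial>G)
          \<le> (\<integral>\<^sup>+g. ennreal (if bounded_gains ka g then lik kb I R w (g, z) / ?L (g, z) else 0) \<partial>G)"
        using receivers(1) by (intro nn_integral_mono) (auto simp: U_def typical_def)
      also have "\<dots> \<le> (\<integral>\<^sup>+g. ennreal (?C ^ n) * ?T (g, z) \<partial>G)"
        using nn_integral_lik_ratio_le[OF R w True] fmax_pos pointwise_const_pos[of K dmax c]
        by (simp add: ennreal_mult'[symmetric])
      finally show ?thesis .
    next
      case False
      then have "U (g, z) = 0" for g using receivers(1) by (auto simp: U_def typical_def)
      then show ?thesis by simp
    qed
  qed
  also have "\<dots> = (\<integral>\<^sup>+gz. ennreal (?C ^ n) * ?T gz \<partial>Om)"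
    by (rule block.nn_integral_snd) measurable
  also have "\<dots> = ennreal (?C ^ n) * (\<integral>\<^sup>+gz. ?T gz \<partial>Om)"
    by (rule nn_integral_cmult) measurable
  finally show ?thesis by (simp only: U_def)
qed

lemma sum_nn_integral_mixture_lik_ratio:
  assumes R: "equiv W R"
  shows "(\<Sum>w\<in>W. \<integral>\<^sup>+gz. ennreal (mixture_lik R w gz / lik ka {..<K} R w gz) \<partial>Om)
    = ennreal ((4 * exp 1 * pi * (real J + 1) * D\<^sup>2) ^ n * real (card W))"
proof -
  have total: "(\<Prod>t<n. \<integral>\<^sup>+u. ennreal (dyadic_mixture D J (u - signal ka g w t)) \<partial>lborel)
      = ennreal ((4 * exp 1 * pi * (real J + 1) * D\<^sup>2) ^ n)" for g w
    using D_pos by (simp add: nn_integral_dyadic_mixture ennreal_power)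
  have "(\<Sum>w\<in>W. \<integral>\<^sup>+gz. ennreal (mixture_lik R w gz / lik ka {..<K} R w gz) \<partial>Om)
      = ennreal ((4 * exp 1 * pi * (real J + 1) * D\<^sup>2) ^ n) * of_nat (card W)"
    unfolding mixture_lik_def output_diff_def
    using measurable_mixture_lik[unfolded mixture_lik_def output_diff_def]
    by (intro sum_nn_integral_Om_posterior[OF receivers(1) R,
        where \<kappa> = "\<lambda>g w t u. dyadic_mixture D J (u - signal ka g w t)"])
      (simp_all add: total dyadic_mixture_nonneg D_pos)
  then show ?thesis by (simp add: ennreal_of_nat_eq_real_of_nat ennreal_mult'[symmetric])
qed

lemma emeasure_misaligned_le:
  assumes R: "equiv W R" and w: "w \<in> W" and \<Lambda>: "\<Lambda> > 0"
  shows "emeasure Om {gz \<in> typical c. \<Lambda> * lik ka {..<K} R w gz < lik kb I R w gz}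
    \<le> ennreal (((fmax * (pi * dmax\<^sup>2 + 1)) ^ K * pointwise_const K dmax c) ^ n / \<Lambda>) *
      (\<integral>\<^sup>+gz. ennreal (mixture_lik R w gz / lik ka {..<K} R w gz) \<partial>Om)"
proof -
  let ?L = "lik ka {..<K} R w" and ?C = "(fmax * (pi * dmax\<^sup>2 + 1)) ^ K * pointwise_const K dmax c"
  define h where "h gz = (if gz \<in> typical c then lik kb I R w gz else 0)" for gz
  have [measurable]: "?L \<in> borel_measurable Om" "lik kb I R w \<in> borel_measurable Om" "typical c \<in> sets Om"
    using receivers I by (auto intro: measurable_lik_Om sets_typical)
  have [measurable]: "h \<in> borel_measurable Om"
    unfolding h_def by measurable
  have "emeasure Om {gz \<in> typical c. \<Lambda> * ?L gz < lik kb I R w gz}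
      \<le> emeasure Om {gz \<in> space Om. \<Lambda> * ?L gz < h gz}"
  proof (rule emeasure_mono)
    show "{gz \<in> typical c. \<Lambda> * ?L gz < lik kb I R w gz} \<subseteq> {gz \<in> space Om. \<Lambda> * ?L gz < h gz}"
      using sets.sets_into_space[OF sets_typical] by (auto simp only: h_def mem_Collect_eq if_True)
  qed measurable
  also have "\<dots> \<le> (\<integral>\<^sup>+gz. ennreal (h gz / (\<Lambda> * ?L gz)) \<partial>Om)"
    using \<Lambda> lik_pos[OF R w] by (intro emeasure_less_le_nn_integral_ratio) auto
  also have "\<dots> = (\<integral>\<^sup>+gz. ennreal (1 / \<Lambda>) * ennreal (h gz / ?L gz) \<partial>Om)"
    using \<Lambda> by (simp add: ennreal_mult'[symmetric])
  also have "\<dots> = ennreal (1 / \<Lambda>) * (\<integral>\<^sup>+gz. ennreal (h gz / ?L gz) \<partial>Om)"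
    by (rule nn_integral_cmult) measurable
  also have "\<dots> \<le> ennreal (1 / \<Lambda>) * (ennreal (?C ^ n) * (\<integral>\<^sup>+gz. ennreal (mixture_lik R w gz / ?L gz) \<partial>Om))"
    unfolding h_def by (intro mult_left_mono nn_integral_Om_lik_ratio_le[OF R w]) simp_all
  also have "\<dots> = ennreal (?C ^ n / \<Lambda>) * (\<integral>\<^sup>+gz. ennreal (mixture_lik R w gz / ?L gz) \<partial>Om)"
    using \<Lambda> by (simp add: mult.assoc[symmetric] ennreal_mult'[symmetric])
  finally show ?thesis .
qed

lemma rare_misaligned:
  assumes R: "equiv W R"
    and \<Lambda>: "\<Lambda> > 0" "(align_const K fmax dmax c * (real J + 1) * D\<^sup>2) ^ n \<le> \<epsilon> * \<Lambda>"
  shows "rare \<epsilon> (\<lambda>w. {gz \<in> typical c. \<Lambda> * lik ka {..<K} R w gz < lik kb I R w gz})"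
proof -
  let ?A = "4 * exp 1 * pi * (real J + 1) * D\<^sup>2"
  define C where "C = (fmax * (pi * dmax\<^sup>2 + 1)) ^ K * pointwise_const K dmax c"
  have C: "C \<ge> 0" using fmax_pos pointwise_const_pos[of K dmax c] by (simp add: C_def)
  have "(\<Sum>w\<in>W. emeasure Om {gz \<in> typical c. \<Lambda> * lik ka {..<K} R w gz < lik kb I R w gz})
      \<le> ennreal (C ^ n / \<Lambda>) * (\<Sum>w\<in>W. \<integral>\<^sup>+gz. ennreal (mixture_lik R w gz / lik ka {..<K} R w gz) \<partial>Om)"
    unfolding sum_distrib_left C_def by (intro sum_mono emeasure_misaligned_le[OF R _ \<Lambda>(1)])
  also have "\<dots> = ennreal ((C * ?A) ^ n / \<Lambda> * real (card W))"
    using C \<Lambda>(1) by (simp only: sum_nn_integral_mixture_lik_ratio[OF R])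
      (simp add: ennreal_mult'[symmetric] power_mult_distrib)
  also have "\<dots> \<le> ennreal (\<epsilon> * real (card W))"
  proof (intro ennreal_leI mult_right_mono)
    have "C * ?A = align_const K fmax dmax c * (real J + 1) * D\<^sup>2" by (simp add: C_def align_const_def)
    then have "(C * ?A) ^ n \<le> \<epsilon> * \<Lambda>" using \<Lambda>(2) by (simp only:)
    then show "(C * ?A) ^ n / \<Lambda> \<le> \<epsilon>" using \<Lambda>(1) by (simp only: pos_divide_le_eq)
  qed simp
  finally show ?thesis using sets_misaligned[OF receivers(1,2) I(1)] by (simp add: rare_def)
qed

end

subsection \<open>Codes for independent messages\<close>

definition agree_on :: "(nat \<Rightarrow> nat) set \<Rightarrow> nat set \<Rightarrow> ((nat \<Rightarrow> nat) \<times> (nat \<Rightarrow> nat)) set" where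
  "agree_on W J = {(w, w') \<in> W \<times> W. \<forall>j\<in>J. w j = w' j}"

lemma equiv_agree_on: "equiv W (agree_on W J)"
  by (intro equivI refl_onI symI transI) (auto simp: agree_on_def)

lemma agree_on_insert_subset: "agree_on W (insert k J) \<subseteq> agree_on W J"
  by (auto simp: agree_on_def)

lemma agree_on_lessThan_Image:
  assumes "w \<in> msg_set K M"
  shows "agree_on (msg_set K M) {..<K} `` {w} = {w}"
proof -
  have "w' = w" if "w' \<in> msg_set K M" "\<forall>j\<in>{..<K}. w j = w' j" for w'
    using that assms unfolding msg_set_def by (metis PiE_ext)
  then show ?thesis using assms by (auto simp: agree_on_def)
qed

lemma finite_msg_set: "finite (msg_set K M)"
  unfolding msg_set_def by (intro finite_PiE) auto

lemma msg_set_nonempty: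
  assumes "\<And>k. k < K \<Longrightarrow> M k \<ge> 1"
  shows "msg_set K M \<noteq> {}"
  unfolding msg_set_def PiE_eq_empty_iff lessThan_empty_iff using assms by fastforce

lemma card_agree_on_class_ge:
  assumes w: "w \<in> msg_set K M" and S: "S \<subseteq> {..<K}"
  shows "(\<Prod>k\<in>S. M k) \<le> card (agree_on (msg_set K M) ({..<K} - S) `` {w})"
proof -
  let ?f = "\<lambda>f k. if k \<in> S then f k else w k"
  have "(\<Prod>k\<in>S. M k) = card (Pi\<^sub>E S (\<lambda>k. {..<M k}))"
    using S finite_subset by (subst card_PiE) auto
  also have "\<dots> \<le> card (agree_on (msg_set K M) ({..<K} - S) `` {w})"
  proof (rule card_inj_on_le[where f = ?f])
    show "inj_on ?f (Pi\<^sub>E S (\<lambda>k. {..<M k}))"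
    proof (rule inj_onI)
      fix f f' assume f: "f \<in> Pi\<^sub>E S (\<lambda>k. {..<M k})" "f' \<in> Pi\<^sub>E S (\<lambda>k. {..<M k})" and eq: "?f f = ?f f'"
      show "f = f'"
      proof (rule PiE_ext[OF f])
        fix k assume "k \<in> S"
        then show "f k = f' k" using fun_cong[OF eq, of k] by simp
      qed
    qed
    show "?f ` Pi\<^sub>E S (\<lambda>k. {..<M k}) \<subseteq> agree_on (msg_set K M) ({..<K} - S) `` {w}"
      using w S by (auto simp: msg_set_def agree_on_def PiE_def Pi_def extensional_def)
    show "finite (agree_on (msg_set K M) ({..<K} - S) `` {w})"
      by (rule finite_Image_equiv[OF finite_msg_set equiv_agree_on])
  qed
  finally show ?thesis .
qed

lemma sqrt_powr_square:
  fixes P e :: real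
  assumes "P > 0"
  shows "(sqrt P powr e)\<^sup>2 = P powr e"
  using assms by (simp add: powr_half_sqrt[symmetric] powr_powr power2_eq_square powr_add[symmetric])

lemma ex_measurable_subset_nn_integral_le:
  assumes fin: "emeasure M (space M) \<noteq> \<infinity>" and \<delta>: "\<delta> > 0"
  shows "\<exists>S\<in>sets M. S \<subseteq> C \<and> (\<integral>\<^sup>+x. indicator C x \<partial>M) \<le> emeasure M S + ennreal \<delta>"
proof (cases "(\<integral>\<^sup>+x. indicator C x \<partial>M) = 0")
  case True
  then show ?thesis by (intro bexI[of _ "{}"]) auto
next
  case False
  let ?I = "\<integral>\<^sup>+x. indicator C x \<partial>M"
  have "?I \<le> (\<integral>\<^sup>+x. 1 \<partial>M)" by (intro nn_integral_mono) (auto simp: indicator_def)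
  also have "\<dots> < \<infinity>" using fin by (simp add: less_top[symmetric])
  finally have "?I < top" by simp
  then have "?I - ennreal \<delta> < ?I"
    using False \<delta> by (intro ennreal_between(1)) (auto simp: zero_less_iff_neq_zero)
  then obtain s where s: "simple_function M s" "s \<le> indicator C" "?I - ennreal \<delta> < integral\<^sup>S M s"
    unfolding nn_integral_def[of M "indicator C"] less_SUP_iff by auto
  define S where "S = {x \<in> space M. s x \<noteq> 0}"
  have [measurable]: "s \<in> borel_measurable M" using s(1) by (rule borel_measurable_simple_function)
  have S: "S \<in> sets M" unfolding S_def by measurable
  have s_le: "s x \<le> indicator C x" for x using s(2) by (simp add: le_fun_def)
  have "S \<subseteq> C"
  proof
    fix x assume "x \<in> S"
    then show "x \<in> C" using s_le[of x] by (cases "x \<in> C") (auto simp: S_def)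
  qed
  moreover have "?I \<le> emeasure M S + ennreal \<delta>"
  proof -
    have "integral\<^sup>S M s = integral\<^sup>N M s" using s(1) by (rule nn_integral_eq_simple_integral[symmetric])
    also have "\<dots> \<le> (\<integral>\<^sup>+x. indicator S x \<partial>M)"
    proof (rule nn_integral_mono)
      fix x assume "x \<in> space M"
      moreover have "s x \<le> 1" using s_le[of x] by (auto simp: indicator_def split: if_splits intro: order_trans)
      ultimately show "s x \<le> indicator S x" by (auto simp: S_def indicator_def)
    qed
    also have "\<dots> = emeasure M S" using S by simp
    finally have "?I - ennreal \<delta> \<le> emeasure M S" using s(3) by simp
    then show ?thesis by (simp add: ennreal_minus_le_iff add.commute)
  qed
  ultimately show ?thesis using S by blast
qed

definition err_tol :: "nat \<Rightarrow> real" where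
  "err_tol K = 1 / (16 * real K)"

definition noise_cap :: "nat \<Rightarrow> real" where
  "noise_cap K = 2 * ln (32 * (real K)\<^sup>2)"

locale message_code = fading_code K fmax dmin dmax G n "\<lambda>k i. sqrt P powr \<alpha> k i" "msg_set K M" E
  for K :: nat and fmax dmin dmax :: real and G :: "(nat \<Rightarrow> nat \<Rightarrow> nat \<Rightarrow> complex) measure" and n :: nat
    and P :: real and \<alpha> :: "nat \<Rightarrow> nat \<Rightarrow> real" and M :: "nat \<Rightarrow> nat"
    and E :: "(nat \<Rightarrow> nat) \<Rightarrow> nat \<Rightarrow> nat \<Rightarrow> complex" +
  fixes dec :: "nat \<Rightarrow> (nat \<Rightarrow> complex) \<Rightarrow> (nat \<Rightarrow> nat \<Rightarrow> nat \<Rightarrow> complex) \<Rightarrow> nat"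
  assumes P: "P > 1" and n_pos: "n \<ge> 1" and K_pos: "K \<ge> 1" and M_pos: "\<And>k. k < K \<Longrightarrow> M k \<ge> 1"
    and success: "ennreal (3 / 4) \<le> success_prob K \<alpha> P G n M E dec"
begin

abbreviation "W \<equiv> msg_set K M"

lemma err_tol_pos: "err_tol K > 0"
  using K_pos by (simp add: err_tol_def)

lemma card_W_pos: "card W > 0"
  using msg_set_nonempty[OF M_pos] finite_msg_set by (simp add: card_gt_0_iff)

lemma rx_signal_eq_signal:
  "rx_signal K \<alpha> P n E w g z k = (\<lambda>t. if t < n then signal k g w t + z (t, k) else 0)"
  by (auto simp: fun_eq_iff rx_signal_def signal_def)

definition decoding_family ::
  "((nat \<Rightarrow> nat) \<Rightarrow> ((nat \<Rightarrow> nat \<Rightarrow> nat \<Rightarrow> complex) \<times> (nat \<times> nat \<Rightarrow> complex)) set) \<Rightarrow> bool" where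
  "decoding_family S \<longleftrightarrow> (\<forall>w\<in>W. S w \<in> sets Om) \<and>
    (\<forall>w\<in>W. \<forall>g z k. (g, z) \<in> S w \<longrightarrow> k < K \<longrightarrow> dec k (rx_signal K \<alpha> P n E w g z k) (restrict_time n g) = w k) \<and>
    ennreal (real (card W) / 2) \<le> (\<Sum>w\<in>W. emeasure Om (S w))"

lemma ex_decoding_family: "\<exists>S. decoding_family S"
proof -
  define C where "C w = {gz. \<forall>k<K. dec k (rx_signal K \<alpha> P n E w (fst gz) (snd gz) k) (restrict_time n (fst gz))
      = w k}"
    for w
  have "\<exists>S\<in>sets Om. S \<subseteq> C w \<and> (\<integral>\<^sup>+gz. indicator (C w) gz \<partial>Om) \<le> emeasure Om S + ennreal (1 / 4)" for w
    by (rule ex_measurable_subset_nn_integral_le) auto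
  then obtain S where S: "\<And>w. S w \<in> sets Om" "\<And>w. S w \<subseteq> C w"
      "\<And>w. (\<integral>\<^sup>+gz. indicator (C w) gz \<partial>Om) \<le> emeasure Om (S w) + ennreal (1 / 4)"
    by metis
  have "ennreal (3 / 4 * real (card W)) = ennreal (3 / 4) * of_nat (card W)"
    unfolding ennreal_of_nat_eq_real_of_nat by (rule ennreal_mult) auto
  also have "\<dots> \<le> (\<Sum>w\<in>W. \<integral>\<^sup>+gz. indicator (C w) gz \<partial>Om) / of_nat (card W) * of_nat (card W)"
    using success by (intro mult_right_mono) (auto simp: C_def success_prob_def)
  also have "\<dots> = (\<Sum>w\<in>W. \<integral>\<^sup>+gz. indicator (C w) gz \<partial>Om)"
    using card_W_pos by (intro ennreal_divide_times[THEN trans])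
      (simp add: divide_ennreal_def mult.assoc ennreal_of_nat_eq_real_of_nat inverse_ennreal ennreal_mult[symmetric])
  also have "\<dots> \<le> (\<Sum>w\<in>W. emeasure Om (S w) + ennreal (1 / 4))"
    by (intro sum_mono S)
  also have "\<dots> = (\<Sum>w\<in>W. emeasure Om (S w)) + ennreal (real (card W) / 4)"
    by (simp add: sum.distrib ennreal_of_nat_eq_real_of_nat ennreal_mult[symmetric])
  finally have "ennreal (3 / 4 * real (card W)) - ennreal (real (card W) / 4) \<le> (\<Sum>w\<in>W. emeasure Om (S w))"
    by (simp add: ennreal_minus_le_iff add.commute)
  moreover have "ennreal (3 / 4 * real (card W)) - ennreal (real (card W) / 4) = ennreal (real (card W) / 2)"
    by (subst ennreal_minus) auto
  ultimately have "decoding_family S"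
    using S by (fastforce simp: decoding_family_def C_def)
  then show ?thesis by blast
qed

definition atypical :: "(nat \<Rightarrow> nat) \<Rightarrow> ((nat \<Rightarrow> nat \<Rightarrow> nat \<Rightarrow> complex) \<times> (nat \<times> nat \<Rightarrow> complex)) set" where
  "atypical w = space Om - typical (noise_cap K)"

definition unconfident ::
  "((nat \<Rightarrow> nat) \<Rightarrow> ((nat \<Rightarrow> nat \<Rightarrow> nat \<Rightarrow> complex) \<times> (nat \<times> nat \<Rightarrow> complex)) set) \<Rightarrow> nat \<Rightarrow> nat set \<Rightarrow>
    (nat \<Rightarrow> nat) \<Rightarrow> ((nat \<Rightarrow> nat \<Rightarrow> nat \<Rightarrow> complex) \<times> (nat \<times> nat \<Rightarrow> complex)) set" where
  "unconfident S k H w = {gz \<in> S w.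
    lik k {..<K} (agree_on W (insert k H)) w gz < err_tol K * lik k {..<K} (agree_on W H) w gz}"

definition misaligned ::
  "real \<Rightarrow> nat \<Rightarrow> nat \<Rightarrow> nat set \<Rightarrow> nat set \<Rightarrow> (nat \<Rightarrow> nat) \<Rightarrow>
    ((nat \<Rightarrow> nat \<Rightarrow> nat \<Rightarrow> complex) \<times> (nat \<times> nat \<Rightarrow> complex)) set" where
  "misaligned L ka kb I H w = {gz \<in> typical (noise_cap K).
    L * lik ka {..<K} (agree_on W H) w gz < lik kb I (agree_on W H) w gz}"

definition improbable ::
  "real \<Rightarrow> nat \<Rightarrow> nat set \<Rightarrow> (nat \<Rightarrow> nat) \<Rightarrow> ((nat \<Rightarrow> nat \<Rightarrow> nat \<Rightarrow> complex) \<times> (nat \<times> nat \<Rightarrow> complex)) set" where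
  "improbable s k H w = {gz \<in> space Om. lik k {..<K} (agree_on W H) w gz < err_tol K *
    (real (card (agree_on W H `` {w})) * (\<Prod>t<n. cnormal_density s (signal k (fst gz) w t + snd gz (t, k))))}"

lemma rare_atypical: "rare (err_tol K) atypical"
proof -
  have "2 * exp (- noise_cap K / 2) = 1 / (16 * (real K)\<^sup>2)"
    using K_pos by (simp add: noise_cap_def exp_minus field_simps)
  moreover have "(1 / (16 * (real K)\<^sup>2)) ^ n \<le> (1 / (16 * (real K)\<^sup>2)) ^ 1"
  proof (rule power_decreasing)
    have "1 \<le> (real K)\<^sup>2" using K_pos by simp
    then show "1 / (16 * (real K)\<^sup>2) \<le> 1" by (simp add: divide_simps)
  qed (use n_pos in auto)
  ultimately have "real K * (2 * exp (- noise_cap K / 2)) ^ n \<le> real K * (1 / (16 * (real K)\<^sup>2))"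
    by (intro mult_left_mono) auto
  also have "\<dots> = err_tol K" using K_pos by (simp add: err_tol_def power2_eq_square)
  finally have "emeasure Om (space Om - typical (noise_cap K)) \<le> ennreal (err_tol K)"
    using emeasure_not_typical_le[of "noise_cap K"] by (meson ennreal_leI order_trans)
  then have "(\<Sum>w\<in>W. emeasure Om (space Om - typical (noise_cap K))) \<le> (\<Sum>w\<in>W. ennreal (err_tol K))"
    by (intro sum_mono)
  also have "\<dots> = ennreal (err_tol K * real (card W))"
    using err_tol_pos by (subst sum_ennreal) (auto simp: mult.commute)
  finally show ?thesis using sets_typical by (simp add: rare_def atypical_def)
qed

lemma rare_improbable:
  assumes "k < K" "s > 0"
  shows "rare (err_tol K) (improbable s k H)"
  unfolding improbable_def using assms err_tol_pos by (intro rare_atypical_output equiv_agree_on) simp_all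

lemma rare_unconfident_decoding:
  assumes S: "decoding_family S" and k: "k < K"
  shows "rare (err_tol K) (unconfident S k H)"
  unfolding unconfident_def
proof (rule rare_unconfident[OF k equiv_agree_on agree_on_insert_subset])
  fix w w' g z z'
  assume R: "(w, w') \<in> agree_on W H" and gz: "(g, z) \<in> S w" "(g, z') \<in> S w'"
    and eq: "\<And>t. t < n \<Longrightarrow> signal k g w t + z (t, k) = signal k g w' t + z' (t, k)"
  have "rx_signal K \<alpha> P n E w g z k = rx_signal K \<alpha> P n E w' g z' k"
    using eq by (auto simp: rx_signal_eq_signal)
  moreover have "dec k (rx_signal K \<alpha> P n E w g z k) (restrict_time n g) = w k"
      "dec k (rx_signal K \<alpha> P n E w' g z' k) (restrict_time n g) = w' k"
    using S R gz k by (auto simp: decoding_family_def agree_on_def)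
  ultimately show "(w, w') \<in> agree_on W (insert k H)"
    using R by (simp add: agree_on_def)
qed (use S err_tol_pos in \<open>auto simp: decoding_family_def\<close>)

definition hop_loss :: "real \<Rightarrow> nat \<Rightarrow> real" where
  "hop_loss e J = (align_const K fmax dmax (noise_cap K) * (real J + 1) * P powr e) ^ n / err_tol K"

lemma hop_loss_pos: "hop_loss e J > 0"
  unfolding hop_loss_def using align_const_pos[OF fmax_pos] err_tol_pos P
  by (intro divide_pos_pos zero_less_power mult_pos_pos) auto

lemma prod_hop_loss:
  assumes "finite L"
  shows "(\<Prod>l\<in>L. hop_loss (e l) J) = (1 / err_tol K) ^ card L *
    (align_const K fmax dmax (noise_cap K) ^ card L * (real J + 1) ^ card L * P powr (\<Sum>l\<in>L. e l)) ^ n"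
proof -
  have "(\<Prod>l\<in>L. hop_loss (e l) J)
      = (1 / err_tol K) ^ card L *
        (\<Prod>l\<in>L. align_const K fmax dmax (noise_cap K) * (real J + 1) * P powr e l) ^ n"
    by (simp add: hop_loss_def prod_dividef power_divide prod_power_distrib)
  also have "(\<Prod>l\<in>L. align_const K fmax dmax (noise_cap K) * (real J + 1) * P powr e l)
      = align_const K fmax dmax (noise_cap K) ^ card L * (real J + 1) ^ card L * P powr (\<Sum>l\<in>L. e l)"
    using P assms by (simp add: prod.distrib powr_sum power_mult_distrib)
  finally show ?thesis .
qed

lemma sqrt_powr_mono: "x \<le> y \<Longrightarrow> sqrt P powr x \<le> sqrt P powr y"
  using P by (intro powr_mono) auto

lemma sqrt_powr_ge_1: "x \<ge> 0 \<Longrightarrow> sqrt P powr x \<ge> 1"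
  using P by (intro ge_one_powr_ge_zero) auto

lemma rare_hop_misaligned:
  assumes k: "ka < K" "kb < K" "ka \<noteq> kb" and I: "I \<subseteq> {..<K}" "I \<noteq> {}" and e: "e \<ge> 0"
    and le_e: "\<And>i. i \<in> I \<Longrightarrow> \<alpha> ka i - \<alpha> kb i \<le> e" "\<And>i. i < K \<Longrightarrow> i \<notin> I \<Longrightarrow> \<alpha> ka i \<le> e"
    and A: "A \<ge> 0" "\<And>i. i < K \<Longrightarrow> \<alpha> ka i \<le> A" and J: "P powr A \<le> 4 ^ J"
  shows "rare (err_tol K) (misaligned (hop_loss e J) ka kb I H)"
proof -
  have "(sqrt P powr A)\<^sup>2 \<le> 4 ^ J * (sqrt P powr e)\<^sup>2"
    using P e J mult_mono[of "P powr A" "4 ^ J" 1 "P powr e"]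
    by (simp add: sqrt_powr_square ge_one_powr_ge_zero)
  moreover have "sqrt P powr \<alpha> ka i \<le> sqrt P powr e * sqrt P powr \<alpha> kb i" if "i \<in> I" for i
    using le_e(1)[OF that] unfolding powr_add[symmetric] by (intro sqrt_powr_mono) simp
  ultimately interpret aligned_receivers K fmax dmin dmax G n "\<lambda>k i. sqrt P powr \<alpha> k i" W E ka kb I
      "sqrt P powr e" "sqrt P powr A" J
    by unfold_locales (use k I e A le_e(2) in \<open>auto intro: sqrt_powr_mono sqrt_powr_ge_1\<close>)
  show ?thesis
    unfolding misaligned_def
    using P err_tol_pos hop_loss_pos
    by (intro rare_misaligned equiv_agree_on) (simp_all add: hop_loss_def sqrt_powr_square)
qed

lemma ex_avoiding_rare_decoding:
  assumes S: "decoding_family S" and fin: "finite \<B>" and card: "card \<B> < 8 * K"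
    and rare: "\<And>B. B \<in> \<B> \<Longrightarrow> rare (err_tol K) B"
  obtains w gz where "w \<in> W" "gz \<in> S w" "\<And>B. B \<in> \<B> \<Longrightarrow> gz \<notin> B w"
proof (rule ex_avoiding_rare[OF msg_set_nonempty[OF M_pos], of S, OF _ _ fin rare])
  show "real (card \<B>) * err_tol K < 1 / 2"
    using card K_pos by (simp add: err_tol_def divide_simps)
qed (use S err_tol_pos that in \<open>auto simp: decoding_family_def\<close>)

end

subsection \<open>Paths of receivers\<close>

lemma telescoping_le:
  fixes p q \<Lambda> :: "nat \<Rightarrow> real"
  assumes c: "c > 0" and \<Lambda>: "\<And>l. \<Lambda> l \<ge> 0"
    and step: "\<And>l. l < m \<Longrightarrow> c * p l \<le> q l" and hop: "\<And>l. Suc l < m \<Longrightarrow> q l \<le> \<Lambda> l * p (Suc l)" and l: "l < m"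
  shows "p 0 \<le> (1 / c) ^ l * (\<Prod>j<l. \<Lambda> j) * p l"
  using l
proof (induction l)
  case (Suc l)
  have "c * p l \<le> \<Lambda> l * p (Suc l)"
    using step[of l] hop[of l] Suc.prems by simp
  then have "p l \<le> (1 / c) * (\<Lambda> l * p (Suc l))"
    using c by (simp add: field_simps)
  then have "(1 / c) ^ l * (\<Prod>j<l. \<Lambda> j) * p l \<le> (1 / c) ^ l * (\<Prod>j<l. \<Lambda> j) * ((1 / c) * (\<Lambda> l * p (Suc l)))"
    using c \<Lambda> by (intro mult_left_mono mult_nonneg_nonneg prod_nonneg) auto
  with Suc show ?case by (simp add: mult_ac)
qed simp

lemma (in fading_code) prod_output_density_ge:
  assumes k: "k < K" and w: "w \<in> W" and gz: "(g, z) \<in> typical c" and R: "R \<ge> 1" "\<And>i. i < K \<Longrightarrow> a k i \<le> R"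
  shows "(1 / (R\<^sup>2 * (pi * exp (2 * c + 2 * dmax\<^sup>2 * (real K)\<^sup>2)))) ^ n
    \<le> (\<Prod>t<n. cnormal_density (R\<^sup>2) (signal k g w t + z (t, k)))"
proof -
  let ?y = "\<lambda>t. signal k g w t + z (t, k)" and ?b = "2 * c + 2 * dmax\<^sup>2 * (real K)\<^sup>2"
  have g: "bounded_gains k g" and z: "(\<Sum>t<n. (cmod (z (t, k)))\<^sup>2) \<le> c * real n"
    using gz k by (auto simp: typical_def bounded_noise_def)
  have "(\<Sum>t<n. (cmod (?y t))\<^sup>2 / R\<^sup>2)
      \<le> (\<Sum>t<n. 2 * (cmod (z (t, k)))\<^sup>2 + 2 * dmax\<^sup>2 * real K * (\<Sum>i<K. (cmod (E w i t))\<^sup>2))"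
    unfolding signal_def using received_energy_le[OF g _ R] by (intro sum_mono) (simp add: add.commute)
  also have "\<dots> = 2 * (\<Sum>t<n. (cmod (z (t, k)))\<^sup>2) + 2 * dmax\<^sup>2 * real K * (\<Sum>i<K. \<Sum>t<n. (cmod (E w i t))\<^sup>2)"
    by (simp only: sum.distrib sum_distrib_left[symmetric] sum.swap[of _ "{..<K}" "{..<n}"])
  also have "\<dots> \<le> 2 * (c * real n) + 2 * dmax\<^sup>2 * real K * (\<Sum>i<K. real n)"
    using z power_le[OF w] by (intro add_mono mult_left_mono sum_mono) auto
  also have "\<dots> = real n * ?b"
    by (simp add: power2_eq_square algebra_simps)
  finally have energy: "(\<Sum>t<n. (cmod (?y t))\<^sup>2 / R\<^sup>2) \<le> real n * ?b" .
  have "(1 / (R\<^sup>2 * (pi * exp ?b))) ^ n = exp (- (real n * ?b)) * (1 / (pi * R\<^sup>2)) ^ n"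
    by (simp add: exp_minus exp_of_nat_mult power_mult_distrib power_divide divide_simps)
  also have "\<dots> \<le> exp (- (\<Sum>t<n. (cmod (?y t))\<^sup>2 / R\<^sup>2)) * (1 / (pi * R\<^sup>2)) ^ n"
    using energy by (intro mult_right_mono) auto
  also have "\<dots> = (\<Prod>t<n. cnormal_density (R\<^sup>2) (?y t))"
    by (simp add: cnormal_density_def sum_negf[symmetric] exp_sum prod_dividef power_divide)
  finally show ?thesis .
qed

definition output_const :: "nat \<Rightarrow> real \<Rightarrow> real" where
  "output_const K d = pi * exp (2 * noise_cap K + 2 * d\<^sup>2 * (real K)\<^sup>2)"

lemma output_const_pos: "output_const K d > 0"
  by (simp add: output_const_def)

context message_code
begin

definition known_before :: "nat list \<Rightarrow> nat \<Rightarrow> nat set" where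
  "known_before ks l = ({..<K} - set ks) \<union> set (take l ks)"

lemma known_before_Suc: "l < length ks \<Longrightarrow> known_before ks (Suc l) = insert (ks ! l) (known_before ks l)"
  by (auto simp: known_before_def take_Suc_conv_app_nth)

lemma known_before_length: "set ks \<subseteq> {..<K} \<Longrightarrow> known_before ks (length ks) = {..<K}"
  by (auto simp: known_before_def)

lemma ex_typical_path:
  assumes ks: "ks \<noteq> []" "distinct ks" "set ks \<subseteq> {..<K}"
    and e: "\<And>l. Suc l < length ks \<Longrightarrow> e l \<ge> 0"
      "\<And>l i. Suc l < length ks \<Longrightarrow> i < K \<Longrightarrow> \<alpha> (ks ! Suc l) i - \<alpha> (ks ! l) i \<le> e l"
    and A: "A \<ge> 0" "\<And>k i. k < K \<Longrightarrow> i < K \<Longrightarrow> \<alpha> k i \<le> A" and J: "P powr A \<le> 4 ^ J" and s: "s > 0"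
    and S: "decoding_family S"
  obtains w gz where "w \<in> W" "gz \<in> S w" "gz \<notin> atypical w" "gz \<notin> improbable s (ks ! 0) (known_before ks 0) w"
    "\<And>l. l < length ks \<Longrightarrow> gz \<notin> unconfident S (ks ! l) (known_before ks l) w"
    "\<And>l. Suc l < length ks \<Longrightarrow>
      gz \<notin> misaligned (hop_loss (e l) J) (ks ! Suc l) (ks ! l) {..<K} (known_before ks (Suc l)) w"
proof -
  let ?m = "length ks"
  have ks_less: "ks ! l < K" if "l < ?m" for l
    using ks(3) that nth_mem by blast
  define \<U> where "\<U> l = unconfident S (ks ! l) (known_before ks l)" for l
  define \<A> where "\<A> l = misaligned (hop_loss (e l) J) (ks ! Suc l) (ks ! l) {..<K} (known_before ks (Suc l))"
    for l
  let ?\<B> = "{atypical, improbable s (ks ! 0) (known_before ks 0)} \<union> \<U> ` {..<?m} \<union> \<A> ` {l. Suc l < ?m}"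
  have "rare (err_tol K) (\<U> l)" if "l < ?m" for l
    unfolding \<U>_def using that by (intro rare_unconfident_decoding S ks_less)
  moreover have "rare (err_tol K) (\<A> l)" if l: "Suc l < ?m" for l
  proof -
    have "ks ! Suc l \<noteq> ks ! l" using l ks(2) by (simp add: nth_eq_iff_index_eq)
    then show ?thesis
      unfolding \<A>_def using l K_pos e A
      by (intro rare_hop_misaligned[OF _ _ _ _ _ _ _ _ A(1) A(2)[OF ks_less[OF l]] J])
        (auto intro!: ks_less simp: lessThan_empty_iff)
  qed
  moreover have "rare (err_tol K) (improbable s (ks ! 0) (known_before ks 0))"
    using ks(1) s by (intro rare_improbable ks_less) auto
  ultimately have rare: "rare (err_tol K) B" if "B \<in> ?\<B>" for B
    using that rare_atypical by auto
  have "?m \<le> K" using ks card_mono[of "{..<K}" "set ks"] by (simp add: distinct_card)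
  moreover have "card ?\<B> \<le> 2 + ?m + (?m - 1)"
  proof (intro order_trans[OF card_Un_le] add_mono card_image_le[THEN order_trans])
    have "{l. Suc l < ?m} = {..<?m - 1}" by auto
    then show "finite {l. Suc l < ?m}" "card {l. Suc l < ?m} \<le> ?m - 1" by simp_all
  qed (auto simp: card_insert_if)
  ultimately have card: "card ?\<B> < 8 * K" using K_pos by linarith
  have "finite {l. Suc l < ?m}" by (rule finite_subset[of _ "{..<?m}"]) auto
  then obtain w gz where "w \<in> W" "gz \<in> S w" "\<And>B. B \<in> ?\<B> \<Longrightarrow> gz \<notin> B w"
    using ex_avoiding_rare_decoding[OF S _ card rare] by auto
  then show ?thesis using that[of w gz] by (auto simp: \<U>_def \<A>_def)
qed

lemma lik_known_before_telescoping:
  assumes S: "decoding_family S" and w: "w \<in> W" and gz: "gz \<in> S w" "gz \<notin> atypical w"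
    and ks: "ks \<noteq> []" "set ks \<subseteq> {..<K}"
    and confident: "\<And>l. l < length ks \<Longrightarrow> gz \<notin> unconfident S (ks ! l) (known_before ks l) w"
    and aligned: "\<And>l. Suc l < length ks \<Longrightarrow>
      gz \<notin> misaligned (hop_loss (e l) J) (ks ! Suc l) (ks ! l) {..<K} (known_before ks (Suc l)) w"
  shows "lik (ks ! 0) {..<K} (agree_on W (known_before ks 0)) w gz
    \<le> (1 / err_tol K) ^ length ks * (\<Prod>l<length ks - 1. hop_loss (e l) J)"
proof -
  let ?c = "err_tol K" and ?m = "length ks"
  define L where "L l = lik (ks ! l) {..<K} (agree_on W (known_before ks l)) w gz" for l
  define L' where "L' l = lik (ks ! l) {..<K} (agree_on W (known_before ks (Suc l))) w gz" for l
  have c: "?c > 0" by (rule err_tol_pos)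
  have gz_typical: "gz \<in> typical (noise_cap K)"
    using S w gz sets.sets_into_space by (fastforce simp: atypical_def decoding_family_def)
  have L: "?c * L l \<le> L' l" if "l < ?m" for l
    using confident[OF that] gz(1) that by (simp add: L_def L'_def unconfident_def known_before_Suc not_less)
  have L': "L' l \<le> hop_loss (e l) J * L (Suc l)" if "Suc l < ?m" for l
    using aligned[OF that] gz_typical by (simp add: L_def L'_def misaligned_def not_less)
  have "L 0 \<le> (1 / ?c) ^ (?m - 1) * (\<Prod>l<?m - 1. hop_loss (e l) J) * L (?m - 1)"
    using ks(1)
    by (intro telescoping_le[where p = L and q = L' and m = ?m] c L L' less_imp_le[OF hop_loss_pos]) auto
  also have "\<dots> \<le> (1 / ?c) ^ (?m - 1) * (\<Prod>l<?m - 1. hop_loss (e l) J) * (1 / ?c)"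
  proof (intro mult_left_mono mult_nonneg_nonneg prod_nonneg)
    have "agree_on W (known_before ks ?m) `` {w} = {w}"
      using agree_on_lessThan_Image[OF w] by (simp add: known_before_length[OF ks(2)])
    then have "L' (?m - 1) \<le> 1"
      using ks(1) by (auto simp: L'_def lik_def intro!: prod_le_1 cnormal_density_1_le_1)
    then show "L (?m - 1) \<le> 1 / ?c"
      using L[of "?m - 1"] ks(1) c by (simp add: field_simps)
  qed (use c hop_loss_pos in \<open>auto intro: less_imp_le\<close>)
  also have "\<dots> = (1 / ?c) ^ ?m * (\<Prod>l<?m - 1. hop_loss (e l) J)"
    using ks(1) by (cases ks) auto
  finally show ?thesis by (simp only: L_def)
qed

lemma lik_lower_bound:
  assumes S: "decoding_family S" and w: "w \<in> W" and gz: "gz \<in> S w" "gz \<notin> atypical w"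
    and probable: "gz \<notin> improbable (P powr e) k ({..<K} - H) w"
    and k: "k < K" "H \<subseteq> {..<K}" and e: "e \<ge> 0" "\<And>i. i < K \<Longrightarrow> \<alpha> k i \<le> e"
  shows "err_tol K * (real (\<Prod>k\<in>H. M k) * (1 / (P powr e * output_const K dmax)) ^ n)
    \<le> lik k {..<K} (agree_on W ({..<K} - H)) w gz"
proof -
  obtain g z where gz_eq: "gz = (g, z)" by (cases gz)
  have space: "gz \<in> space Om"
    using S w gz sets.sets_into_space by (fastforce simp: decoding_family_def)
  have "(1 / (P powr e * output_const K dmax)) ^ n
      \<le> (\<Prod>t<n. cnormal_density (P powr e) (signal k g w t + z (t, k)))"
    using prod_output_density_ge[OF k(1) w, of g z "noise_cap K" "sqrt P powr e"] space gz(2) e P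
    by (simp add: atypical_def gz_eq output_const_def sqrt_powr_square sqrt_powr_ge_1 sqrt_powr_mono)
  moreover have "real (\<Prod>k\<in>H. M k) \<le> real (card (agree_on W ({..<K} - H) `` {w}))"
    using card_agree_on_class_ge[OF w k(2)] by (simp del: of_nat_prod)
  ultimately have "err_tol K * (real (\<Prod>k\<in>H. M k) * (1 / (P powr e * output_const K dmax)) ^ n)
      \<le> err_tol K * (real (card (agree_on W ({..<K} - H) `` {w})) *
          (\<Prod>t<n. cnormal_density (P powr e) (signal k g w t + z (t, k))))"
    using err_tol_pos output_const_pos[of K dmax] by (intro mult_left_mono mult_mono) auto
  also have "\<dots> \<le> lik k {..<K} (agree_on W ({..<K} - H)) w gz"
    using probable space by (simp add: improbable_def gz_eq not_less)
  finally show ?thesis .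
qed

lemma broadcast_size_le:
  assumes ks: "ks \<noteq> []" "distinct ks" "set ks \<subseteq> {..<K}"
    and e: "\<And>l. Suc l < length ks \<Longrightarrow> e l \<ge> 0"
      "\<And>l i. Suc l < length ks \<Longrightarrow> i < K \<Longrightarrow> \<alpha> (ks ! Suc l) i - \<alpha> (ks ! l) i \<le> e l"
    and e0: "e0 \<ge> 0" "\<And>i. i < K \<Longrightarrow> \<alpha> (ks ! 0) i \<le> e0"
    and A: "A \<ge> 0" "\<And>k i. k < K \<Longrightarrow> i < K \<Longrightarrow> \<alpha> k i \<le> A" and J: "P powr A \<le> 4 ^ J"
  shows "real (\<Prod>k\<in>set ks. M k) \<le> (1 / err_tol K) ^ (2 * length ks) *
    (output_const K dmax * align_const K fmax dmax (noise_cap K) ^ (length ks - 1) *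
      (real J + 1) ^ (length ks - 1) *
      P powr (e0 + (\<Sum>l<length ks - 1. e l))) ^ n"
proof -
  let ?c = "err_tol K" and ?m = "length ks"
  define X where "X = P powr e0 * output_const K dmax"
  have c: "?c > 0" and X: "X > 0" using P by (simp_all add: X_def err_tol_pos output_const_pos)
  have known_before_0: "known_before ks 0 = {..<K} - set ks" by (simp add: known_before_def)
  obtain S where S: "decoding_family S" using ex_decoding_family by blast
  have "P powr e0 > 0" using P by simp
  obtain w gz where w: "w \<in> W" and gz: "gz \<in> S w" "gz \<notin> atypical w"
    and probable: "gz \<notin> improbable (P powr e0) (ks ! 0) (known_before ks 0) w"
    and confident: "\<And>l. l < ?m \<Longrightarrow> gz \<notin> unconfident S (ks ! l) (known_before ks l) w"
    and aligned: "\<And>l. Suc l < ?m \<Longrightarrow>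
      gz \<notin> misaligned (hop_loss (e l) J) (ks ! Suc l) (ks ! l) {..<K} (known_before ks (Suc l)) w"
    by (rule ex_typical_path[OF ks e A J \<open>P powr e0 > 0\<close> S]; blast)
  have "ks ! 0 < K" using ks(1,3) by (cases ks) auto
  then have "?c * (real (\<Prod>k\<in>set ks. M k) * (1 / X) ^ n)
      \<le> lik (ks ! 0) {..<K} (agree_on W (known_before ks 0)) w gz"
    unfolding known_before_0 X_def using ks e0 probable
    by (intro lik_lower_bound[OF S w gz]) (auto simp: known_before_0)
  also have "\<dots> \<le> (1 / ?c) ^ ?m * (\<Prod>l<?m - 1. hop_loss (e l) J)"
    using ks by (intro lik_known_before_telescoping[OF S w gz _ _ confident aligned])
  finally have "real (\<Prod>k\<in>set ks. M k) \<le> (1 / ?c) * ((1 / ?c) ^ ?m * (\<Prod>l<?m - 1. hop_loss (e l) J)) * X ^ n"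
    using c X by (simp add: power_divide field_simps)
  also have "\<dots> = (1 / ?c) ^ (1 + ?m + (?m - 1)) *
      (output_const K dmax * align_const K fmax dmax (noise_cap K) ^ (?m - 1) * (real J + 1) ^ (?m - 1) *
        P powr (e0 + (\<Sum>l<?m - 1. e l))) ^ n"
    by (simp only: X_def prod_hop_loss finite_lessThan card_lessThan powr_add power_add power_one_right
        power_mult_distrib mult_ac)
  also have "1 + ?m + (?m - 1) = 2 * ?m" using ks(1) by (cases ks) auto
  finally show ?thesis .
qed

end

subsection \<open>Cycles of receivers without transmitter cooperation\<close>

definition own_message_encoder ::
  "nat \<Rightarrow> (nat \<Rightarrow> nat) \<Rightarrow> ((nat \<Rightarrow> nat) \<Rightarrow> nat \<Rightarrow> nat \<Rightarrow> complex) \<Rightarrow> bool" where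
  "own_message_encoder K M E \<longleftrightarrow>
    (\<forall>w\<in>msg_set K M. \<forall>w'\<in>msg_set K M. \<forall>i<K. w i = w' i \<longrightarrow> E w i = E w' i)"

lemma sum_fixed_message_mult_le:
  fixes f :: "(nat \<Rightarrow> nat) \<Rightarrow> real"
  assumes k: "k < K" and f_nonneg: "\<And>w. f w \<ge> 0"
    and f_upd: "\<And>w v. w \<in> msg_set K M \<Longrightarrow> v < M k \<Longrightarrow> f (w(k := v)) = f w"
  shows "real (M k) * (\<Sum>w | w \<in> msg_set K M \<and> w k = u. f w) \<le> (\<Sum>w\<in>msg_set K M. f w)"
proof -
  define V where "V = {w \<in> msg_set K M. w k = u}"
  have "real (M k) * sum f V = (\<Sum>(v, w)\<in>{..<M k} \<times> V. f w)"
    by (simp add: sum.cartesian_product[symmetric])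
  also have "\<dots> = (\<Sum>p\<in>{..<M k} \<times> V. f ((snd p)(k := fst p)))"
    using f_upd by (intro sum.cong) (auto simp: V_def)
  also have "\<dots> = sum f ((\<lambda>p. (snd p)(k := fst p)) ` ({..<M k} \<times> V))"
  proof (rule sum.reindex[symmetric, unfolded o_def], rule inj_onI)
    fix p p'
    assume p: "p \<in> {..<M k} \<times> V" "p' \<in> {..<M k} \<times> V" and upd_eq: "(snd p)(k := fst p) = (snd p')(k := fst p')"
    have "fst p = fst p'" using fun_cong[OF upd_eq, of k] by simp
    moreover have "snd p j = snd p' j" for j
      using fun_cong[OF upd_eq, of j] p by (cases "j = k") (auto simp: V_def)
    ultimately show "p = p'" by (simp add: prod_eq_iff fun_eq_iff)
  qed
  also have "\<dots> \<le> sum f (msg_set K M)"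
    using k f_nonneg finite_msg_set
    by (intro sum_mono2) (auto simp: V_def msg_set_def PiE_def Pi_def extensional_def)
  finally show ?thesis by (simp add: V_def)
qed

context message_code
begin

lemma lik_own_message_le:
  assumes own: "own_message_encoder K M E" and k: "k < K" and w: "w \<in> W"
  shows "real (M k) * lik k {..<K} (agree_on W {k}) w gz \<le> lik k ({..<K} - {k}) (agree_on W {}) w gz"
proof -
  define f where "f w' = (\<Prod>t<n. cnormal_density 1 (snd gz (t, k) -
    (\<Sum>i\<in>{..<K} - {k}. complex_of_real (sqrt P powr \<alpha> k i) * fst gz t k i * (E w' i t - E w i t))))" for w'
  have own: "E w i = E w' i" if "w \<in> W" "w' \<in> W" "i < K" "w i = w' i" for w w' i
    using own that unfolding own_message_encoder_def by blast
  have "f (w'(k := v)) = f w'" if "w' \<in> W" "v < M k" for w' v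
  proof -
    have "w'(k := v) \<in> W" using that k by (auto simp: msg_set_def PiE_def Pi_def extensional_def)
    then have "E (w'(k := v)) i = E w' i" if "i \<in> {..<K} - {k}" for i
      using own[of "w'(k := v)" w' i] \<open>w' \<in> W\<close> that by simp
    then show ?thesis unfolding f_def
      by (auto intro!: prod.cong arg_cong[where f = "cnormal_density 1"] sum.cong)
  qed
  then have "real (M k) * (\<Sum>w' | w' \<in> W \<and> w' k = w k. f w') \<le> (\<Sum>w'\<in>W. f w')"
    using k by (intro sum_fixed_message_mult_le) (auto simp: f_def intro!: prod_nonneg)
  moreover have "lik k {..<K} (agree_on W {k}) w gz = (\<Sum>w' | w' \<in> W \<and> w' k = w k. f w')"
    unfolding lik_def
  proof (rule sum.cong)
    show "agree_on W {k} `` {w} = {w' \<in> W. w' k = w k}" using w by (auto simp: agree_on_def)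
    fix w' assume "w' \<in> {w' \<in> W. w' k = w k}"
    then have "E w' k = E w k" using own[of w' w k] w k by simp
    then show "(\<Prod>t<n. cnormal_density 1 (snd gz (t, k) -
        (\<Sum>i<K. complex_of_real (sqrt P powr \<alpha> k i) * fst gz t k i * (E w' i t - E w i t)))) = f w'"
      using k by (simp add: f_def sum.remove[of "{..<K}" k])
  qed
  moreover have "lik k ({..<K} - {k}) (agree_on W {}) w gz = (\<Sum>w'\<in>W. f w')"
    using w by (auto simp: lik_def f_def agree_on_def intro!: sum.cong)
  ultimately show ?thesis by simp
qed

lemma ex_typical_cycle:
  assumes K: "K \<ge> 2" and e: "e \<ge> 0" and pr: "\<And>k. k < K \<Longrightarrow> pr k < K" "\<And>k. k < K \<Longrightarrow> pr k \<noteq> k"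
    and le_e: "\<And>k i. k < K \<Longrightarrow> i < K \<Longrightarrow> i \<noteq> k \<Longrightarrow> \<alpha> (pr k) i - \<alpha> k i \<le> e" "\<And>k. k < K \<Longrightarrow> \<alpha> (pr k) k \<le> e"
    and A: "A \<ge> 0" "\<And>k i. k < K \<Longrightarrow> i < K \<Longrightarrow> \<alpha> k i \<le> A" and J: "P powr A \<le> 4 ^ J"
    and S: "decoding_family S"
  obtains w gz where "w \<in> W" "gz \<in> S w" "gz \<notin> atypical w" "\<And>k. k < K \<Longrightarrow> gz \<notin> unconfident S k {} w"
    "\<And>k. k < K \<Longrightarrow> gz \<notin> misaligned (hop_loss e J) (pr k) k ({..<K} - {k}) {} w"
proof -
  let ?\<B> = "{atypical} \<union> (\<lambda>k. unconfident S k {}) ` {..<K} \<union>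
    (\<lambda>k. misaligned (hop_loss e J) (pr k) k ({..<K} - {k}) {}) ` {..<K}"
  have "rare (err_tol K) (misaligned (hop_loss e J) (pr k) k ({..<K} - {k}) {})" if k: "k < K" for k
  proof -
    have "(if k = 0 then 1 else 0) \<in> {..<K} - {k}" using K k by auto
    then have "{..<K} - {k} \<noteq> {}" by blast
    then show ?thesis
      using k pr e le_e by (intro rare_hop_misaligned[OF _ _ _ _ _ _ _ _ A(1) A(2)[OF pr(1)[OF k]] J]) auto
  qed
  then have rare: "rare (err_tol K) B" if "B \<in> ?\<B>" for B
    using that rare_atypical rare_unconfident_decoding[OF S] by auto
  have "card ?\<B> \<le> 1 + K + K"
    by (intro order_trans[OF card_Un_le] add_mono card_image_le[THEN order_trans]) (auto simp: card_insert_if)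
  also have "\<dots> < 8 * K" using K by simp
  finally have card: "card ?\<B> < 8 * K" .
  obtain w gz where "w \<in> W" "gz \<in> S w" "\<And>B. B \<in> ?\<B> \<Longrightarrow> gz \<notin> B w"
    using ex_avoiding_rare_decoding[OF S _ card rare] by auto
  then show ?thesis using that[of w gz] by auto
qed

lemma size_mult_lik_le:
  assumes own: "own_message_encoder K M E" and S: "decoding_family S" and k: "k < K" and w: "w \<in> W"
    and gz: "gz \<in> S w" "gz \<notin> atypical w" "gz \<notin> unconfident S k {} w"
      "gz \<notin> misaligned L ka k ({..<K} - {k}) {} w"
  shows "real (M k) * lik k {..<K} (agree_on W {}) w gz \<le> (L / err_tol K) * lik ka {..<K} (agree_on W {}) w gz"
proof -
  have typical: "gz \<in> typical (noise_cap K)"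
    using S w gz sets.sets_into_space by (fastforce simp: atypical_def decoding_family_def)
  have "real (M k) * (err_tol K * lik k {..<K} (agree_on W {}) w gz)
      \<le> real (M k) * lik k {..<K} (agree_on W {k}) w gz"
    using gz(1,3) by (intro mult_left_mono) (auto simp: unconfident_def not_less)
  also have "\<dots> \<le> lik k ({..<K} - {k}) (agree_on W {}) w gz"
    by (rule lik_own_message_le[OF own k w])
  also have "\<dots> \<le> L * lik ka {..<K} (agree_on W {}) w gz"
    using gz(4) typical by (auto simp: misaligned_def not_less)
  finally show ?thesis using err_tol_pos by (simp add: field_simps)
qed

lemma interference_size_le:
  assumes own: "own_message_encoder K M E" and K: "K \<ge> 2" and e: "e \<ge> 0"
    and pr: "bij_betw pr {..<K} {..<K}" "\<And>k. k < K \<Longrightarrow> pr k \<noteq> k"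
    and le_e: "\<And>k i. k < K \<Longrightarrow> i < K \<Longrightarrow> i \<noteq> k \<Longrightarrow> \<alpha> (pr k) i - \<alpha> k i \<le> e" "\<And>k. k < K \<Longrightarrow> \<alpha> (pr k) k \<le> e"
    and A: "A \<ge> 0" "\<And>k i. k < K \<Longrightarrow> i < K \<Longrightarrow> \<alpha> k i \<le> A" and J: "P powr A \<le> 4 ^ J"
  shows "real (\<Prod>k<K. M k) \<le> (1 / err_tol K) ^ (2 * K) *
    (align_const K fmax dmax (noise_cap K) ^ K * (real J + 1) ^ K * P powr (real K * e)) ^ n"
proof -
  have pr_less: "pr k < K" if "k < K" for k using pr(1) that by (auto simp: bij_betw_def)
  obtain S where S: "decoding_family S" using ex_decoding_family by blast
  obtain w gz where w: "w \<in> W" and gz: "gz \<in> S w" "gz \<notin> atypical w"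
      "\<And>k. k < K \<Longrightarrow> gz \<notin> unconfident S k {} w"
      "\<And>k. k < K \<Longrightarrow> gz \<notin> misaligned (hop_loss e J) (pr k) k ({..<K} - {k}) {} w"
    by (rule ex_typical_cycle[OF K e pr_less pr(2) le_e A J S]; blast)
  define L where "L k = lik k {..<K} (agree_on W {}) w gz" for k
  have L: "L k > 0" for k
    unfolding L_def by (rule lik_pos[OF equiv_agree_on w])
  have "(\<Prod>k<K. real (M k)) * (\<Prod>k<K. L k) = (\<Prod>k<K. real (M k) * L k)"
    by (simp add: prod.distrib)
  also have "\<dots> \<le> (\<Prod>k<K. (hop_loss e J / err_tol K) * L (pr k))"
    using size_mult_lik_le[OF own S _ w gz(1,2)] gz(3,4) L
    by (intro prod_mono conjI mult_nonneg_nonneg) (auto simp: L_def intro: less_imp_le)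
  also have "\<dots> = (hop_loss e J / err_tol K) ^ K * (\<Prod>k<K. L k)"
    by (simp only: prod.distrib prod_constant card_lessThan prod.reindex_bij_betw[OF pr(1)])
  finally have "(\<Prod>k<K. real (M k)) \<le> (hop_loss e J / err_tol K) ^ K"
    using prod_pos[of "{..<K}" L] L by (simp add: mult_le_cancel_right)
  also have "\<dots> = (1 / err_tol K) ^ K * (\<Prod>k<K. hop_loss e J)"
    by (simp add: power_divide)
  also have "\<dots> = (1 / err_tol K) ^ (2 * K) *
      (align_const K fmax dmax (noise_cap K) ^ K * (real J + 1) ^ K * P powr (real K * e)) ^ n"
    unfolding prod_hop_loss[OF finite_lessThan] by (simp add: mult_2 power_add)
  finally show ?thesis by simp
qed

end

subsection \<open>Converse bounds on GDoF tuples\<close>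

lemma achievable_message_codeE:
  assumes "fading_law K fmax dmin dmax G" and P: "P > 1" and K: "K \<ge> 1" and ach: "achievable is_bc K \<alpha> G P R"
  obtains n M E dec where "message_code K fmax dmin dmax G n P \<alpha> M E dec"
    "\<And>k. k < K \<Longrightarrow> 2 powr (real n * R k) \<le> real (M k)" "\<not> is_bc \<Longrightarrow> own_message_encoder K M E"
proof -
  interpret fading_law K fmax dmin dmax G by fact
  have "(1 / 4 :: real) > 0" by simp
  with ach obtain N where N: "\<forall>n\<ge>N. \<exists>M E dec.
        (\<forall>k<K. 2 powr (real n * R k) \<le> real (M k)) \<and>
        (\<forall>w\<in>msg_set K M. \<forall>i<K. (\<Sum>t<n. (cmod (E w i t))\<^sup>2) \<le> real n) \<and>
        (\<not> is_bc \<longrightarrow> own_message_encoder K M E) \<and>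
        ennreal (1 - 1 / 4) \<le> success_prob K \<alpha> P G n M E dec"
    unfolding achievable_def own_message_encoder_def by blast
  define n where "n = max N 1"
  have "n \<ge> N" by (simp add: n_def)
  from N[rule_format, OF this] obtain M E dec where
      size: "\<forall>k<K. 2 powr (real n * R k) \<le> real (M k)"
    and power: "\<forall>w\<in>msg_set K M. \<forall>i<K. (\<Sum>t<n. (cmod (E w i t))\<^sup>2) \<le> real n"
    and own: "\<not> is_bc \<longrightarrow> own_message_encoder K M E"
    and success: "ennreal (1 - 1 / 4) \<le> success_prob K \<alpha> P G n M E dec"
    by (elim exE conjE) (rule that)
  have M_pos: "M k \<ge> 1" if "k < K" for k
  proof -
    have "0 < 2 powr (real n * R k)" by simp
    also have "\<dots> \<le> real (M k)" using size that by blast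
    finally show ?thesis by simp
  qed
  have "message_code K fmax dmin dmax G n P \<alpha> M E dec"
    using P K M_pos success power finite_msg_set[of K M]
    by unfold_locales (simp_all add: n_def)
  then show ?thesis
    using size own by (intro that[of n M E dec]) simp_all
qed

lemma sum_rate_le_of_size_le:
  assumes T: "finite T" and size: "\<And>k. k \<in> T \<Longrightarrow> 2 powr (real n * R k) \<le> real (M k)"
    and le: "real (\<Prod>k\<in>T. M k) \<le> C * Y ^ n" and n: "n \<ge> 1" and C: "C \<ge> 1" and Y: "Y > 0"
  shows "(\<Sum>k\<in>T. R k) \<le> log 2 C + log 2 Y"
proof -
  have "2 powr (real n * (\<Sum>k\<in>T. R k)) = (\<Prod>k\<in>T. 2 powr (real n * R k))"
    using T by (simp add: sum_distrib_left powr_sum)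
  also have "\<dots> \<le> (\<Prod>k\<in>T. real (M k))"
    using size by (intro prod_mono) auto
  also have "\<dots> \<le> C * Y ^ n" using le by simp
  finally have "real n * (\<Sum>k\<in>T. R k) \<le> log 2 (C * Y ^ n)"
    using C Y by (simp add: le_log_iff)
  also have "\<dots> = log 2 C + real n * log 2 Y"
    using C Y by (simp add: log_mult log_nat_power)
  also have "log 2 C \<le> real n * log 2 C"
    using C n mult_right_mono[of 1 "real n" "log 2 C"] by simp
  finally have "real n * (\<Sum>k\<in>T. R k) \<le> real n * (log 2 C + log 2 Y)" by (simp add: algebra_simps)
  then show ?thesis using n by simp
qed

lemma ex_dyadic_exponent:
  fixes P A :: real
  assumes "P > 1" "A \<ge> 0"
  obtains J :: nat where "P powr A \<le> 4 ^ J" "real J + 1 \<le> A * log 2 P + 2"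
proof
  define J where "J = nat \<lceil>A * log 2 P\<rceil>"
  have "A * log 2 P \<ge> 0" using assms by simp
  then have "real J < A * log 2 P + 1" unfolding J_def by linarith
  then show "real J + 1 \<le> A * log 2 P + 2" by simp
  have "P powr A = 2 powr (A * log 2 P)"
    using assms by (simp add: powr_def log_def)
  also have "\<dots> \<le> 2 powr real J" unfolding J_def by (intro powr_mono) (auto simp: real_nat_ceiling_ge)
  also have "\<dots> = 2 ^ J" by (simp add: powr_realpow)
  also have "\<dots> \<le> 4 ^ J" by (intro power_mono) auto
  finally show "P powr A \<le> 4 ^ J" .
qed

lemma GDoF_le_of_rate_le:
  fixes R :: "real \<Rightarrow> real"
  assumes lim: "((\<lambda>P. R P / log 2 P) \<longlongrightarrow> d) at_top" and A: "A > 0"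
    and le: "\<And>P. P > 1 \<Longrightarrow> R P \<le> B + C * log 2 (A * log 2 P + 2) + e * log 2 P"
  shows "d \<le> e"
proof (rule tendsto_le[OF _ _ lim])
  show "((\<lambda>P. (B + C * log 2 (A * log 2 P + 2)) / log 2 P + e) \<longlongrightarrow> e) at_top"
    using A by real_asymp
  show "\<forall>\<^sub>F P in at_top. R P / log 2 P \<le> (B + C * log 2 (A * log 2 P + 2)) / log 2 P + e"
    using eventually_gt_at_top[of 1]
  proof eventually_elim
    case (elim P)
    then have "log 2 P > 0" by simp
    then show ?case using le[OF elim] by (simp add: divide_simps)
  qed
qed simp

definition alpha_bound :: "nat \<Rightarrow> (nat \<Rightarrow> nat \<Rightarrow> real) \<Rightarrow> real" where
  "alpha_bound K \<alpha> = 1 + (\<Sum>k<K. \<Sum>i<K. \<bar>\<alpha> k i\<bar>)"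

lemma alpha_bound_pos: "alpha_bound K \<alpha> > 0"
  unfolding alpha_bound_def by (intro add_pos_nonneg sum_nonneg) auto

lemma le_alpha_bound:
  assumes "k < K" "i < K"
  shows "\<alpha> k i \<le> alpha_bound K \<alpha>"
proof -
  have "\<bar>\<alpha> k i\<bar> \<le> (\<Sum>i<K. \<bar>\<alpha> k i\<bar>)" using assms by (intro member_le_sum) auto
  also have "\<dots> \<le> (\<Sum>k<K. \<Sum>i<K. \<bar>\<alpha> k i\<bar>)"
    using assms by (intro member_le_sum[of k "{..<K}" "\<lambda>k. \<Sum>i<K. \<bar>\<alpha> k i\<bar>"]) (auto intro!: sum_nonneg)
  finally show ?thesis by (simp add: alpha_bound_def)
qed

lemma GDoF_sum_le_of_size_le:
  assumes K: "K \<ge> 1" and adm: "admissible_channel K Gm" and d: "d \<in> GDoF_region is_bc K \<alpha> Gm"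
    and T: "T \<subseteq> {..<K}"
    and C: "C \<ge> 1" "\<And>fmax dmax. fmax > 0 \<Longrightarrow> C' fmax dmax > 0"
    and size_le: "\<And>fmax dmin dmax G n P M E dec J. message_code K fmax dmin dmax G n P \<alpha> M E dec \<Longrightarrow>
      (\<not> is_bc \<Longrightarrow> own_message_encoder K M E) \<Longrightarrow> P powr alpha_bound K \<alpha> \<le> 4 ^ J \<Longrightarrow>
      real (\<Prod>k\<in>T. M k) \<le> C * (C' fmax dmax * (real J + 1) ^ m * P powr e) ^ n"
  shows "(\<Sum>k\<in>T. d k) \<le> e"
proof -
  let ?A = "alpha_bound K \<alpha>"
  obtain fmax dmin dmax where law: "\<And>P. P > 1 \<Longrightarrow> fading_law K fmax dmin dmax (Gm P)"
    using admissible_channelE[OF adm] by blast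
  obtain R where ach: "\<And>P. P > 1 \<Longrightarrow> achievable is_bc K \<alpha> (Gm P) P (R P)"
      and lim: "\<And>k. k < K \<Longrightarrow> ((\<lambda>P. R P k / log 2 P) \<longlongrightarrow> d k) at_top"
    using d unfolding GDoF_region_def by blast
  have "fmax > 0" using law[of 2] by (simp add: fading_law_def fading_law_axioms_def)
  then have C': "C' fmax dmax > 0" by (rule C(2))
  have "((\<lambda>P. (\<Sum>k\<in>T. R P k) / log 2 P) \<longlongrightarrow> (\<Sum>k\<in>T. d k)) at_top"
    unfolding sum_divide_distrib using lim T by (intro tendsto_sum) auto
  then show ?thesis
  proof (rule GDoF_le_of_rate_le[OF _ alpha_bound_pos])
    fix P :: real assume P: "P > 1"
    obtain n M E dec where code: "message_code K fmax dmin dmax (Gm P) n P \<alpha> M E dec"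
      and size: "\<And>k. k < K \<Longrightarrow> 2 powr (real n * R P k) \<le> real (M k)"
      and own: "\<not> is_bc \<Longrightarrow> own_message_encoder K M E"
      using achievable_message_codeE[OF law[OF P] P K ach[OF P]] by blast
    obtain J where J: "P powr ?A \<le> 4 ^ J" "real J + 1 \<le> ?A * log 2 P + 2"
      using ex_dyadic_exponent[OF P less_imp_le[OF alpha_bound_pos]] by blast
    have "(\<Sum>k\<in>T. R P k) \<le> log 2 C + log 2 (C' fmax dmax * (real J + 1) ^ m * P powr e)"
    proof (rule sum_rate_le_of_size_le[OF _ _ size_le[OF code own J(1)] _ C(1)])
      show "n \<ge> 1" by (rule message_code.n_pos[OF code])
      show "C' fmax dmax * (real J + 1) ^ m * P powr e > 0" using C' P by (simp add: zero_less_mult_iff)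
    qed (use size T finite_subset in auto)
    also have "log 2 (C' fmax dmax * (real J + 1) ^ m * P powr e)
        = log 2 (C' fmax dmax) + real m * log 2 (real J + 1) + e * log 2 P"
      using C' P by (simp add: log_mult log_powr log_nat_power add_pos_nonneg)
    also have "real m * log 2 (real J + 1) \<le> real m * log 2 (?A * log 2 P + 2)"
      using J(2) by (intro mult_left_mono log_mono) auto
    finally show "(\<Sum>k\<in>T. R P k)
        \<le> (log 2 C + log 2 (C' fmax dmax)) + real m * log 2 (?A * log 2 P + 2) + e * log 2 P"
      by simp
  qed
qed

lemma GDoF_broadcast_le:
  assumes K: "K \<ge> 1" and adm: "admissible_channel K Gm" and d: "d \<in> GDoF_region is_bc K \<alpha> Gm"
    and ks: "ks \<noteq> []" "distinct ks" "set ks \<subseteq> {..<K}"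
    and e: "\<And>l. Suc l < length ks \<Longrightarrow> e l \<ge> 0"
      "\<And>l i. Suc l < length ks \<Longrightarrow> i < K \<Longrightarrow> \<alpha> (ks ! Suc l) i - \<alpha> (ks ! l) i \<le> e l"
    and e0: "e0 \<ge> 0" "\<And>i. i < K \<Longrightarrow> \<alpha> (ks ! 0) i \<le> e0"
  shows "(\<Sum>k\<in>set ks. d k) \<le> e0 + (\<Sum>l<length ks - 1. e l)"
proof (rule GDoF_sum_le_of_size_le[OF K adm d ks(3)])
  show "(1 / err_tol K) ^ (2 * length ks) \<ge> 1"
    using K by (intro one_le_power) (simp add: err_tol_def)
  show "output_const K dmax * align_const K fmax dmax (noise_cap K) ^ (length ks - 1) > 0" if "fmax > 0"
    for fmax dmax
    using that by (simp add: output_const_pos align_const_pos)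
  fix fmax dmin dmax G n P M E dec J
  assume "message_code K fmax dmin dmax G n P \<alpha> M E dec" and J: "P powr alpha_bound K \<alpha> \<le> 4 ^ J"
  then interpret message_code K fmax dmin dmax G n P \<alpha> M E dec by simp
  show "real (\<Prod>k\<in>set ks. M k) \<le> (1 / err_tol K) ^ (2 * length ks) *
      (output_const K dmax * align_const K fmax dmax (noise_cap K) ^ (length ks - 1) *
        (real J + 1) ^ (length ks - 1) *
        P powr (e0 + (\<Sum>l<length ks - 1. e l))) ^ n"
    by (rule broadcast_size_le[OF ks e e0 less_imp_le[OF alpha_bound_pos] le_alpha_bound J])
qed

lemma GDoF_interference_le:
  assumes K: "K \<ge> 2" and adm: "admissible_channel K Gm" and d: "d \<in> GDoF_region False K \<alpha> Gm" and e: "e \<ge> 0"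
    and pr: "bij_betw pr {..<K} {..<K}" "\<And>k. k < K \<Longrightarrow> pr k \<noteq> k"
    and le_e: "\<And>k i. k < K \<Longrightarrow> i < K \<Longrightarrow> i \<noteq> k \<Longrightarrow> \<alpha> (pr k) i - \<alpha> k i \<le> e" "\<And>k. k < K \<Longrightarrow> \<alpha> (pr k) k \<le> e"
  shows "(\<Sum>k<K. d k) \<le> real K * e"
proof (rule GDoF_sum_le_of_size_le[OF _ adm d order_refl])
  show "(1 / err_tol K) ^ (2 * K) \<ge> 1"
    using K by (intro one_le_power) (simp add: err_tol_def)
  show "align_const K fmax dmax (noise_cap K) ^ K > 0" if "fmax > 0" for fmax dmax
    using that by (simp add: align_const_pos)
  fix fmax dmin dmax G n P M E dec J
  assume "message_code K fmax dmin dmax G n P \<alpha> M E dec" and own: "\<not> False \<Longrightarrow> own_message_encoder K M E"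
    and J: "P powr alpha_bound K \<alpha> \<le> 4 ^ J"
  then interpret message_code K fmax dmin dmax G n P \<alpha> M E dec by simp
  show "real (\<Prod>k<K. M k) \<le> (1 / err_tol K) ^ (2 * K) *
      (align_const K fmax dmax (noise_cap K) ^ K * (real J + 1) ^ K * P powr (real K * e)) ^ n"
    using own by (intro interference_size_le[OF _ K e pr le_e less_imp_le[OF alpha_bound_pos] le_alpha_bound J]) simp
qed (use K in simp)

subsection \<open>Codes of large minimum distance\<close>

lemma ex_separated_subset:
  fixes b :: real
  assumes fin: "finite X" and refl: "\<And>x. x \<in> X \<Longrightarrow> near x x" and sym: "\<And>x y. near x y \<Longrightarrow> near y x"
    and ball: "\<And>x. x \<in> X \<Longrightarrow> real (card {y \<in> X. near x y}) \<le> b"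
  obtains C where "C \<subseteq> X" "real (card X) \<le> b * real (card C)" "\<And>x y. x \<in> C \<Longrightarrow> y \<in> C \<Longrightarrow> x \<noteq> y \<Longrightarrow> \<not> near x y"
proof -
  define \<C> where "\<C> = {C. C \<subseteq> X \<and> (\<forall>x\<in>C. \<forall>y\<in>C. x \<noteq> y \<longrightarrow> \<not> near x y)}"
  have "finite \<C>" by (rule finite_subset[of _ "Pow X"]) (auto simp: \<C>_def fin)
  moreover have "{} \<in> \<C>" by (simp add: \<C>_def)
  ultimately obtain C where C: "C \<in> \<C>" and max: "\<And>B. B \<in> \<C> \<Longrightarrow> C \<subseteq> B \<Longrightarrow> C = B"
    using finite_has_maximal[of \<C>] by blast
  have "C \<subseteq> X" using C by (simp add: \<C>_def)
  then have finite_C: "finite C" using fin finite_subset by blast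
  have "X \<subseteq> (\<Union>x\<in>C. {y \<in> X. near x y})"
  proof (rule subsetI, rule ccontr)
    fix y assume y: "y \<in> X" "y \<notin> (\<Union>x\<in>C. {y \<in> X. near x y})"
    then have "insert y C \<in> \<C>" using C sym by (auto simp: \<C>_def)
    then have "y \<in> C" using max[of "insert y C"] by auto
    then show False using y refl by auto
  qed
  then have "card X \<le> card (\<Union>x\<in>C. {y \<in> X. near x y})"
    using finite_C fin by (intro card_mono) auto
  also have "\<dots> \<le> (\<Sum>x\<in>C. card {y \<in> X. near x y})"
    by (rule card_UN_le[OF finite_C])
  finally have "real (card X) \<le> (\<Sum>x\<in>C. real (card {y \<in> X. near x y}))"
    by (simp only: of_nat_sum[symmetric] of_nat_le_iff)
  also have "\<dots> \<le> (\<Sum>x\<in>C. b)"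
    using ball \<open>C \<subseteq> X\<close> by (intro sum_mono) auto
  also have "\<dots> = b * real (card C)" by (simp add: mult.commute)
  finally show ?thesis using that[of C] C by (auto simp: \<C>_def)
qed

definition nat_dist :: "nat \<Rightarrow> nat \<Rightarrow> nat" where
  "nat_dist x y = (x - y) + (y - x)"

lemma nat_dist_le_square: "real (nat_dist x y) \<le> (real x - real y)\<^sup>2"
proof -
  have "\<bar>real x - real y\<bar> = real (nat_dist x y)" by (auto simp: nat_dist_def)
  moreover have "real (nat_dist x y) \<le> (real (nat_dist x y))\<^sup>2"
    by (cases "nat_dist x y") (auto simp: power2_eq_square)
  ultimately show ?thesis by (metis power2_abs)
qed

lemma sum_half_power_nat_dist_le: "(\<Sum>v<N. (1 / 2 :: real) ^ nat_dist x v) \<le> 3"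
proof -
  have geometric: "(\<Sum>i<m. (1 / 2 :: real) ^ i) \<le> 2" for m
    by (subst geometric_sum) (auto simp: field_simps)
  have "(\<Sum>v<N. (1 / 2 :: real) ^ nat_dist x v) \<le> (\<Sum>v\<in>{..x} \<union> {x<..x + N}. (1 / 2 :: real) ^ nat_dist x v)"
    by (intro sum_mono2) auto
  also have "\<dots> = (\<Sum>v\<in>{..x}. (1 / 2 :: real) ^ nat_dist x v) + (\<Sum>v\<in>{x<..x + N}. (1 / 2 :: real) ^ nat_dist x v)"
    by (rule sum.union_disjoint) auto
  also have "(\<Sum>v\<in>{..x}. (1 / 2 :: real) ^ nat_dist x v) = (\<Sum>i<Suc x. (1 / 2 :: real) ^ i)"
    by (rule sum.reindex_bij_witness[of _ "\<lambda>i. x - i" "\<lambda>v. x - v"]) (auto simp: nat_dist_def)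
  also have "(\<Sum>v\<in>{x<..x + N}. (1 / 2 :: real) ^ nat_dist x v) = (\<Sum>i<N. (1 / 2 :: real) ^ Suc i)"
    by (rule sum.reindex_bij_witness[of _ "\<lambda>i. x + Suc i" "\<lambda>v. v - x - 1"])
      (auto simp: nat_dist_def Suc_diff_Suc simp del: power_Suc)
  also have "(\<Sum>i<N. (1 / 2 :: real) ^ Suc i) = 1 / 2 * (\<Sum>i<N. (1 / 2 :: real) ^ i)"
    by (simp add: sum_distrib_left)
  finally show ?thesis using geometric[of "Suc x"] geometric[of N] by linarith
qed

text \<open>A Chernoff bound: each point of the ball has weight at least \<open>2\<^sup>-\<^sup>m\<close> under the exponential of minus the distance.\<close>
lemma card_nat_dist_ball_le:
  "real (card {y \<in> Pi\<^sub>E {..<m} (\<lambda>_. {..<N}). (\<Sum>j<m. nat_dist (x j) (y j)) \<le> m}) \<le> 6 ^ m"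
proof -
  let ?X = "Pi\<^sub>E {..<m} (\<lambda>_. {..<N})" and ?d = "\<lambda>y. \<Sum>j<m. nat_dist (x j) (y j)"
  have fin: "finite ?X" by (intro finite_PiE) auto
  have "real (card {y \<in> ?X. ?d y \<le> m}) = (\<Sum>y\<in>{y \<in> ?X. ?d y \<le> m}. 1)" by simp
  also have "\<dots> \<le> (\<Sum>y\<in>{y \<in> ?X. ?d y \<le> m}. 2 ^ m * (1 / 2) ^ ?d y)"
  proof (rule sum_mono)
    fix y assume y: "y \<in> {y \<in> ?X. ?d y \<le> m}"
    have "(1 :: real) = 2 ^ m * (1 / 2) ^ m" by (simp add: power_divide)
    also have "\<dots> \<le> 2 ^ m * (1 / 2) ^ ?d y"
      using y by (intro mult_left_mono power_decreasing) auto
    finally show "1 \<le> (2 :: real) ^ m * (1 / 2) ^ ?d y" .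
  qed
  also have "\<dots> \<le> (\<Sum>y\<in>?X. 2 ^ m * (1 / 2) ^ ?d y)"
    using fin by (intro sum_mono2) auto
  also have "\<dots> = 2 ^ m * (\<Sum>y\<in>?X. \<Prod>j<m. (1 / 2) ^ nat_dist (x j) (y j))"
    by (simp add: sum_distrib_left power_sum)
  also have "(\<Sum>y\<in>?X. \<Prod>j<m. (1 / 2) ^ nat_dist (x j) (y j)) = (\<Prod>j<m. \<Sum>v<N. (1 / 2 :: real) ^ nat_dist (x j) v)"
    by (subst prod_sum_PiE) auto
  also have "\<dots> \<le> (\<Prod>j<m. 3)"
    by (intro prod_mono conjI sum_half_power_nat_dist_le sum_nonneg) auto
  finally show ?thesis by (simp add: power_mult_distrib[symmetric])
qed

lemma ex_integer_code:
  obtains C where "C \<subseteq> Pi\<^sub>E {..<m} (\<lambda>_. {..<N})" "(real N / 6) ^ m \<le> real (card C)"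
    "\<And>x y. x \<in> C \<Longrightarrow> y \<in> C \<Longrightarrow> x \<noteq> y \<Longrightarrow> m < (\<Sum>j<m. nat_dist (x j) (y j))"
proof -
  let ?X = "Pi\<^sub>E {..<m} (\<lambda>_. {..<N})"
  obtain C where C: "C \<subseteq> ?X" "real (card ?X) \<le> 6 ^ m * real (card C)"
    "\<And>x y. x \<in> C \<Longrightarrow> y \<in> C \<Longrightarrow> x \<noteq> y \<Longrightarrow> \<not> (\<Sum>j<m. nat_dist (x j) (y j)) \<le> m"
  proof (rule ex_separated_subset[of ?X "\<lambda>x y. (\<Sum>j<m. nat_dist (x j) (y j)) \<le> m" "6 ^ m"])
    show "finite ?X" by (intro finite_PiE) auto
    show "real (card {y \<in> ?X. (\<Sum>j<m. nat_dist (x j) (y j)) \<le> m}) \<le> 6 ^ m" for x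
      by (rule card_nat_dist_ball_le)
  qed (auto simp: nat_dist_def add.commute)
  then show ?thesis
    using that[of C] by (simp add: card_PiE power_divide field_simps not_le)
qed

lemma ex_complex_code:
  assumes N: "N \<ge> 1"
  obtains code :: "nat \<Rightarrow> nat \<Rightarrow> complex" and L :: nat
  where "(real N / 6) ^ (2 * n) \<le> real L" "\<And>u t. u < L \<Longrightarrow> t < n \<Longrightarrow> cmod (code u t) \<le> 1"
    "\<And>u v. u < L \<Longrightarrow> v < L \<Longrightarrow> u \<noteq> v \<Longrightarrow> real n / (2 * (real N)\<^sup>2) < (\<Sum>t<n. (cmod (code u t - code v t))\<^sup>2)"
proof -
  obtain C where C: "C \<subseteq> Pi\<^sub>E {..<2 * n} (\<lambda>_. {..<N})" and card: "(real N / 6) ^ (2 * n) \<le> real (card C)"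
    and far: "\<And>x y. x \<in> C \<Longrightarrow> y \<in> C \<Longrightarrow> x \<noteq> y \<Longrightarrow> 2 * n < (\<Sum>j<2 * n. nat_dist (x j) (y j))"
    using ex_integer_code[of "2 * n" N] by blast
  have "finite C" using C by (rule finite_subset) (intro finite_PiE; simp)
  then obtain h where h: "bij_betw h {..<card C} C"
    using ex_bij_betw_nat_finite[of C] by (auto simp: atLeast0LessThan)
  have h_less: "h u j < N" if "u < card C" "j < 2 * n" for u j
    using bij_betwE[OF h] C that by fastforce
  define code where
    "code u t = Complex (real (h u (2 * t)) / (2 * real N)) (real (h u (2 * t + 1)) / (2 * real N))" for u t
  show ?thesis
  proof (rule that[OF card, of code])
    fix u t assume ut: "u < card C" "t < n"
    have "cmod (code u t) \<le> \<bar>real (h u (2 * t)) / (2 * real N)\<bar> + \<bar>real (h u (2 * t + 1)) / (2 * real N)\<bar>"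
      using cmod_le[of "code u t"] by (simp add: code_def)
    also have "\<dots> \<le> 1 / 2 + 1 / 2"
      using h_less[OF ut(1), of "2 * t"] h_less[OF ut(1), of "2 * t + 1"] ut(2) N
      by (intro add_mono) (auto simp: divide_simps)
    finally show "cmod (code u t) \<le> 1" by simp
  next
    fix u v assume uv: "u < card C" "v < card C" "u \<noteq> v"
    have "h u \<noteq> h v" using h uv by (auto simp: bij_betw_def inj_on_def)
    then have "2 * n < (\<Sum>j<2 * n. nat_dist (h u j) (h v j))"
      using far bij_betwE[OF h] uv by blast
    then have "real (2 * n) < (\<Sum>j<2 * n. real (nat_dist (h u j) (h v j)))"
      by (simp only: of_nat_sum[symmetric] of_nat_less_iff)
    also have "\<dots> \<le> (\<Sum>j<2 * n. (real (h u j) - real (h v j))\<^sup>2)"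
      by (intro sum_mono nat_dist_le_square)
    also have "\<dots> = (\<Sum>t<n. (real (h u (2 * t)) - real (h v (2 * t)))\<^sup>2 +
          (real (h u (2 * t + 1)) - real (h v (2 * t + 1)))\<^sup>2)"
      by (induction n) (auto simp: algebra_simps)
    also have "\<dots> = (\<Sum>t<n. (2 * real N)\<^sup>2 * (cmod (code u t - code v t))\<^sup>2)"
      using N by (intro sum.cong refl)
        (simp add: code_def cmod_power2 diff_divide_distrib[symmetric] power_divide add_divide_distrib[symmetric])
    finally show "real n / (2 * (real N)\<^sup>2) < (\<Sum>t<n. (cmod (code u t - code v t))\<^sup>2)"
      using N by (simp add: sum_distrib_left[symmetric] field_simps power2_eq_square)
  qed
qed

definition good_code :: "nat \<Rightarrow> real \<Rightarrow> (nat \<Rightarrow> nat \<Rightarrow> complex) \<Rightarrow> nat \<Rightarrow> bool" where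
  "good_code n R code L \<longleftrightarrow> 2 powr (real n * R) \<le> real L \<and> (\<forall>u<L. \<forall>t<n. cmod (code u t) \<le> 1) \<and>
    (\<forall>u<L. \<forall>v<L. u \<noteq> v \<longrightarrow> R > 0 \<and> real n / (98 * 2 powr R) \<le> (\<Sum>t<n. (cmod (code u t - code v t))\<^sup>2))"

lemma good_code_size_pos:
  assumes "good_code n R code L"
  shows "L > 0"
proof -
  have "0 < 2 powr (real n * R)" by simp
  also have "\<dots> \<le> real L" using assms by (simp add: good_code_def)
  finally show ?thesis by simp
qed

lemma good_code_diff_le:
  assumes "good_code n R code L" and "u < L" "v < L" and "t < n"
  shows "cmod (code u t - code v t) \<le> 2"
proof -
  have "cmod (code u t) \<le> 1" "cmod (code v t) \<le> 1" using assms by (simp_all add: good_code_def)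
  then show ?thesis using norm_triangle_ineq4[of "code u t" "code v t"] by linarith
qed

lemma ex_good_code:
  assumes R: "R \<ge> 0"
  shows "\<exists>code L. good_code n R code L"
proof (cases "R = 0")
  case True
  show ?thesis by (intro exI[of _ "\<lambda>_ _. 0"] exI[of _ 1]) (simp add: True good_code_def)
next
  case False
  define N where "N = nat \<lceil>6 * 2 powr (R / 2)\<rceil>"
  have powr_ge_1: "2 powr (R / 2) \<ge> 1" using R by (intro ge_one_powr_ge_zero) auto
  have N_ge: "6 * 2 powr (R / 2) \<le> real N" unfolding N_def by (rule real_nat_ceiling_ge)
  have "real N < 6 * 2 powr (R / 2) + 1" unfolding N_def using powr_ge_1 by linarith
  then have N_le: "real N \<le> 7 * 2 powr (R / 2)" using powr_ge_1 by linarith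
  have N_pos: "N \<ge> 1" using N_ge powr_ge_1 by linarith
  have square: "(2 powr (R / 2))\<^sup>2 = 2 powr R" by (simp add: power2_eq_square powr_add[symmetric])
  obtain code L where L: "(real N / 6) ^ (2 * n) \<le> real L"
    and peak: "\<And>u t. u < L \<Longrightarrow> t < n \<Longrightarrow> cmod (code u t) \<le> 1"
    and far: "\<And>u v. u < L \<Longrightarrow> v < L \<Longrightarrow> u \<noteq> v \<Longrightarrow> real n / (2 * (real N)\<^sup>2) < (\<Sum>t<n. (cmod (code u t - code v t))\<^sup>2)"
    by (rule ex_complex_code[OF N_pos, where n = n]) (rule that)
  have "2 powr (real n * R) = (2 powr R) ^ n"
    by (simp add: powr_realpow[symmetric] powr_powr mult.commute)
  also have "\<dots> = (2 powr (R / 2)) ^ (2 * n)" by (simp only: power_mult square)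
  also have "\<dots> \<le> (real N / 6) ^ (2 * n)" using N_ge by (intro power_mono) auto
  finally have "2 powr (real n * R) \<le> real L" using L by linarith
  moreover have "real n / (98 * 2 powr R) \<le> (\<Sum>t<n. (cmod (code u t - code v t))\<^sup>2)" if "u < L" "v < L" "u \<noteq> v"
    for u v
  proof -
    have "(real N)\<^sup>2 \<le> (7 * 2 powr (R / 2))\<^sup>2" using N_le by (intro power_mono) auto
    also have "\<dots> = 49 * 2 powr R" by (simp only: power_mult_distrib square) simp
    finally have "real n / (98 * 2 powr R) \<le> real n / (2 * (real N)\<^sup>2)"
      using N_pos by (intro divide_left_mono) auto
    then show ?thesis using far[OF that] by linarith
  qed
  ultimately have "good_code n R code L"
    using peak R False by (simp add: good_code_def)
  then show ?thesis by blast
qed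

subsection \<open>Achievability from minimum distance\<close>

lemma sum_norm_add_square_le:
  fixes x y :: "'i \<Rightarrow> 'a :: real_normed_vector"
  shows "(\<Sum>t\<in>T. (norm (x t + y t))\<^sup>2) \<le> 2 * (\<Sum>t\<in>T. (norm (x t))\<^sup>2) + 2 * (\<Sum>t\<in>T. (norm (y t))\<^sup>2)"
proof -
  have "(norm (x t + y t))\<^sup>2 \<le> 2 * (norm (x t))\<^sup>2 + 2 * (norm (y t))\<^sup>2" for t
  proof -
    have "(norm (x t + y t))\<^sup>2 \<le> (norm (x t) + norm (y t))\<^sup>2"
      by (intro power_mono norm_triangle_ineq) simp
    also have "\<dots> \<le> 2 * (norm (x t))\<^sup>2 + 2 * (norm (y t))\<^sup>2"
      by (rule power2_sum_le)
    finally show ?thesis .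
  qed
  then have "(\<Sum>t\<in>T. (norm (x t + y t))\<^sup>2) \<le> (\<Sum>t\<in>T. 2 * (norm (x t))\<^sup>2 + 2 * (norm (y t))\<^sup>2)"
    by (rule sum_mono)
  then show ?thesis by (simp add: sum.distrib sum_distrib_left)
qed

context fading_block
begin

definition separated_encoder ::
  "(nat \<Rightarrow> nat \<Rightarrow> real) \<Rightarrow> real \<Rightarrow> (nat \<Rightarrow> nat) \<Rightarrow> ((nat \<Rightarrow> nat) \<Rightarrow> nat \<Rightarrow> nat \<Rightarrow> complex) \<Rightarrow> bool" where
  "separated_encoder \<alpha> P M E \<longleftrightarrow>
    (\<forall>w\<in>msg_set K M. \<forall>w'\<in>msg_set K M. \<forall>k<K. \<forall>g. bounded_gains k g \<longrightarrow> w k \<noteq> w' k \<longrightarrow>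
      16 * real n < (\<Sum>t<n.
        (cmod (\<Sum>i<K. complex_of_real (sqrt P powr \<alpha> k i) * g t k i * (E w i t - E w' i t)))\<^sup>2))"

definition distance_decoder ::
  "(nat \<Rightarrow> nat \<Rightarrow> real) \<Rightarrow> real \<Rightarrow> (nat \<Rightarrow> nat) \<Rightarrow> ((nat \<Rightarrow> nat) \<Rightarrow> nat \<Rightarrow> nat \<Rightarrow> complex) \<Rightarrow>
    nat \<Rightarrow> (nat \<Rightarrow> complex) \<Rightarrow> (nat \<Rightarrow> nat \<Rightarrow> nat \<Rightarrow> complex) \<Rightarrow> nat" where
  "distance_decoder \<alpha> P M E k y g = (SOME v. \<exists>w\<in>msg_set K M. v = w k \<and>
    (\<Sum>t<n. (cmod (y t - (\<Sum>i<K. complex_of_real (sqrt P powr \<alpha> k i) * g t k i * E w i t)))\<^sup>2) \<le> 4 * real n)"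

lemma distance_decoder_eq:
  assumes sep: "separated_encoder \<alpha> P M E" and w: "w \<in> msg_set K M" and k: "k < K"
    and g: "bounded_gains k g" and z: "bounded_noise 4 k z"
  shows "distance_decoder \<alpha> P M E k (rx_signal K \<alpha> P n E w g z k) (restrict_time n g) = w k"
proof -
  define s where "s w t = (\<Sum>i<K. complex_of_real (sqrt P powr \<alpha> k i) * g t k i * E w i t)" for w t
  define y where "y = rx_signal K \<alpha> P n E w g z k"
  have y: "y t = s w t + z (t, k)" if "t < n" for t
    using that by (simp add: y_def rx_signal_def s_def)
  have z_le: "(\<Sum>t<n. (cmod (z (t, k)))\<^sup>2) \<le> 4 * real n"
    using z by (simp add: bounded_noise_def)
  have unique: "w' k = w k" if w': "w' \<in> msg_set K M" and near: "(\<Sum>t<n. (cmod (y t - s w' t))\<^sup>2) \<le> 4 * real n"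
    for w'
  proof (rule ccontr)
    assume "w' k \<noteq> w k"
    then have "16 * real n
        < (\<Sum>t<n. (cmod (\<Sum>i<K. complex_of_real (sqrt P powr \<alpha> k i) * g t k i * (E w i t - E w' i t)))\<^sup>2)"
      using sep[unfolded separated_encoder_def, rule_format, OF w w' k g] by simp
    also have "\<dots> = (\<Sum>t<n. (cmod ((y t - s w' t) + - z (t, k)))\<^sup>2)"
      by (intro sum.cong refl) (simp add: y s_def algebra_simps sum_subtractf)
    also have "\<dots> \<le> 2 * (\<Sum>t<n. (cmod (y t - s w' t))\<^sup>2) + 2 * (\<Sum>t<n. (cmod (- z (t, k)))\<^sup>2)"
      by (rule sum_norm_add_square_le)
    also have "\<dots> \<le> 16 * real n"
      using near z_le by simp
    finally show False by simp
  qed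
  have "distance_decoder \<alpha> P M E k y (restrict_time n g)
      = (SOME v. \<exists>w\<in>msg_set K M. v = w k \<and> (\<Sum>t<n. (cmod (y t - s w t))\<^sup>2) \<le> 4 * real n)"
    by (simp add: distance_decoder_def s_def restrict_time_def)
  also have "\<dots> = w k"
  proof (rule some_equality)
    show "\<exists>w'\<in>msg_set K M. w k = w' k \<and> (\<Sum>t<n. (cmod (y t - s w' t))\<^sup>2) \<le> 4 * real n"
      using w z_le by (intro bexI[of _ w]) (simp_all add: y)
  qed (use unique in blast)
  finally show ?thesis by (simp only: y_def)
qed

lemma emeasure_typical_ge: "ennreal (1 - real K * (2 * exp (- c / 2)) ^ n) \<le> emeasure Om (typical c)"
proof -
  have "1 - ennreal (real K * (2 * exp (- c / 2)) ^ n)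
      \<le> emeasure Om (space Om) - emeasure Om (space Om - typical c)"
    using emeasure_not_typical_le by (simp add: block.emeasure_space_1 ennreal_minus_mono)
  also have "\<dots> = emeasure Om (typical c)"
    using sets_typical sets.sets_into_space[OF sets_typical]
    by (simp add: emeasure_compl[symmetric] double_diff)
  finally show ?thesis by (simp add: ennreal_minus[symmetric])
qed

lemma success_prob_separated_ge:
  assumes sep: "separated_encoder \<alpha> P M E" and M_pos: "\<And>k. k < K \<Longrightarrow> M k \<ge> 1"
  shows "ennreal (1 - real K * (2 * exp (- 2)) ^ n) \<le> success_prob K \<alpha> P G n M E (distance_decoder \<alpha> P M E)"
proof -
  let ?W = "msg_set K M"
  let ?C = "\<lambda>w. {gz. \<forall>k<K. distance_decoder \<alpha> P M E k (rx_signal K \<alpha> P n E w (fst gz) (snd gz) k)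
    (restrict_time n (fst gz)) = w k}"
  define p where "p = ennreal (1 - real K * (2 * exp (- 2)) ^ n)"
  have "card ?W > 0"
    using msg_set_nonempty[OF M_pos] finite_msg_set by (simp add: card_gt_0_iff)
  then have "p = (\<Sum>w\<in>?W. p) / of_nat (card ?W)"
    by (simp add: mult.commute[of _ p] mult_divide_eq_ennreal)
  also have "\<dots> \<le> (\<Sum>w\<in>?W. \<integral>\<^sup>+gz. indicator (?C w) gz \<partial>Om) / of_nat (card ?W)"
  proof (intro divide_right_mono_ennreal sum_mono)
    fix w assume w: "w \<in> ?W"
    have "p \<le> emeasure Om (typical 4)"
      using emeasure_typical_ge[of 4] by (simp add: p_def)
    also have "\<dots> = (\<integral>\<^sup>+gz. indicator (typical 4) gz \<partial>Om)"
      using sets_typical by simp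
    also have "\<dots> \<le> (\<integral>\<^sup>+gz. indicator (?C w) gz \<partial>Om)"
      using distance_decoder_eq[OF sep w]
      by (intro nn_integral_mono) (auto simp: typical_def indicator_def)
    finally show "p \<le> (\<integral>\<^sup>+gz. indicator (?C w) gz \<partial>Om)" .
  qed
  finally show ?thesis by (simp add: success_prob_def p_def)
qed

end

definition unit_encoder :: "nat \<Rightarrow> nat \<Rightarrow> (nat \<Rightarrow> nat) \<Rightarrow> ((nat \<Rightarrow> nat) \<Rightarrow> nat \<Rightarrow> nat \<Rightarrow> complex) \<Rightarrow> bool" where
  "unit_encoder K n M E \<longleftrightarrow> (\<forall>w\<in>msg_set K M. \<forall>i<K. \<forall>t<n. cmod (E w i t) \<le> 1)"

lemma unit_encoder_energy_le:
  assumes "unit_encoder K n M E" "w \<in> msg_set K M" "i < K"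
  shows "(\<Sum>t<n. (cmod (E w i t))\<^sup>2) \<le> real n"
proof -
  have "(\<Sum>t<n. (cmod (E w i t))\<^sup>2) \<le> (\<Sum>t<n. 1)"
    using assms by (intro sum_mono) (auto simp: unit_encoder_def power_le_one)
  then show ?thesis by simp
qed

lemma (in fading_law) achievable_of_separated:
  assumes R: "\<And>k. k < K \<Longrightarrow> R k \<ge> 0"
    and code: "\<And>n. n \<ge> 1 \<Longrightarrow> \<exists>M E. (\<forall>k<K. 2 powr (real n * R k) \<le> real (M k)) \<and> unit_encoder K n M E \<and>
      (\<not> is_bc \<longrightarrow> own_message_encoder K M E) \<and> fading_block.separated_encoder K dmin dmax n \<alpha> P M E"
  shows "achievable is_bc K \<alpha> G P R"
proof -
  have "\<exists>N. \<forall>n\<ge>N. \<exists>M E dec. (\<forall>k<K. 2 powr (real n * R k) \<le> real (M k)) \<and>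
      (\<forall>w\<in>msg_set K M. \<forall>i<K. (\<Sum>t<n. (cmod (E w i t))\<^sup>2) \<le> real n) \<and>
      (\<not> is_bc \<longrightarrow> own_message_encoder K M E) \<and> ennreal (1 - \<epsilon>) \<le> success_prob K \<alpha> P G n M E dec"
    if \<epsilon>: "\<epsilon> > 0" for \<epsilon> :: real
  proof -
    have "exp (2 :: real) \<ge> 1 + 2" by (rule exp_ge_add_one_self)
    then have "2 * exp (- 2 :: real) < 1" by (simp add: exp_minus divide_simps)
    then have "(\<lambda>n. real K * (2 * exp (- 2)) ^ n) \<longlonglongrightarrow> real K * 0"
      by (intro tendsto_intros LIMSEQ_realpow_zero) auto
    then have "\<forall>\<^sub>F n in sequentially. real K * (2 * exp (- 2)) ^ n < \<epsilon>"
      using \<epsilon> by (simp add: order_tendstoD(2))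
    then obtain N where N: "\<And>n. n \<ge> N \<Longrightarrow> real K * (2 * exp (- 2)) ^ n < \<epsilon>"
      unfolding eventually_sequentially by blast
    show ?thesis
    proof (intro exI[of _ "max N 1"] allI impI)
      fix n assume n: "n \<ge> max N 1"
      interpret fading_block K fmax dmin dmax G n ..
      obtain M E where size: "\<forall>k<K. 2 powr (real n * R k) \<le> real (M k)" and unit: "unit_encoder K n M E"
        and own: "\<not> is_bc \<longrightarrow> own_message_encoder K M E" and sep: "separated_encoder \<alpha> P M E"
        using code[of n] n by auto
      have "M k \<ge> 1" if "k < K" for k
        using size[rule_format, OF that] powr_gt_zero[of 2 "real n * R k"] by linarith
      note success_prob_separated_ge[OF sep this]
      moreover have "ennreal (1 - \<epsilon>) \<le> ennreal (1 - real K * (2 * exp (- 2)) ^ n)"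
        using N[of n] n by (intro ennreal_leI) simp
      ultimately have "ennreal (1 - \<epsilon>) \<le> success_prob K \<alpha> P G n M E (distance_decoder \<alpha> P M E)"
        by (rule order_trans[rotated])
      then show "\<exists>M E dec. (\<forall>k<K. 2 powr (real n * R k) \<le> real (M k)) \<and>
          (\<forall>w\<in>msg_set K M. \<forall>i<K. (\<Sum>t<n. (cmod (E w i t))\<^sup>2) \<le> real n) \<and>
          (\<not> is_bc \<longrightarrow> own_message_encoder K M E) \<and> ennreal (1 - \<epsilon>) \<le> success_prob K \<alpha> P G n M E dec"
        using size unit_encoder_energy_le[OF unit] own by blast
    qed
  qed
  then show ?thesis using R by (simp add: achievable_def own_message_encoder_def)
qed

definition gdof_rate :: "real \<Rightarrow> real \<Rightarrow> real \<Rightarrow> real" where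
  "gdof_rate B d P = max 0 (d * log 2 P - log 2 B)"

lemma gdof_rate_nonneg: "gdof_rate B d P \<ge> 0"
  by (simp add: gdof_rate_def)

lemma tendsto_gdof_rate:
  assumes "d \<ge> 0"
  shows "((\<lambda>P. gdof_rate B d P / log 2 P) \<longlongrightarrow> d) at_top"
proof -
  have "((\<lambda>P. log 2 B / log 2 P) \<longlongrightarrow> 0) at_top" by real_asymp
  then have "((\<lambda>P. max 0 (d - log 2 B / log 2 P)) \<longlongrightarrow> max 0 (d - 0)) at_top"
    by (intro tendsto_intros)
  moreover have "\<forall>\<^sub>F P in at_top. max 0 (d - log 2 B / log 2 P) = gdof_rate B d P / log 2 P"
    using eventually_gt_at_top[of 1]
  proof eventually_elim
    case (elim P)
    then have "log 2 P > 0" by simp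
    then show ?case by (simp add: gdof_rate_def max_def divide_simps)
  qed
  ultimately show ?thesis using assms by (auto elim: Lim_transform_eventually)
qed

lemma powr_gdof_rate:
  assumes "P > 1" "B > 0" and pos: "gdof_rate B d P > 0"
  shows "2 powr gdof_rate B d P = P powr d / B"
proof -
  have "gdof_rate B d P = d * log 2 P - log 2 B" using pos by (simp add: gdof_rate_def)
  moreover have "2 powr (d * log 2 P) = P powr d" using assms by (simp add: powr_def log_def)
  ultimately show ?thesis using assms by (simp add: powr_diff)
qed

lemma good_code_separation:
  assumes code: "good_code n (gdof_rate B d P) code L" and uv: "u < L" "v < L" "u \<noteq> v"
    and P: "P > 1" and B: "B > 0" and n: "n \<ge> 1" and Z: "Z \<ge> 1" and \<eta>: "\<eta> \<ge> 0"
    and H: "\<And>t. t < n \<Longrightarrow> \<eta> \<le> cmod (H t)" and q: "\<And>t. t < n \<Longrightarrow> cmod (q t) \<le> Q * Z"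
    and gap: "196 * (17 + Q\<^sup>2) * Z\<^sup>2 * P powr d \<le> B * \<eta>\<^sup>2"
  shows "16 * real n < (\<Sum>t<n. (cmod (H t * (code u t - code v t) + q t))\<^sup>2)"
proof -
  define \<Delta> where "\<Delta> t = code u t - code v t" for t
  let ?X = "\<Sum>t<n. (cmod (H t * \<Delta> t + q t))\<^sup>2"
  have rate: "gdof_rate B d P > 0" and far: "real n / (98 * 2 powr gdof_rate B d P) \<le> (\<Sum>t<n. (cmod (\<Delta> t))\<^sup>2)"
    using code uv by (auto simp: good_code_def \<Delta>_def)
  have "2 * (17 + Q\<^sup>2) * Z\<^sup>2 * real n = (196 * (17 + Q\<^sup>2) * Z\<^sup>2 * P powr d) * (real n / (98 * P powr d))"
    using P by simp
  also have "\<dots> \<le> (B * \<eta>\<^sup>2) * (real n / (98 * P powr d))"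
    using gap by (intro mult_right_mono) auto
  also have "\<dots> = \<eta>\<^sup>2 * (real n / (98 * 2 powr gdof_rate B d P))"
    using B by (simp add: powr_gdof_rate[OF P B rate])
  also have "\<dots> \<le> \<eta>\<^sup>2 * (\<Sum>t<n. (cmod (\<Delta> t))\<^sup>2)"
    using far by (intro mult_left_mono) auto
  also have "\<dots> \<le> (\<Sum>t<n. (cmod ((H t * \<Delta> t + q t) + - q t))\<^sup>2)"
    using H \<eta> unfolding sum_distrib_left
    by (intro sum_mono) (auto simp: norm_mult power_mult_distrib intro!: mult_right_mono power_mono)
  also have "\<dots> \<le> 2 * ?X + 2 * (\<Sum>t<n. (cmod (- q t))\<^sup>2)"
    by (rule sum_norm_add_square_le)
  also have "\<dots> \<le> 2 * ?X + 2 * (\<Sum>t<n. (Q * Z)\<^sup>2)"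
    using q by (intro add_mono mult_left_mono sum_mono power_mono) auto
  finally have "17 * Z\<^sup>2 * real n \<le> ?X"
    by (simp add: power_mult_distrib algebra_simps)
  moreover have "17 * 1 * real n \<le> 17 * Z\<^sup>2 * real n"
    using Z by (intro mult_right_mono mult_left_mono) auto
  ultimately show ?thesis using n unfolding \<Delta>_def by linarith
qed

lemma (in fading_block) scaled_gain_bounds:
  assumes "bounded_gains k g" "t < n" "i < K"
  shows "dmin * sqrt P powr a \<le> cmod (complex_of_real (sqrt P powr a) * g t k i)"
    and "cmod (complex_of_real (sqrt P powr a) * g t k i) \<le> dmax * sqrt P powr a"
  using assms
  by (auto simp: bounded_gains_def norm_mult mult.commute[of "sqrt P powr a"] intro!: mult_right_mono)

subsection \<open>Treating interference as noise\<close>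

definition tin_encoder ::
  "real \<Rightarrow> (nat \<Rightarrow> nat \<Rightarrow> real) \<Rightarrow> nat set \<Rightarrow> (nat \<Rightarrow> real) \<Rightarrow> (nat \<Rightarrow> nat \<Rightarrow> nat \<Rightarrow> complex) \<Rightarrow>
    (nat \<Rightarrow> nat) \<Rightarrow> nat \<Rightarrow> nat \<Rightarrow> complex" where
  "tin_encoder P \<alpha> S u code w i t =
    (if i \<in> S then complex_of_real (sqrt P powr (u i - \<alpha> i i)) * code i (w i) t else 0)"

lemma own_message_tin_encoder: "own_message_encoder K M (tin_encoder P \<alpha> S u code)"
  by (auto simp: own_message_encoder_def tin_encoder_def fun_eq_iff)

lemma unit_tin_encoder:
  assumes P: "P > 1" and u: "\<And>i. i \<in> S \<Longrightarrow> u i \<le> \<alpha> i i" and code: "\<And>i. good_code n (R i) (code i) (M i)"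
  shows "unit_encoder K n M (tin_encoder P \<alpha> S u code)"
  unfolding unit_encoder_def
proof (intro ballI allI impI)
  fix w i t assume "w \<in> msg_set K M" "i < K" "t < n"
  then have "cmod (code i (w i) t) \<le> 1"
    using code[of i] by (auto simp: good_code_def msg_set_def)
  moreover have "sqrt P powr (u i - \<alpha> i i) \<le> 1" if "i \<in> S"
    using u[OF that] P powr_mono[of "u i - \<alpha> i i" 0 "sqrt P"] by simp
  ultimately show "cmod (tin_encoder P \<alpha> S u code w i t) \<le> 1"
    by (auto simp: tin_encoder_def norm_mult intro!: mult_le_one)
qed

lemma (in fading_block) tin_interference_le:
  assumes P: "P > 1" and g: "bounded_gains k g" and t: "t < n" and w: "w \<in> msg_set K M" "w' \<in> msg_set K M"
    and code: "\<And>i. good_code n (R i) (code i) (M i)"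
    and \<gamma>: "\<And>i. i \<in> S \<Longrightarrow> i \<noteq> k \<Longrightarrow> \<alpha> k i + (u i - \<alpha> i i) \<le> \<gamma>"
  shows "cmod (\<Sum>i\<in>{..<K} - {k}. complex_of_real (sqrt P powr \<alpha> k i) * g t k i *
    (tin_encoder P \<alpha> S u code w i t - tin_encoder P \<alpha> S u code w' i t)) \<le> 2 * real K * dmax * sqrt P powr \<gamma>"
proof -
  let ?E = "tin_encoder P \<alpha> S u code"
  have "cmod (complex_of_real (sqrt P powr \<alpha> k i) * g t k i * (?E w i t - ?E w' i t))
      \<le> 2 * dmax * sqrt P powr \<gamma>"
    if i: "i < K" "i \<noteq> k" for i
  proof (cases "i \<in> S")
    case True
    have "complex_of_real (sqrt P powr \<alpha> k i) * g t k i * (?E w i t - ?E w' i t)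
        = complex_of_real (sqrt P powr (\<alpha> k i + (u i - \<alpha> i i))) * g t k i * (code i (w i) t - code i (w' i) t)"
      by (simp only: tin_encoder_def if_P[OF True] powr_add of_real_mult right_diff_distrib mult_ac)
    also have "cmod \<dots> \<le> (dmax * sqrt P powr (\<alpha> k i + (u i - \<alpha> i i))) * 2"
      unfolding norm_mult[of _ "code i (w i) t - code i (w' i) t"] using g t i w dmax_pos
      by (intro mult_mono scaled_gain_bounds good_code_diff_le[OF code]) (auto simp: msg_set_def)
    also have "\<dots> \<le> (dmax * sqrt P powr \<gamma>) * 2"
      using \<gamma>[OF True i(2)] P dmax_pos by (intro mult_right_mono mult_left_mono powr_mono) auto
    finally show ?thesis by (simp add: mult_ac)
  next
    case False
    then show ?thesis using dmax_pos by (simp add: tin_encoder_def)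
  qed
  then have "cmod (\<Sum>i\<in>{..<K} - {k}. complex_of_real (sqrt P powr \<alpha> k i) * g t k i * (?E w i t - ?E w' i t))
      \<le> (\<Sum>i\<in>{..<K} - {k}. 2 * dmax * sqrt P powr \<gamma>)"
    by (intro sum_norm_le) auto
  also have "\<dots> \<le> (\<Sum>i<K. 2 * dmax * sqrt P powr \<gamma>)"
    using dmax_pos by (intro sum_mono2) auto
  finally show ?thesis by (simp add: mult_ac)
qed

lemma tin_received_diff:
  assumes k: "k < K" "k \<in> S"
  shows "(\<Sum>i<K. complex_of_real (sqrt P powr \<alpha> k i) * h i *
      (tin_encoder P \<alpha> S u code w i t - tin_encoder P \<alpha> S u code w' i t))
    = complex_of_real (sqrt P powr u k) * h k * (code k (w k) t - code k (w' k) t)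
      + (\<Sum>i\<in>{..<K} - {k}. complex_of_real (sqrt P powr \<alpha> k i) * h i *
          (tin_encoder P \<alpha> S u code w i t - tin_encoder P \<alpha> S u code w' i t))"
proof -
  have "sqrt P powr u k = sqrt P powr \<alpha> k k * sqrt P powr (u k - \<alpha> k k)"
    by (simp only: powr_add[symmetric] add_diff_cancel_left' diff_add_cancel add.commute[of "\<alpha> k k"])
  then have "complex_of_real (sqrt P powr \<alpha> k k) *
      h k * (tin_encoder P \<alpha> S u code w k t - tin_encoder P \<alpha> S u code w' k t)
      = complex_of_real (sqrt P powr u k) * h k * (code k (w k) t - code k (w' k) t)"
    by (simp only: tin_encoder_def if_P[OF k(2)] of_real_mult right_diff_distrib mult_ac)
  then show ?thesis using k(1) by (simp add: sum.remove[of "{..<K}" k])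
qed

lemma (in fading_block) separated_tin_encoder:
  assumes P: "P > 1" and n: "n \<ge> 1"
    and B: "B > 0" "196 * (17 + (2 * real K * dmax)\<^sup>2) \<le> B * dmin\<^sup>2"
    and u: "\<And>i. i \<in> S \<Longrightarrow> d i \<le> u i"
      "\<And>i j. i \<in> S \<Longrightarrow> j \<in> S \<Longrightarrow> i \<noteq> j \<Longrightarrow> u i - (\<alpha> i i - \<alpha> j i) \<le> u j - d j"
    and code: "\<And>i. good_code n (if i \<in> S then gdof_rate B (d i) P else 0) (code i) (M i)"
  shows "separated_encoder \<alpha> P M (tin_encoder P \<alpha> S u code)"
  unfolding separated_encoder_def
proof (intro ballI allI impI)
  let ?E = "tin_encoder P \<alpha> S u code"
  fix w w' k g
  assume w: "w \<in> msg_set K M" "w' \<in> msg_set K M" and k: "k < K" and g: "bounded_gains k g" and neq: "w k \<noteq> w' k"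
  have w_less: "w k < M k" "w' k < M k" using w k by (auto simp: msg_set_def)
  have S: "k \<in> S" using code[of k] w_less neq by (auto simp: good_code_def split: if_splits)
  define H where "H t = complex_of_real (sqrt P powr u k) * g t k k" for t
  define q where
    "q t = (\<Sum>i\<in>{..<K} - {k}. complex_of_real (sqrt P powr \<alpha> k i) * g t k i * (?E w i t - ?E w' i t))" for t
  have "16 * real n < (\<Sum>t<n. (cmod (H t * (code k (w k) t - code k (w' k) t) + q t))\<^sup>2)"
  proof (rule good_code_separation[where Z = "sqrt P powr (u k - d k)" and Q = "2 * real K * dmax"
        and \<eta> = "dmin * sqrt P powr u k"])
    show "good_code n (gdof_rate B (d k) P) (code k) (M k)" using code[of k] S by simp
    show "sqrt P powr (u k - d k) \<ge> 1" using u(1)[OF S] P by (intro ge_one_powr_ge_zero) auto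
    show "dmin * sqrt P powr u k \<le> cmod (H t)" if "t < n" for t
      unfolding H_def by (rule scaled_gain_bounds(1)[OF g that k])
    show "cmod (q t) \<le> 2 * real K * dmax * sqrt P powr (u k - d k)" if "t < n" for t
      unfolding q_def using u(2)[OF _ S]
      by (intro tin_interference_le[OF P g that w code]) (simp add: algebra_simps)
    have "P powr (u k - d k) * P powr d k = P powr u k" by (simp add: powr_add[symmetric])
    then show "196 * (17 + (2 * real K * dmax)\<^sup>2) * (sqrt P powr (u k - d k))\<^sup>2 * P powr d k
        \<le> B * (dmin * sqrt P powr u k)\<^sup>2"
      using mult_right_mono[OF B(2), of "P powr u k"] P
      by (simp add: power_mult_distrib sqrt_powr_square mult.assoc)
  qed (use P B n w_less neq dmin_pos in auto)
  then show "16 * real n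
      < (\<Sum>t<n. (cmod (\<Sum>i<K. complex_of_real (sqrt P powr \<alpha> k i) * g t k i * (?E w i t - ?E w' i t)))\<^sup>2)"
    by (simp only: tin_received_diff[OF k S] H_def q_def)
qed

lemma tin_achievable:
  assumes adm: "admissible_channel K Gm" and S: "S \<subseteq> {..<K}"
    and d: "\<And>k. k \<notin> S \<Longrightarrow> d k = 0" "\<And>k. d k \<ge> 0"
    and u: "\<And>i. i \<in> S \<Longrightarrow> d i \<le> u i" "\<And>i. i \<in> S \<Longrightarrow> u i \<le> \<alpha> i i"
      "\<And>i j. i \<in> S \<Longrightarrow> j \<in> S \<Longrightarrow> i \<noteq> j \<Longrightarrow> u i - (\<alpha> i i - \<alpha> j i) \<le> u j - d j"
  shows "d \<in> GDoF_region False K \<alpha> Gm"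
proof -
  obtain fmax dmin dmax where law: "\<And>P. P > 1 \<Longrightarrow> fading_law K fmax dmin dmax (Gm P)"
    using admissible_channelE[OF adm] by blast
  have dmin: "dmin > 0" using law[of 2] by (simp add: fading_law_def fading_law_axioms_def)
  define B where "B = 196 * (17 + (2 * real K * dmax)\<^sup>2) / dmin\<^sup>2"
  have B: "B > 0" "196 * (17 + (2 * real K * dmax)\<^sup>2) \<le> B * dmin\<^sup>2"
    using dmin by (simp_all add: B_def add_pos_nonneg)
  define R where "R P k = (if k \<in> S then gdof_rate B (d k) P else 0)" for P k
  have "achievable False K \<alpha> (Gm P) P (R P)" if P: "P > 1" for P
  proof -
    interpret fading_law K fmax dmin dmax "Gm P" by (rule law[OF P])
    show ?thesis
    proof (rule achievable_of_separated)
      fix n :: nat assume n: "n \<ge> 1"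
      interpret fading_block K fmax dmin dmax "Gm P" n ..
      have "\<forall>k. \<exists>code L. good_code n (R P k) code L"
        by (simp add: R_def ex_good_code gdof_rate_nonneg)
      then obtain code M where code: "\<And>k. good_code n (R P k) (code k) (M k)" by metis
      have "\<forall>k<K. 2 powr (real n * R P k) \<le> real (M k)" using code by (simp add: good_code_def)
      moreover have "unit_encoder K n M (tin_encoder P \<alpha> S u code)"
        using u(2) by (intro unit_tin_encoder[OF P _ code])
      moreover have "separated_encoder \<alpha> P M (tin_encoder P \<alpha> S u code)"
        using code u(1,3) unfolding R_def by (intro separated_tin_encoder[OF P n B])
      ultimately show "\<exists>M E. (\<forall>k<K. 2 powr (real n * R P k) \<le> real (M k)) \<and> unit_encoder K n M E \<and>
          (\<not> False \<longrightarrow> own_message_encoder K M E) \<and> separated_encoder \<alpha> P M E"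
        using own_message_tin_encoder by blast
    qed (simp add: R_def gdof_rate_nonneg)
  qed
  moreover have "((\<lambda>P. R P k / log 2 P) \<longlongrightarrow> d k) at_top" for k
    using tendsto_gdof_rate[OF d(2)[of k], of B] d(1)[of k] by (cases "k \<in> S") (simp_all add: R_def)
  moreover have "\<forall>k. k \<ge> K \<longrightarrow> d k = 0" using S d(1) by fastforce
  ultimately show ?thesis unfolding GDoF_region_def by blast
qed

subsection \<open>Superposition of a common and private codewords\<close>

text \<open>The private layers are sent at the power at which other receivers hear them at noise level, and the common
  message is part of the message of user \<open>0\<close>.\<close>
locale layered_code = fading_block K fmax dmin dmax G n
  for K :: nat and fmax dmin dmax :: real and G :: "(nat \<Rightarrow> nat \<Rightarrow> nat \<Rightarrow> complex) measure" and n :: nat +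
  fixes \<alpha> :: "nat \<Rightarrow> nat \<Rightarrow> real" and \<beta> B P :: real
    and common_code private_code :: "nat \<Rightarrow> nat \<Rightarrow> complex" and Lc Lp :: nat
  assumes K_pos: "K \<ge> 1" and n_pos: "n \<ge> 1" and P: "P > 1" and \<beta>: "0 < \<beta>" "\<beta> \<le> 1"
    and direct: "\<And>k. k < K \<Longrightarrow> \<alpha> k k = 1"
    and cross: "\<And>k i. k < K \<Longrightarrow> i < K \<Longrightarrow> i \<noteq> k \<Longrightarrow> \<alpha> k i \<le> 1 - \<beta>"
    and B_ge: "3136 * (17 + (real K * dmax)\<^sup>2) \<le> B * dmin\<^sup>2" "(2 * (real K * dmax) / dmin) powr (2 / \<beta>) \<le> B"
    and good_common: "good_code n (gdof_rate B (1 - \<beta>) P) common_code Lc"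
    and good_private: "good_code n (gdof_rate B \<beta> P) private_code Lp"
begin

definition size :: "nat \<Rightarrow> nat" where
  "size k = (if k = 0 then Lc * Lp else Lp)"

definition common_part :: "(nat \<Rightarrow> nat) \<Rightarrow> nat" where
  "common_part w = w 0 div Lp"

definition private_part :: "(nat \<Rightarrow> nat) \<Rightarrow> nat \<Rightarrow> nat" where
  "private_part w i = (if i = 0 then w 0 mod Lp else w i)"

definition private_amplitude :: real where
  "private_amplitude = sqrt P powr (\<beta> - 1)"

definition encoder :: "(nat \<Rightarrow> nat) \<Rightarrow> nat \<Rightarrow> nat \<Rightarrow> complex" where
  "encoder w i t = (common_code (common_part w) t +
    complex_of_real private_amplitude * private_code (private_part w i) t) / 2"

lemma B_pos: "B > 0"
proof -
  have "0 < 3136 * (17 + (real K * dmax)\<^sup>2)" by (simp add: add_pos_nonneg)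
  with B_ge(1) have "0 < B * dmin\<^sup>2" by linarith
  then show ?thesis by (simp add: zero_less_mult_iff)
qed

lemma common_part_less: "w \<in> msg_set K size \<Longrightarrow> common_part w < Lc"
  using K_pos by (auto simp: common_part_def msg_set_def size_def less_mult_imp_div_less dest!: PiE_mem[of _ _ _ 0])

lemma private_part_less: "w \<in> msg_set K size \<Longrightarrow> i < K \<Longrightarrow> private_part w i < Lp"
  using good_code_size_pos[OF good_private]
  by (auto simp: private_part_def msg_set_def size_def dest!: PiE_mem[of _ _ _ i])

lemma message_eq_iff: "w k = w' k" if "common_part w = common_part w'" "private_part w k = private_part w' k"
  using that div_mod_decomp[of "w 0" Lp] div_mod_decomp[of "w' 0" Lp]
  by (auto simp: common_part_def private_part_def split: if_splits)

lemma unit_encoder_encoder: "unit_encoder K n size encoder"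
  unfolding unit_encoder_def
proof (intro ballI allI impI)
  fix w i t assume w: "w \<in> msg_set K size" and i: "i < K" and t: "t < n"
  have code: "cmod (common_code (common_part w) t) \<le> 1" "cmod (private_code (private_part w i) t) \<le> 1"
    using good_common good_private common_part_less[OF w] private_part_less[OF w i] t
    by (simp_all add: good_code_def)
  have "private_amplitude \<le> 1"
    unfolding private_amplitude_def using P \<beta> powr_mono[of "\<beta> - 1" 0 "sqrt P"] by simp
  then have "cmod (complex_of_real private_amplitude * private_code (private_part w i) t) \<le> 1"
    using code(2) unfolding norm_mult norm_of_real by (intro mult_le_one) (auto simp: private_amplitude_def)
  then show "cmod (encoder w i t) \<le> 1"
    using code(1) norm_triangle_ineq[of "common_code (common_part w) t"
      "complex_of_real private_amplitude * private_code (private_part w i) t"]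
    by (simp add: encoder_def norm_divide)
qed

definition channel :: "nat \<Rightarrow> (nat \<Rightarrow> nat \<Rightarrow> nat \<Rightarrow> complex) \<Rightarrow> nat \<Rightarrow> nat \<Rightarrow> complex" where
  "channel k g t i = complex_of_real (sqrt P powr \<alpha> k i) * g t k i"

definition private_diff :: "(nat \<Rightarrow> nat) \<Rightarrow> (nat \<Rightarrow> nat) \<Rightarrow> nat \<Rightarrow> nat \<Rightarrow> complex" where
  "private_diff w w' i t = complex_of_real (private_amplitude / 2) *
    (private_code (private_part w i) t - private_code (private_part w' i) t)"

lemma received_diff:
  "(\<Sum>i<K. channel k g t i * (encoder w i t - encoder w' i t)) =
    (\<Sum>i<K. channel k g t i) / 2 * (common_code (common_part w) t - common_code (common_part w') t) +
    (\<Sum>i<K. channel k g t i * private_diff w w' i t)"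
proof -
  have "encoder w i t - encoder w' i t =
      (common_code (common_part w) t - common_code (common_part w') t) / 2 + private_diff w w' i t" for i
    by (simp add: encoder_def private_diff_def diff_divide_distrib add_divide_distrib right_diff_distrib)
  then show ?thesis
    by (simp add: distrib_left sum.distrib sum_distrib_right sum_divide_distrib)
qed

lemma private_interference_le:
  assumes g: "bounded_gains k g" and t: "t < n"
    and w: "w \<in> msg_set K size" "w' \<in> msg_set K size"
    and I: "I \<subseteq> {..<K}" and \<gamma>: "\<And>i. i \<in> I \<Longrightarrow> \<alpha> k i + (\<beta> - 1) \<le> \<gamma>"
  shows "cmod (\<Sum>i\<in>I. channel k g t i * private_diff w w' i t) \<le> real K * dmax * sqrt P powr \<gamma>"
proof -
  have "cmod (channel k g t i * private_diff w w' i t) \<le> dmax * sqrt P powr \<gamma>" if i: "i \<in> I" for i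
  proof -
    have "i < K" using i I by blast
    then have "cmod (private_code (private_part w i) t - private_code (private_part w' i) t) \<le> 2"
      using w by (intro good_code_diff_le[OF good_private _ _ t] private_part_less)
    then have "cmod (private_diff w w' i t) \<le> private_amplitude"
      by (simp add: private_diff_def private_amplitude_def norm_mult mult_left_mono)
    moreover have "cmod (channel k g t i) \<le> dmax * sqrt P powr \<alpha> k i"
      unfolding channel_def by (rule scaled_gain_bounds(2)[OF g t \<open>i < K\<close>])
    ultimately have "cmod (channel k g t i * private_diff w w' i t)
        \<le> (dmax * sqrt P powr \<alpha> k i) * private_amplitude"
      unfolding norm_mult using dmax_pos by (intro mult_mono) auto
    also have "\<dots> = dmax * sqrt P powr (\<alpha> k i + (\<beta> - 1))"
      by (simp only: private_amplitude_def powr_add mult.assoc)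
    also have "\<dots> \<le> dmax * sqrt P powr \<gamma>"
      using \<gamma>[OF i] P dmax_pos by (intro mult_left_mono powr_mono) auto
    finally show ?thesis .
  qed
  then have "cmod (\<Sum>i\<in>I. channel k g t i * private_diff w w' i t) \<le> (\<Sum>i\<in>I. dmax * sqrt P powr \<gamma>)"
    by (rule sum_norm_le)
  also have "\<dots> \<le> (\<Sum>i<K. dmax * sqrt P powr \<gamma>)"
    using I dmax_pos by (intro sum_mono2) auto
  finally show ?thesis by simp
qed

lemma cross_gain_le:
  assumes rate: "gdof_rate B (1 - \<beta>) P > 0"
  shows "real K * dmax * sqrt P powr (1 - \<beta>) \<le> dmin * sqrt P / 2"
proof -
  let ?r = "2 * (real K * dmax) / dmin"
  have "log 2 B < (1 - \<beta>) * log 2 P" using rate by (simp add: gdof_rate_def)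
  also have "\<dots> \<le> 1 * log 2 P" using \<beta> P by (intro mult_right_mono) auto
  finally have "B < P" using B_pos P by simp
  then have "?r powr (2 / \<beta>) \<le> P" using B_ge(2) by simp
  then have "(?r powr (2 / \<beta>)) powr (\<beta> / 2) \<le> P powr (\<beta> / 2)"
    using \<beta> by (intro powr_mono2) auto
  moreover have "(?r powr (2 / \<beta>)) powr (\<beta> / 2) = ?r"
    using \<beta> dmax_pos dmin_pos by (simp add: powr_powr)
  moreover have "P powr (\<beta> / 2) = sqrt P powr \<beta>"
    using P by (simp add: powr_half_sqrt[symmetric] powr_powr)
  ultimately have "?r \<le> sqrt P powr \<beta>" by simp
  then have "2 * (real K * dmax) \<le> dmin * sqrt P powr \<beta>"
    using dmin_pos by (simp add: field_simps)
  then have "2 * (real K * dmax) * sqrt P powr (1 - \<beta>) \<le> dmin * sqrt P powr \<beta> * sqrt P powr (1 - \<beta>)"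
    by (intro mult_right_mono) auto
  also have "\<dots> = dmin * sqrt P" using P by (simp add: mult.assoc powr_add[symmetric])
  finally show ?thesis by simp
qed

lemma common_gain_ge:
  assumes rate: "gdof_rate B (1 - \<beta>) P > 0" and g: "bounded_gains k g" and t: "t < n" and k: "k < K"
  shows "dmin * sqrt P / 2 \<le> cmod (\<Sum>i<K. channel k g t i)"
proof -
  let ?cross = "\<Sum>i\<in>{..<K} - {k}. channel k g t i"
  have "cmod ?cross \<le> (\<Sum>i\<in>{..<K} - {k}. dmax * sqrt P powr (1 - \<beta>))"
  proof (rule sum_norm_le)
    fix i assume i: "i \<in> {..<K} - {k}"
    then have "cmod (channel k g t i) \<le> dmax * sqrt P powr \<alpha> k i"
      unfolding channel_def by (intro scaled_gain_bounds[OF g t]) simp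
    also have "\<dots> \<le> dmax * sqrt P powr (1 - \<beta>)"
      using i k cross P dmax_pos by (intro mult_left_mono powr_mono) auto
    finally show "cmod (channel k g t i) \<le> dmax * sqrt P powr (1 - \<beta>)" .
  qed
  also have "\<dots> \<le> (\<Sum>i<K. dmax * sqrt P powr (1 - \<beta>))"
    using dmax_pos by (intro sum_mono2) auto
  finally have "cmod ?cross \<le> dmin * sqrt P / 2"
    using cross_gain_le[OF rate] by simp
  moreover have "dmin * sqrt P \<le> cmod (channel k g t k)"
    using scaled_gain_bounds(1)[OF g t k, of "P" 1] k direct P by (simp add: channel_def)
  moreover have "(\<Sum>i<K. channel k g t i) = channel k g t k + ?cross"
    using k by (intro sum.remove) auto
  ultimately show ?thesis
    using norm_diff_ineq[of "channel k g t k" ?cross] by simp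
qed

lemma common_separation:
  assumes g: "bounded_gains k g" and k: "k < K" and w: "w \<in> msg_set K size" "w' \<in> msg_set K size"
    and neq: "common_part w \<noteq> common_part w'"
  shows "16 * real n < (\<Sum>t<n. (cmod (\<Sum>i<K. channel k g t i * (encoder w i t - encoder w' i t)))\<^sup>2)"
  unfolding received_diff
proof (rule good_code_separation[OF good_common _ _ neq P B_pos n_pos,
      where Z = "sqrt P powr \<beta>" and Q = "real K * dmax" and \<eta> = "dmin * sqrt P / 4"])
  have rate: "gdof_rate B (1 - \<beta>) P > 0"
    using good_common common_part_less[OF w(1)] common_part_less[OF w(2)] neq by (auto simp: good_code_def)
  show "dmin * sqrt P / 4 \<le> cmod ((\<Sum>i<K. channel k g t i) / 2)" if "t < n" for t
    using common_gain_ge[OF rate g that k] by (simp add: norm_divide)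
  show "cmod (\<Sum>i<K. channel k g t i * private_diff w w' i t) \<le> real K * dmax * sqrt P powr \<beta>" if t: "t < n"
    for t
  proof (rule private_interference_le[OF g t w order_refl])
    fix i assume "i \<in> {..<K}"
    then show "\<alpha> k i + (\<beta> - 1) \<le> \<beta>" using direct[OF k] cross[OF k] \<beta> by (cases "i = k") fastforce+
  qed
  have "P powr \<beta> * P powr (1 - \<beta>) = P" using P by (simp add: powr_add[symmetric])
  then show "196 * (17 + (real K * dmax)\<^sup>2) * (sqrt P powr \<beta>)\<^sup>2 * P powr (1 - \<beta>) \<le> B * (dmin * sqrt P / 4)\<^sup>2"
    using mult_right_mono[OF B_ge(1), of P] P
    by (simp add: sqrt_powr_square power_mult_distrib power_divide mult.assoc)
qed (use P \<beta> dmin_pos common_part_less w in \<open>auto intro: ge_one_powr_ge_zero\<close>)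

lemma private_separation:
  assumes g: "bounded_gains k g" and k: "k < K" and w: "w \<in> msg_set K size" "w' \<in> msg_set K size"
    and common: "common_part w = common_part w'" and neq: "private_part w k \<noteq> private_part w' k"
  shows "16 * real n < (\<Sum>t<n. (cmod (\<Sum>i<K. channel k g t i * (encoder w i t - encoder w' i t)))\<^sup>2)"
proof -
  define H where "H t = channel k g t k * complex_of_real (private_amplitude / 2)" for t
  define q where "q t = (\<Sum>i\<in>{..<K} - {k}. channel k g t i * private_diff w w' i t)" for t
  have split: "(\<Sum>i<K. channel k g t i * (encoder w i t - encoder w' i t))
      = H t * (private_code (private_part w k) t - private_code (private_part w' k) t) + q t" for t
    unfolding received_diff common
    using k by (simp add: sum.remove[of "{..<K}" k] q_def H_def private_diff_def)
  show ?thesis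
    unfolding split
  proof (rule good_code_separation[OF good_private _ _ neq P B_pos n_pos order_refl,
        where Q = "real K * dmax" and \<eta> = "dmin * sqrt P powr \<beta> / 2"])
    fix t assume t: "t < n"
    have "dmin * sqrt P powr \<beta> / 2 = (dmin * sqrt P powr 1) * (private_amplitude / 2)"
      by (simp add: private_amplitude_def powr_diff P)
    also have "\<dots> \<le> cmod (channel k g t k) * (private_amplitude / 2)"
      using scaled_gain_bounds(1)[OF g t k, of P 1] direct[OF k]
      by (intro mult_right_mono) (auto simp: channel_def private_amplitude_def)
    also have "\<dots> = cmod (H t)" by (simp add: H_def norm_mult private_amplitude_def)
    finally show "dmin * sqrt P powr \<beta> / 2 \<le> cmod (H t)" .
    have "cmod (q t) \<le> real K * dmax * sqrt P powr 0"
      unfolding q_def using cross[OF k]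
      by (intro private_interference_le[OF g t w]) (auto simp: algebra_simps)
    then show "cmod (q t) \<le> real K * dmax * 1" using P by simp
  next
    have "784 * (17 + (real K * dmax)\<^sup>2) \<le> B * dmin\<^sup>2"
      using B_ge(1) by (smt (verit) zero_le_power2)
    then show "196 * (17 + (real K * dmax)\<^sup>2) * 1\<^sup>2 * P powr \<beta> \<le> B * (dmin * sqrt P powr \<beta> / 2)\<^sup>2"
      using mult_right_mono[of _ _ "P powr \<beta>"] P
      by (fastforce simp: sqrt_powr_square power_mult_distrib power_divide)
  qed (use dmin_pos private_part_less w k in auto)
qed

lemma separated_encoder_encoder: "separated_encoder \<alpha> P size encoder"
  unfolding separated_encoder_def channel_def[symmetric]
  using common_separation private_separation message_eq_iff by blast

end

lemma common_private_achievable: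
  assumes K: "K \<ge> 1" and adm: "admissible_channel K Gm" and \<beta>: "0 < \<beta>" "\<beta> \<le> 1"
    and direct: "\<And>k. k < K \<Longrightarrow> \<alpha> k k = 1"
    and cross: "\<And>k i. k < K \<Longrightarrow> i < K \<Longrightarrow> i \<noteq> k \<Longrightarrow> \<alpha> k i \<le> 1 - \<beta>"
  shows "(\<lambda>k. if k < K then (if k = 0 then 1 else \<beta>) else 0) \<in> GDoF_region True K \<alpha> Gm"
proof -
  obtain fmax dmin dmax where law: "\<And>P. P > 1 \<Longrightarrow> fading_law K fmax dmin dmax (Gm P)"
    using admissible_channelE[OF adm] by blast
  have dmin: "dmin > 0" using law[of 2] by (simp add: fading_law_def fading_law_axioms_def)
  define B where
    "B = max (3136 * (17 + (real K * dmax)\<^sup>2) / dmin\<^sup>2) ((2 * (real K * dmax) / dmin) powr (2 / \<beta>))"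
  have "3136 * (17 + (real K * dmax)\<^sup>2) / dmin\<^sup>2 \<le> B" and B: "(2 * (real K * dmax) / dmin) powr (2 / \<beta>) \<le> B"
    unfolding B_def by simp_all
  then have B': "3136 * (17 + (real K * dmax)\<^sup>2) \<le> B * dmin\<^sup>2"
    using dmin by (simp only: pos_divide_le_eq zero_less_power)
  define R where "R P k = (if k = 0 then gdof_rate B (1 - \<beta>) P else 0) + gdof_rate B \<beta> P" for P and k :: nat
  have "achievable True K \<alpha> (Gm P) P (R P)" if P: "P > 1" for P
  proof -
    interpret fading_law K fmax dmin dmax "Gm P" by (rule law[OF P])
    show ?thesis
    proof (rule achievable_of_separated)
      fix n :: nat assume n: "n \<ge> 1"
      obtain cc Lc cp Lp where good_common: "good_code n (gdof_rate B (1 - \<beta>) P) cc Lc"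
        and good_private: "good_code n (gdof_rate B \<beta> P) cp Lp"
        using ex_good_code[OF gdof_rate_nonneg] by metis
      interpret layered_code K fmax dmin dmax "Gm P" n \<alpha> \<beta> B P cc cp Lc Lp
        by unfold_locales (use K n P \<beta> direct cross B B' good_common good_private in auto)
      have "2 powr (real n * R P k) \<le> real (size k)" for k
      proof -
        have "2 powr (real n * gdof_rate B (1 - \<beta>) P) \<le> real Lc" "2 powr (real n * gdof_rate B \<beta> P) \<le> real Lp"
          using good_common good_private by (simp_all add: good_code_def)
        then show ?thesis by (simp add: R_def size_def distrib_left powr_add mult_mono)
      qed
      then show "\<exists>M E. (\<forall>k<K. 2 powr (real n * R P k) \<le> real (M k)) \<and> unit_encoder K n M E \<and>
          (\<not> True \<longrightarrow> own_message_encoder K M E) \<and> separated_encoder \<alpha> P M E"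
        using unit_encoder_encoder separated_encoder_encoder by blast
    qed (simp add: R_def gdof_rate_nonneg)
  qed
  moreover have "((\<lambda>P. R P k / log 2 P) \<longlongrightarrow> (if k = 0 then 1 else \<beta>)) at_top" for k
    using tendsto_add[OF tendsto_gdof_rate[of "1 - \<beta>" B] tendsto_gdof_rate[of \<beta> B]] tendsto_gdof_rate[of \<beta> B] \<beta>
    by (simp add: R_def add_divide_distrib)
  ultimately show ?thesis
    unfolding GDoF_region_def by (intro CollectI conjI exI[of _ R] allI impI) simp_all
qed

subsection \<open>Weighted paths and cycles\<close>

fun path_weight :: "('v \<Rightarrow> 'v \<Rightarrow> 'a :: comm_monoid_add) \<Rightarrow> 'v list \<Rightarrow> 'a" where
  "path_weight w (x # y # zs) = w x y + path_weight w (y # zs)"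
| "path_weight w _ = 0"

definition cycle_weight :: "('v \<Rightarrow> 'v \<Rightarrow> 'a :: comm_monoid_add) \<Rightarrow> 'v list \<Rightarrow> 'a" where
  "cycle_weight w xs = path_weight w xs + w (last xs) (hd xs)"

lemma path_weight_Cons: "xs \<noteq> [] \<Longrightarrow> path_weight w (x # xs) = w x (hd xs) + path_weight w xs"
  by (cases xs) auto

lemma path_weight_append: "path_weight w (as @ i # bs) = path_weight w (as @ [i]) + path_weight w (i # bs)"
proof (induction as)
  case (Cons x as)
  then show ?case by (cases as) (auto simp: add.assoc)
qed simp

lemma path_weight_snoc: "xs \<noteq> [] \<Longrightarrow> path_weight w (xs @ [x]) = path_weight w xs + w (last xs) x"
  using path_weight_append[of w "butlast xs" "last xs" "[x]"] append_butlast_last_id[of xs]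
  by (metis append_Cons append_Nil append_assoc path_weight.simps(1,3) add.right_neutral)

lemma path_weight_rev: "path_weight w (rev xs) = path_weight (\<lambda>x y. w y x) xs"
proof (induction xs)
  case (Cons x xs)
  then show ?case
    by (cases "xs = []") (simp_all add: path_weight_snoc path_weight_Cons last_rev add.commute)
qed simp

lemma path_weight_eq_sum: "path_weight w xs = (\<Sum>m<length xs - 1. w (xs ! m) (xs ! Suc m))"
proof (induction w xs rule: path_weight.induct)
  case (1 w x y zs)
  then show ?case by (simp add: sum.lessThan_Suc_shift del: sum.lessThan_Suc)
qed auto

lemma le_path_weight:
  fixes w :: "'v \<Rightarrow> 'v \<Rightarrow> 'a :: ordered_comm_monoid_add"
  assumes triangle: "\<And>x y z. x \<in> V \<Longrightarrow> y \<in> V \<Longrightarrow> z \<in> V \<Longrightarrow> w x z \<le> w x y + w y z" and refl: "\<And>x. x \<in> V \<Longrightarrow> w x x \<le> 0"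
    and xs: "xs \<noteq> []" "set xs \<subseteq> V"
  shows "w (hd xs) (last xs) \<le> path_weight w xs"
  using xs
proof (induction xs rule: list_nonempty_induct)
  case (cons x xs)
  then have "w x (last xs) \<le> w x (hd xs) + w (hd xs) (last xs)"
    using last_in_set[of xs] by (intro triangle) auto
  also have "\<dots> \<le> w x (hd xs) + path_weight w xs"
    using cons by (intro add_left_mono) auto
  finally show ?case using cons by (simp add: path_weight_Cons)
qed (use refl in simp)

lemma cycle_weight_rotate1: "cycle_weight w (rotate1 xs) = cycle_weight w xs"
proof (cases xs)
  case (Cons x ys)
  then show ?thesis
    by (cases "ys = []") (simp_all add: cycle_weight_def path_weight_snoc path_weight_Cons add_ac)
qed simp

lemma cycle_weight_rotate: "cycle_weight w (rotate m xs) = cycle_weight w xs"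
  by (induction m) (simp_all add: cycle_weight_rotate1)

lemma cycle_weight_eq_sum:
  assumes "xs \<noteq> []"
  shows "cycle_weight w xs = (\<Sum>m<length xs. w (xs ! m) (xs ! ((m + 1) mod length xs)))"
proof -
  obtain l where l: "length xs = Suc l" using assms by (cases xs) auto
  have "(\<Sum>m<length xs. w (xs ! m) (xs ! ((m + 1) mod length xs))) = path_weight w xs + w (xs ! l) (xs ! 0)"
    by (simp add: l path_weight_eq_sum)
  then show ?thesis using assms l by (simp add: cycle_weight_def last_conv_nth hd_conv_nth)
qed

lemma path_weight_diff_node:
  fixes w :: "'v \<Rightarrow> 'v \<Rightarrow> 'a :: ab_group_add"
  shows "path_weight (\<lambda>i j. w i j - d j) xs = path_weight w xs - sum_list (map d (tl xs))"
  by (induction w xs rule: path_weight.induct) (simp_all add: algebra_simps)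

lemma cycle_weight_diff_node:
  fixes w :: "'v \<Rightarrow> 'v \<Rightarrow> 'a :: ab_group_add"
  shows "xs \<noteq> [] \<Longrightarrow> cycle_weight (\<lambda>i j. w i j - d j) xs = cycle_weight w xs - sum_list (map d xs)"
  by (cases xs) (simp_all add: cycle_weight_def path_weight_diff_node)

definition simple_paths :: "'v set \<Rightarrow> 'v \<Rightarrow> 'v list set" where
  "simple_paths S i = {xs. xs \<noteq> [] \<and> distinct xs \<and> set xs \<subseteq> S \<and> hd xs = i}"

lemma finite_simple_paths: "finite S \<Longrightarrow> finite (simple_paths S i)"
  by (rule finite_subset[of _ "{xs. set xs \<subseteq> S \<and> length xs \<le> card S}"])
    (auto simp: simple_paths_def distinct_card[symmetric] intro: card_mono finite_lists_length_le)

definition path_value :: "('v \<Rightarrow> 'v \<Rightarrow> 'a) \<Rightarrow> ('v \<Rightarrow> 'a) \<Rightarrow> 'v list \<Rightarrow> 'a :: comm_monoid_add" where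
  "path_value w b xs = path_weight w xs + b (last xs)"

definition potential :: "'v set \<Rightarrow> ('v \<Rightarrow> 'v \<Rightarrow> 'a) \<Rightarrow> ('v \<Rightarrow> 'a) \<Rightarrow> 'v \<Rightarrow> 'a :: linordered_ab_group_add" where
  "potential S w b i = Min (path_value w b ` simple_paths S i)"

lemma potential_le: "finite S \<Longrightarrow> xs \<in> simple_paths S i \<Longrightarrow> potential S w b i \<le> path_value w b xs"
  unfolding potential_def by (intro Min_le finite_imageI finite_simple_paths) auto

lemma potential_le_terminal: "finite S \<Longrightarrow> i \<in> S \<Longrightarrow> potential S w b i \<le> b i"
  using potential_le[of S "[i]" i w b] by (simp add: simple_paths_def path_value_def)

lemma potential_attained:
  assumes "finite S" "i \<in> S"
  obtains xs where "xs \<in> simple_paths S i" "potential S w b i = path_value w b xs"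
proof -
  have "[i] \<in> simple_paths S i" using assms by (simp add: simple_paths_def)
  then have "potential S w b i \<in> path_value w b ` simple_paths S i"
    unfolding potential_def by (intro Min_in finite_imageI finite_simple_paths assms(1)) auto
  then show ?thesis using that by blast
qed

text \<open>If the least path from \<open>j\<close> passes through \<open>i\<close>, then the edge from \<open>i\<close> to \<open>j\<close> closes a cycle; cutting it off leaves
  a path from \<open>i\<close> of no greater value.\<close>
lemma potential_le_edge:
  assumes fin: "finite S" and ij: "i \<in> S" "j \<in> S" "i \<noteq> j"
    and cycles: "\<And>xs. distinct xs \<Longrightarrow> set xs \<subseteq> S \<Longrightarrow> length xs \<ge> 2 \<Longrightarrow> cycle_weight w xs \<ge> 0"
  shows "potential S w b i \<le> w i j + potential S w b j"
proof -
  obtain xs where "xs \<in> simple_paths S j" and u: "potential S w b j = path_value w b xs"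
    using potential_attained[OF fin ij(2)] by blast
  then have xs: "xs \<noteq> []" "distinct xs" "set xs \<subseteq> S" "hd xs = j" by (auto simp: simple_paths_def)
  show ?thesis
  proof (cases "i \<in> set xs")
    case False
    then have "i # xs \<in> simple_paths S i" using xs ij by (auto simp: simple_paths_def)
    from potential_le[OF fin this] show ?thesis
      using xs u by (simp add: path_value_def path_weight_Cons add.assoc)
  next
    case True
    then obtain as bs where split: "xs = as @ i # bs" by (meson split_list)
    then have "as \<noteq> []" using xs(4) ij(3) by auto
    then have "hd as = j" and "length (as @ [i]) \<ge> 2"
      using xs(4) split by (simp_all add: Suc_le_eq)
    moreover have "distinct (as @ [i])" "set (as @ [i]) \<subseteq> S" using xs split by auto
    ultimately have cycle: "path_weight w (as @ [i]) + w i j \<ge> 0"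
      using cycles[of "as @ [i]"] \<open>as \<noteq> []\<close> by (simp add: cycle_weight_def)
    have "i # bs \<in> simple_paths S i" using xs split by (auto simp: simple_paths_def)
    then have "potential S w b i \<le> 0 + path_value w b (i # bs)" using potential_le[OF fin] by simp
    also have "\<dots> \<le> (path_weight w (as @ [i]) + w i j) + path_value w b (i # bs)"
      using cycle by (rule add_right_mono)
    also have "\<dots> = w i j + path_value w b xs"
      by (simp only: path_value_def split path_weight_append[of w as i bs] last_append list.distinct if_False add_ac)
    finally show ?thesis by (simp only: u)
  qed
qed

subsection \<open>The CTIN regime\<close>

lemma CTIN_nonneg: "\<alpha> \<in> A_CTIN K \<Longrightarrow> i < K \<Longrightarrow> j < K \<Longrightarrow> \<alpha> i j \<ge> 0"
  by (simp add: A_CTIN_def)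

lemma CTIN_pair: "\<alpha> \<in> A_CTIN K \<Longrightarrow> i < K \<Longrightarrow> j < K \<Longrightarrow> i \<noteq> j \<Longrightarrow> \<alpha> i j + \<alpha> j i \<le> \<alpha> i i"
  unfolding A_CTIN_def by (metis (mono_tags, lifting) max.bounded_iff mem_Collect_eq)

lemma CTIN_triple:
  "\<alpha> \<in> A_CTIN K \<Longrightarrow> i < K \<Longrightarrow> j < K \<Longrightarrow> k < K \<Longrightarrow> i \<noteq> j \<Longrightarrow> i \<noteq> k \<Longrightarrow> \<alpha> i k + \<alpha> j i - \<alpha> j k \<le> \<alpha> i i"
  unfolding A_CTIN_def by (metis (mono_tags, lifting) max.bounded_iff mem_Collect_eq)

lemma CTIN_row_le:
  assumes "\<alpha> \<in> A_CTIN K" "i < K" "j < K"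
  shows "\<alpha> i j \<le> \<alpha> i i"
  using CTIN_pair[OF assms] CTIN_nonneg[OF assms(1,3,2)] by (cases "i = j") auto

lemma delta_nonneg:
  assumes "\<alpha> \<in> A_CTIN K" "i < K" "j < K"
  shows "delta \<alpha> i j \<ge> 0"
  using CTIN_pair[OF assms] CTIN_nonneg[OF assms] by (cases "i = j") (auto simp: delta_def)

lemma delta_le_direct:
  assumes "\<alpha> \<in> A_CTIN K" "i < K" "j < K"
  shows "delta \<alpha> i j \<le> \<alpha> i i"
  using CTIN_nonneg[OF assms(1,3,2)] CTIN_nonneg[OF assms(1,2,2)] by (auto simp: delta_def)

lemma row_diff_le_delta:
  assumes "\<alpha> \<in> A_CTIN K" "i < K" "j < K" "m < K" "i \<noteq> j"
  shows "\<alpha> i m - \<alpha> j m \<le> delta \<alpha> i j"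
  using CTIN_triple[OF assms(1-5)] assms(5) by (cases "m = i") (auto simp: delta_def)

lemma delta_pair_ge:
  assumes "\<alpha> \<in> A_CTIN K" "i < K" "j < K" "i \<noteq> j"
  shows "\<alpha> i i \<le> delta \<alpha> i j + delta \<alpha> j i"
  using CTIN_pair[of \<alpha> K j i] assms by (simp add: delta_def)

lemma delta_triangle:
  assumes "\<alpha> \<in> A_CTIN K" "i < K" "j < K" "k < K"
  shows "delta \<alpha> i j \<le> delta \<alpha> i k + delta \<alpha> k j"
proof -
  consider (refl) "i = j" | (endpoint) "k = i \<or> k = j" | (distinct) "i \<noteq> j" "k \<noteq> i" "k \<noteq> j" by blast
  then show ?thesis
  proof cases
    case refl
    then show ?thesis using delta_nonneg[OF assms(1,2,4)] delta_nonneg[OF assms(1,4,3)] by (simp add: delta_def)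
  next
    case distinct
    then show ?thesis using CTIN_triple[OF assms(1,4,3,2)] by (simp add: delta_def)
  qed (auto simp: delta_def)
qed

lemma delta_le_path_weight:
  assumes "\<alpha> \<in> A_CTIN K" "xs \<noteq> []" "set xs \<subseteq> {..<K}"
  shows "delta \<alpha> (hd xs) (last xs) \<le> path_weight (delta \<alpha>) xs"
  using assms by (intro le_path_weight[where V = "{..<K}"] delta_triangle) (auto simp: delta_def)

lemma Delta_singleton [simp]: "Delta \<alpha> [i] = \<alpha> i i"
  by (simp add: Delta_def)

lemma Delta_eq_cycle_weight: "length \<pi> \<ge> 2 \<Longrightarrow> Delta \<alpha> \<pi> = cycle_weight (delta \<alpha>) \<pi>"
  by (subst cycle_weight_eq_sum) (auto simp: Delta_def)

lemma Delta_le_path_weight_plus_direct: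
  assumes \<alpha>: "\<alpha> \<in> A_CTIN K" and xs: "xs \<noteq> []" "set xs \<subseteq> {..<K}"
  shows "Delta \<alpha> xs \<le> path_weight (delta \<alpha>) xs + \<alpha> (last xs) (last xs)"
proof (cases "length xs \<ge> 2")
  case True
  have "last xs < K" "hd xs < K" using xs last_in_set hd_in_set by blast+
  then show ?thesis
    using delta_le_direct[OF \<alpha>] True by (simp add: Delta_eq_cycle_weight cycle_weight_def)
next
  case False
  then obtain i where "xs = [i]" using xs(1) by (cases xs) (auto simp: not_le)
  then show ?thesis by simp
qed

subsection \<open>Broadcast bounds over paths and cycles\<close>

lemma GDoF_nonneg:
  assumes "d \<in> GDoF_region is_bc K \<alpha> Gm" "k < K"
  shows "d k \<ge> 0"
proof -
  obtain R where ach: "\<And>P. P > 1 \<Longrightarrow> achievable is_bc K \<alpha> (Gm P) P (R P)"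
      and lim: "((\<lambda>P. R P k / log 2 P) \<longlongrightarrow> d k) at_top"
    using assms unfolding GDoF_region_def by blast
  have "\<forall>\<^sub>F P in at_top. 0 \<le> R P k / log 2 P"
    using eventually_gt_at_top[of 1]
  proof eventually_elim
    case (elim P)
    then show ?case using ach[OF elim] assms(2) by (simp add: achievable_def)
  qed
  then show ?thesis by (rule tendsto_lowerbound[OF lim]) simp
qed

lemma achievable_BC_of_IC:
  assumes "achievable False K \<alpha> G P R"
  shows "achievable True K \<alpha> G P R"
  using assms unfolding achievable_def
  by (elim conj_forward all_forward imp_forward ex_forward) (assumption | simp)+

lemma GDoF_IC_subset_BC: "GDoF_region False K \<alpha> Gm \<subseteq> GDoF_region True K \<alpha> Gm"
  unfolding GDoF_region_def using achievable_BC_of_IC by blast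

lemma broadcast_path_le:
  assumes \<alpha>: "\<alpha> \<in> A_CTIN K" and adm: "admissible_channel K Gm" and d: "d \<in> GDoF_region is_bc K \<alpha> Gm"
    and xs: "xs \<noteq> []" "distinct xs" "set xs \<subseteq> {..<K}"
  shows "(\<Sum>k\<in>set xs. d k) \<le> \<alpha> (last xs) (last xs) + path_weight (delta \<alpha>) xs"
proof -
  define ks where "ks = rev xs"
  have ks: "ks \<noteq> []" "distinct ks" "set ks \<subseteq> {..<K}" using xs by (auto simp: ks_def)
  have ks_less: "ks ! l < K" if "l < length ks" for l using ks(3) nth_mem[OF that] by auto
  have last: "last xs < K" using xs last_in_set by blast
  have first: "ks ! 0 = last xs" using xs(1) by (simp add: ks_def rev_nth last_conv_nth)
  have "(\<Sum>k\<in>set ks. d k) \<le> \<alpha> (last xs) (last xs) + (\<Sum>l<length ks - 1. delta \<alpha> (ks ! Suc l) (ks ! l))"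
  proof (rule GDoF_broadcast_le[OF _ adm d ks])
    fix l assume l: "Suc l < length ks"
    then show "delta \<alpha> (ks ! Suc l) (ks ! l) \<ge> 0" by (intro delta_nonneg[OF \<alpha>] ks_less) auto
    have "ks ! Suc l \<noteq> ks ! l" using ks(2) l by (simp add: nth_eq_iff_index_eq)
    then show "\<alpha> (ks ! Suc l) i - \<alpha> (ks ! l) i \<le> delta \<alpha> (ks ! Suc l) (ks ! l)" if "i < K" for i
      using l that by (intro row_diff_le_delta[OF \<alpha>] ks_less) auto
  qed (use last first CTIN_nonneg[OF \<alpha>] CTIN_row_le[OF \<alpha>] in auto)
  also have "(\<Sum>l<length ks - 1. delta \<alpha> (ks ! Suc l) (ks ! l)) = path_weight (delta \<alpha>) xs"
    using path_weight_rev[of "delta \<alpha>" ks] by (simp add: path_weight_eq_sum[of "\<lambda>x y. delta \<alpha> y x"] ks_def)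
  finally show ?thesis by (simp add: ks_def)
qed

lemma broadcast_rotated_cycle_le:
  assumes \<alpha>: "\<alpha> \<in> A_CTIN K" and adm: "admissible_channel K Gm" and d: "d \<in> GDoF_region is_bc K \<alpha> Gm"
    and \<pi>: "is_cycle K \<pi>" "length \<pi> \<ge> 2" and m: "m < length \<pi>"
  shows "(\<Sum>k\<in>set \<pi>. d k) + delta \<alpha> (\<pi> ! m) (\<pi> ! ((m + 1) mod length \<pi>)) \<le> 2 * Delta \<alpha> \<pi>"
proof -
  have nonempty: "\<pi> \<noteq> []" using \<pi>(2) by auto
  define xs where "xs = rotate (Suc m) \<pi>"
  have xs: "xs \<noteq> []" "distinct xs" "set xs \<subseteq> {..<K}" and set: "set xs = set \<pi>"
    using \<pi> by (auto simp: xs_def is_cycle_def)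
  have ends: "last xs < K" "hd xs < K" using xs last_in_set hd_in_set by blast+
  have hd: "hd xs = \<pi> ! ((m + 1) mod length \<pi>)"
    using nonempty by (simp add: xs_def hd_rotate_conv_nth del: rotate_Suc)
  have "last (rotate1 ys) = hd ys" if "ys \<noteq> []" for ys :: "nat list" using that by (cases ys) auto
  then have last: "last xs = \<pi> ! m"
    using nonempty m by (simp add: xs_def hd_rotate_conv_nth)
  have "last xs \<noteq> hd xs"
    using xs(1,2) \<pi>(2) by (simp add: last_conv_nth hd_conv_nth nth_eq_iff_index_eq xs_def)
  then have "\<alpha> (last xs) (last xs) \<le> delta \<alpha> (last xs) (hd xs) + delta \<alpha> (hd xs) (last xs)"
    using ends by (intro delta_pair_ge[OF \<alpha>])
  also have "\<dots> \<le> delta \<alpha> (last xs) (hd xs) + path_weight (delta \<alpha>) xs"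
    using delta_le_path_weight[OF \<alpha> xs(1,3)] by simp
  finally have "(\<Sum>k\<in>set \<pi>. d k) + delta \<alpha> (last xs) (hd xs) \<le> 2 * cycle_weight (delta \<alpha>) xs"
    using broadcast_path_le[OF \<alpha> adm d xs] by (simp add: set cycle_weight_def)
  also have "cycle_weight (delta \<alpha>) xs = Delta \<alpha> \<pi>"
    using \<pi>(2) by (simp only: xs_def cycle_weight_rotate Delta_eq_cycle_weight)
  finally show ?thesis by (simp only: hd last)
qed

lemma broadcast_cycle_le:
  assumes \<alpha>: "\<alpha> \<in> A_CTIN K" and adm: "admissible_channel K Gm" and d: "d \<in> GDoF_region is_bc K \<alpha> Gm"
    and \<pi>: "is_cycle K \<pi>"
  shows "(\<Sum>k\<in>set \<pi>. d k) \<le> (2 - 1 / real K) * Delta \<alpha> \<pi>"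
proof -
  define M where "M = length \<pi>"
  have M: "1 \<le> M" "M \<le> K"
    using \<pi> card_mono[of "{..<K}" "set \<pi>"] by (auto simp: M_def is_cycle_def distinct_card Suc_le_eq)
  have "(\<Sum>k\<in>set \<pi>. d k) \<le> (2 - 1 / real M) * Delta \<alpha> \<pi> \<and> Delta \<alpha> \<pi> \<ge> 0"
  proof (cases "M = 1")
    case True
    then obtain i where "\<pi> = [i]" by (auto simp: M_def length_Suc_conv)
    then show ?thesis
      using broadcast_path_le[OF \<alpha> adm d, of "[i]"] \<pi> CTIN_nonneg[OF \<alpha>] True by (simp add: is_cycle_def)
  next
    case False
    then have M_ge_2: "M \<ge> 2" using M by simp
    have Delta: "Delta \<alpha> \<pi> = (\<Sum>m<M. delta \<alpha> (\<pi> ! m) (\<pi> ! ((m + 1) mod M)))"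
      using M_ge_2 by (simp add: Delta_def M_def)
    have "real M * (\<Sum>k\<in>set \<pi>. d k) + Delta \<alpha> \<pi>
        = (\<Sum>m<M. (\<Sum>k\<in>set \<pi>. d k) + delta \<alpha> (\<pi> ! m) (\<pi> ! ((m + 1) mod M)))"
      by (simp add: sum.distrib Delta)
    also have "\<dots> \<le> (\<Sum>m<M. 2 * Delta \<alpha> \<pi>)"
      using M_ge_2 unfolding M_def by (intro sum_mono broadcast_rotated_cycle_le[OF \<alpha> adm d \<pi>]) auto
    finally have "(\<Sum>k\<in>set \<pi>. d k) \<le> (2 - 1 / real M) * Delta \<alpha> \<pi>"
      using M by (simp add: field_simps)
    moreover have "\<pi> ! m < K" if "m < M" for m
      using \<pi> nth_mem[of m \<pi>] that unfolding is_cycle_def M_def by blast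
    then have "Delta \<alpha> \<pi> \<ge> 0"
      unfolding Delta using M by (intro sum_nonneg delta_nonneg[OF \<alpha>]) auto
    ultimately show ?thesis by simp
  qed
  moreover have "2 - 1 / real M \<le> 2 - 1 / real K" using M by (simp add: frac_le)
  ultimately show ?thesis by (meson mult_right_mono order_trans)
qed

lemma scaled_broadcast_in_PTIN:
  assumes \<alpha>: "\<alpha> \<in> A_CTIN K" and K: "K \<ge> 1" and adm: "admissible_channel K Gm"
    and d: "d \<in> GDoF_region is_bc K \<alpha> Gm"
  shows "(\<lambda>k. d k / (2 - 1 / real K)) \<in> D_PTIN K \<alpha> {..<K}"
proof -
  have pos: "2 - 1 / real K > 0" using K by (simp add: divide_simps)
  have "(\<Sum>k\<in>set \<pi>. d k / (2 - 1 / real K)) \<le> Delta \<alpha> \<pi>" if "is_cycle K \<pi>" for \<pi>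
    using broadcast_cycle_le[OF \<alpha> adm d that] pos
    by (simp add: sum_divide_distrib[symmetric] pos_divide_le_eq mult.commute)
  moreover have "\<forall>k. k \<ge> K \<longrightarrow> d k = 0" using d by (simp add: GDoF_region_def)
  ultimately show ?thesis
    using GDoF_nonneg[OF d] pos by (auto simp: D_PTIN_def intro!: divide_nonneg_nonneg)
qed

subsection \<open>TIN tuples in the interference channel\<close>

lemma PTIN_eq_0: "d \<in> D_PTIN K \<alpha> S \<Longrightarrow> k \<notin> S \<Longrightarrow> d k = 0"
  by (cases "k < K") (auto simp: D_PTIN_def)

lemma PTIN_nonneg: "d \<in> D_PTIN K \<alpha> S \<Longrightarrow> d k \<ge> 0"
  using PTIN_eq_0[of d K \<alpha> S k] by (cases "k \<in> S") (auto simp: D_PTIN_def)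

lemma PTIN_cycle_le:
  "d \<in> D_PTIN K \<alpha> S \<Longrightarrow> S \<subseteq> {..<K} \<Longrightarrow> xs \<noteq> [] \<Longrightarrow> distinct xs \<Longrightarrow> set xs \<subseteq> S \<Longrightarrow> sum_list (map d xs) \<le> Delta \<alpha> xs"
  by (auto simp: D_PTIN_def is_cycle_def sum_list_distinct_conv_sum_set)

lemma PTIN_subset_IC:
  assumes \<alpha>: "\<alpha> \<in> A_CTIN K" and adm: "admissible_channel K Gm" and S: "S \<subseteq> {..<K}" and d: "d \<in> D_PTIN K \<alpha> S"
  shows "d \<in> GDoF_region False K \<alpha> Gm"
proof -
  have fin: "finite S" using S finite_subset by blast
  define w where "w i j = delta \<alpha> i j - d j" for i j
  define u where "u = potential S w (\<lambda>i. \<alpha> i i)"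
  have "cycle_weight w xs \<ge> 0" if xs: "distinct xs" "set xs \<subseteq> S" "length xs \<ge> 2" for xs
  proof -
    have "xs \<noteq> []" using xs(3) by auto
    then show ?thesis
      using PTIN_cycle_le[OF d S _ xs(1,2)] xs(3)
      by (simp add: w_def[abs_def] cycle_weight_diff_node Delta_eq_cycle_weight)
  qed
  then have edge: "u i \<le> w i j + u j" if "i \<in> S" "j \<in> S" "i \<noteq> j" for i j
    unfolding u_def using that by (intro potential_le_edge[OF fin])
  have "d i \<le> path_value w (\<lambda>i. \<alpha> i i) xs" if xs: "xs \<in> simple_paths S i" for i xs
  proof -
    obtain ys where ys: "xs = i # ys" "distinct xs" "set xs \<subseteq> S"
      using xs by (cases xs) (auto simp: simple_paths_def)
    then have "sum_list (map d xs) \<le> path_weight (delta \<alpha>) xs + \<alpha> (last xs) (last xs)"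
      using PTIN_cycle_le[OF d S, of xs] Delta_le_path_weight_plus_direct[OF \<alpha>, of xs] S by force
    then show ?thesis
      unfolding path_value_def w_def[abs_def] path_weight_diff_node by (simp add: ys(1))
  qed
  then have "d i \<le> u i" if "i \<in> S" for i
    using potential_attained[OF fin that, of w "\<lambda>i. \<alpha> i i"] unfolding u_def by metis
  moreover have "u i \<le> \<alpha> i i" if "i \<in> S" for i
    unfolding u_def using fin that by (rule potential_le_terminal)
  moreover have "u i - (\<alpha> i i - \<alpha> j i) \<le> u j - d j" if "i \<in> S" "j \<in> S" "i \<noteq> j" for i j
    using edge[OF that] that(3) by (simp add: w_def delta_def)
  ultimately show ?thesis
    by (intro tin_achievable[OF adm S PTIN_eq_0[OF d] PTIN_nonneg[OF d], where u = u]) simp_all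
qed

lemma TINA_subset_IC:
  "\<alpha> \<in> A_CTIN K \<Longrightarrow> admissible_channel K Gm \<Longrightarrow> D_TINA_region K \<alpha> \<subseteq> GDoF_region False K \<alpha> Gm"
  using PTIN_subset_IC by (fastforce simp: D_TINA_region_def)

lemma zero_in_TINA: "(\<lambda>_. 0) \<in> D_TINA_region K \<alpha>"
proof -
  have "(\<lambda>_. 0) \<in> D_PTIN K \<alpha> {}" by (auto simp: D_PTIN_def is_cycle_def)
  then show ?thesis by (auto simp: D_TINA_region_def)
qed

lemma TINA_le_direct:
  assumes d: "d \<in> D_TINA_region K \<alpha>" and k: "k < K" and \<alpha>: "\<alpha> \<in> A_CTIN K"
  shows "d k \<le> \<alpha> k k"
proof -
  obtain S where S: "S \<subseteq> {..<K}" and d: "d \<in> D_PTIN K \<alpha> S" using d by (auto simp: D_TINA_region_def)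
  then show ?thesis
    using PTIN_cycle_le[OF d S, of "[k]"] PTIN_eq_0[OF d, of k] CTIN_nonneg[OF \<alpha> k k] by (cases "k \<in> S") auto
qed

subsection \<open>Comparison of the sum GDoF values\<close>

lemma sum_le_D_sum_TINA:
  assumes "\<alpha> \<in> A_CTIN K" and "d \<in> D_TINA_region K \<alpha>"
  shows "(\<Sum>k<K. d k) \<le> D_sum_TINA K \<alpha>"
  unfolding D_sum_TINA_def
proof (rule cSup_upper)
  show "bdd_above {(\<Sum>k<K. d k) | d. d \<in> D_TINA_region K \<alpha>}"
    using TINA_le_direct[OF _ _ assms(1)] by (intro bdd_aboveI[of _ "\<Sum>k<K. \<alpha> k k"]) (auto intro!: sum_mono)
qed (use assms(2) in blast)

lemma D_sum_TINA_nonneg: "\<alpha> \<in> A_CTIN K \<Longrightarrow> D_sum_TINA K \<alpha> \<ge> 0"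
  using sum_le_D_sum_TINA[OF _ zero_in_TINA] by simp

lemma sum_broadcast_le_TINA:
  assumes \<alpha>: "\<alpha> \<in> A_CTIN K" and K: "K \<ge> 1" and adm: "admissible_channel K Gm"
    and d: "d \<in> GDoF_region is_bc K \<alpha> Gm"
  shows "(\<Sum>k<K. d k) \<le> (2 - 1 / real K) * D_sum_TINA K \<alpha>"
proof -
  have "2 - 1 / real K > 0" using K by (simp add: divide_simps)
  moreover have "(\<lambda>k. d k / (2 - 1 / real K)) \<in> D_TINA_region K \<alpha>"
    using scaled_broadcast_in_PTIN[OF \<alpha> K adm d] by (auto simp: D_TINA_region_def)
  note sum_le_D_sum_TINA[OF \<alpha> this]
  ultimately show ?thesis by (simp add: sum_divide_distrib[symmetric] pos_divide_le_eq mult.commute)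
qed

lemma bdd_above_sum_GDoF:
  assumes "\<alpha> \<in> A_CTIN K" "K \<ge> 1" "admissible_channel K Gm"
  shows "bdd_above {(\<Sum>k<K. d k) | d. d \<in> GDoF_region is_bc K \<alpha> Gm}"
  using sum_broadcast_le_TINA[OF assms] by (intro bdd_aboveI) auto

lemma zero_in_GDoF:
  assumes "\<alpha> \<in> A_CTIN K" "admissible_channel K Gm"
  shows "(\<lambda>_. 0) \<in> GDoF_region is_bc K \<alpha> Gm"
proof -
  have "(\<lambda>_. 0) \<in> GDoF_region False K \<alpha> Gm"
    by (rule subsetD[OF TINA_subset_IC[OF assms] zero_in_TINA])
  then show ?thesis using subsetD[OF GDoF_IC_subset_BC] by (cases is_bc) simp_all
qed

lemma sum_le_D_sum_BC:
  assumes "\<alpha> \<in> A_CTIN K" "K \<ge> 1" "admissible_channel K Gm" and "d \<in> GDoF_region True K \<alpha> Gm"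
  shows "(\<Sum>k<K. d k) \<le> D_sum_BC K \<alpha> Gm"
  unfolding D_sum_BC_def using assms bdd_above_sum_GDoF by (intro cSup_upper) blast+

lemma D_sum_BC_le:
  assumes "\<alpha> \<in> A_CTIN K" "K \<ge> 1" "admissible_channel K Gm"
  shows "D_sum_BC K \<alpha> Gm \<le> (2 - 1 / real K) * D_sum_TINA K \<alpha>"
  unfolding D_sum_BC_def using sum_broadcast_le_TINA[OF assms] zero_in_GDoF[OF assms(1,3)]
  by (intro cSup_least) auto

lemma D_sum_TINA_le_IC:
  assumes "\<alpha> \<in> A_CTIN K" "K \<ge> 1" "admissible_channel K Gm"
  shows "D_sum_TINA K \<alpha> \<le> D_sum_IC K \<alpha> Gm"
  unfolding D_sum_TINA_def D_sum_IC_def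
proof (rule cSup_subset_mono[OF _ bdd_above_sum_GDoF[OF assms]])
  show "{(\<Sum>k<K. d k) | d. d \<in> D_TINA_region K \<alpha>} \<noteq> {}" using zero_in_TINA by blast
qed (use TINA_subset_IC[OF assms(1,3)] in auto)

lemma D_sum_IC_le:
  assumes "\<alpha> \<in> A_CTIN K" "admissible_channel K Gm" and "\<And>d. d \<in> GDoF_region False K \<alpha> Gm \<Longrightarrow> (\<Sum>k<K. d k) \<le> c"
  shows "D_sum_IC K \<alpha> Gm \<le> c"
  unfolding D_sum_IC_def using assms(3) zero_in_GDoF[OF assms(1,2)] by (intro cSup_least) auto

lemma broadcast_ratio_le:
  assumes \<alpha>: "\<alpha> \<in> A_CTIN K" and K: "K \<ge> 1" and adm: "admissible_channel K Gm" and s: "D_sum_TINA K \<alpha> \<le> s"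
  shows "D_sum_BC K \<alpha> Gm / s \<le> 2 - 1 / real K"
proof (cases "s = 0")
  case False
  have "s > 0" using False s D_sum_TINA_nonneg[OF \<alpha>] by linarith
  have nonneg: "2 - 1 / real K \<ge> 0" using K by (simp add: divide_simps)
  have "D_sum_BC K \<alpha> Gm \<le> (2 - 1 / real K) * D_sum_TINA K \<alpha>" by (rule D_sum_BC_le[OF \<alpha> K adm])
  also have "\<dots> \<le> (2 - 1 / real K) * s" using s nonneg by (rule mult_left_mono)
  finally show ?thesis using \<open>s > 0\<close> by (simp add: pos_divide_le_eq)
qed (use K in \<open>simp add: divide_simps\<close>)

subsection \<open>The cyclic channel\<close>

definition cyclic_dist :: "nat \<Rightarrow> nat \<Rightarrow> nat \<Rightarrow> nat" where
  "cyclic_dist K k i = (k + K - i) mod K"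

lemma cyclic_dist_triangle:
  assumes "i < K" "j < K" "k < K"
  shows "cyclic_dist K j k \<le> cyclic_dist K j i + cyclic_dist K i k"
proof -
  have "(j + K - i) + (i + K - k) = (j + K - k) + K" using assms by simp
  then have "cyclic_dist K j k = ((j + K - i) + (i + K - k)) mod K" by (simp add: cyclic_dist_def)
  also have "\<dots> = (cyclic_dist K j i + cyclic_dist K i k) mod K" by (simp only: cyclic_dist_def mod_add_eq)
  also have "\<dots> \<le> cyclic_dist K j i + cyclic_dist K i k" by (rule mod_less_eq_dividend)
  finally show ?thesis .
qed

lemma cyclic_dist_less:
  assumes "i \<le> k" "k < K"
  shows "cyclic_dist K k i = k - i"
proof -
  have "k + K - i = (k - i) + K" using assms by simp
  then show ?thesis using assms by (simp only: cyclic_dist_def mod_add_self2) simp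
qed

lemma cyclic_dist_add_swap:
  assumes "i < K" "j < K" "i \<noteq> j"
  shows "cyclic_dist K i j + cyclic_dist K j i = K"
proof -
  have "cyclic_dist K i j + cyclic_dist K j i = K" if "i < j" "j < K" for i j
    using that by (simp add: cyclic_dist_less[of i j]) (simp add: cyclic_dist_def)
  from this[of i j] this[of j i] show ?thesis using assms by (cases "i < j") auto
qed

definition cyclic_channel :: "nat \<Rightarrow> nat \<Rightarrow> nat \<Rightarrow> real" where
  "cyclic_channel K k i = 1 - real (cyclic_dist K k i) / real K"

lemma cyclic_channel_diag [simp]: "cyclic_channel K k k = 1"
  by (simp add: cyclic_channel_def cyclic_dist_def)

lemma cyclic_channel_nonneg:
  assumes "K \<ge> 1"
  shows "cyclic_channel K k i \<ge> 0"
proof -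
  have "cyclic_dist K k i \<le> K" using assms by (simp add: cyclic_dist_def less_imp_le)
  then show ?thesis using assms by (simp add: cyclic_channel_def divide_simps)
qed

lemma cyclic_channel_add_swap:
  assumes "i < K" "j < K" "i \<noteq> j"
  shows "cyclic_channel K i j + cyclic_channel K j i = 1"
proof -
  have "real (cyclic_dist K i j) / real K + real (cyclic_dist K j i) / real K = 1"
    using cyclic_dist_add_swap[OF assms] assms(1)
    by (simp add: add_divide_distrib[symmetric] of_nat_add[symmetric] del: of_nat_add)
  then show ?thesis by (simp add: cyclic_channel_def)
qed

lemma cyclic_channel_triangle:
  assumes "i < K" "j < K" "k < K"
  shows "cyclic_channel K i k + cyclic_channel K j i \<le> 1 + cyclic_channel K j k"
proof -
  have "real (cyclic_dist K j k) / real K \<le> real (cyclic_dist K j i + cyclic_dist K i k) / real K"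
    using cyclic_dist_triangle[OF assms] by (intro divide_right_mono of_nat_mono) auto
  then show ?thesis by (simp add: cyclic_channel_def add_divide_distrib)
qed

lemma cyclic_channel_CTIN: "K \<ge> 1 \<Longrightarrow> cyclic_channel K \<in> A_CTIN K"
  unfolding A_CTIN_def
  using cyclic_channel_nonneg[of K] cyclic_channel_add_swap[of _ K] cyclic_channel_triangle[of _ K]
  by (auto simp: algebra_simps)

lemma cyclic_channel_off_diag:
  assumes "k < K" "i < K" "i \<noteq> k"
  shows "cyclic_channel K k i \<le> 1 - 1 / real K"
proof -
  have "cyclic_dist K i k < K" using assms by (simp add: cyclic_dist_def)
  then have "1 \<le> cyclic_dist K k i" using cyclic_dist_add_swap[of k K i] assms by linarith
  then show ?thesis using assms by (simp add: cyclic_channel_def divide_right_mono)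
qed

lemma cyclic_channel_IC_sum_le:
  assumes K: "K \<ge> 1" and adm: "admissible_channel K Gm" and d: "d \<in> GDoF_region False K (cyclic_channel K) Gm"
  shows "(\<Sum>k<K. d k) \<le> 1"
proof (cases "K = 1")
  case True
  then show ?thesis
    using broadcast_path_le[OF cyclic_channel_CTIN[OF K] adm d, of "[0]"] by simp
next
  case False
  then have K_ge_2: "K \<ge> 2" using K by simp
  define pr where "pr k = (if k = 0 then K - 1 else k - 1)" for k
  have pr: "pr k < K" "pr k \<noteq> k" if "k < K" for k using that K_ge_2 by (auto simp: pr_def)
  have "cyclic_dist K k (pr k) = 1" if "k < K" for k
    using that K_ge_2 by (cases "k = 0") (auto simp: pr_def cyclic_dist_less, simp add: cyclic_dist_def)
  then have gap: "cyclic_channel K k (pr k) = 1 - 1 / real K" if "k < K" for k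
    using that by (simp add: cyclic_channel_def)
  have "(\<Sum>k<K. d k) \<le> real K * (1 / real K)"
  proof (rule GDoF_interference_le[OF K_ge_2 adm d])
    show "bij_betw pr {..<K} {..<K}"
      by (rule bij_betw_byWitness[where f' = "\<lambda>k. if k = K - 1 then 0 else k + 1"])
        (use K_ge_2 in \<open>auto simp: pr_def\<close>)
    show "cyclic_channel K (pr k) i - cyclic_channel K k i \<le> 1 / real K" if "k < K" "i < K" for k i
      using cyclic_channel_triangle[OF pr(1)[OF that(1)] that] gap[OF that(1)] by simp
    show "cyclic_channel K (pr k) k \<le> 1 / real K" if "k < K" for k
      using cyclic_channel_add_swap[OF pr(1)[OF that] that pr(2)[OF that]] gap[OF that] by simp
  qed (use pr in auto)
  then show ?thesis using K by simp
qed

lemma cyclic_channel_D_sum_BC_ge: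
  assumes K: "K \<ge> 1" and adm: "admissible_channel K Gm"
  shows "2 - 1 / real K \<le> D_sum_BC K (cyclic_channel K) Gm"
proof -
  define d where "d k = (if k < K then (if k = 0 then 1 else 1 / real K) else 0)" for k
  have "d \<in> GDoF_region True K (cyclic_channel K) Gm"
    unfolding d_def using K cyclic_channel_off_diag by (intro common_private_achievable[OF K adm]) auto
  then have "(\<Sum>k<K. d k) \<le> D_sum_BC K (cyclic_channel K) Gm"
    by (rule sum_le_D_sum_BC[OF cyclic_channel_CTIN[OF K] K adm])
  moreover have "2 - 1 / real K = (\<Sum>k<K. d k)"
  proof -
    have "(\<Sum>k<K. d k) = d 0 + (\<Sum>k\<in>{..<K} - {0}. d k)"
      using K by (intro sum.remove) auto
    also have "(\<Sum>k\<in>{..<K} - {0}. d k) = (\<Sum>k\<in>{..<K} - {0}. 1 / real K)"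
      by (rule sum.cong) (auto simp: d_def)
    finally show ?thesis using K by (simp add: d_def divide_simps of_nat_diff)
  qed
  ultimately show ?thesis by simp
qed

lemma cyclic_channel_sum_GDoF:
  assumes K: "K \<ge> 1" and adm: "admissible_channel K Gm"
  shows "D_sum_TINA K (cyclic_channel K) = 1" "D_sum_IC K (cyclic_channel K) Gm = 1"
    "D_sum_BC K (cyclic_channel K) Gm = 2 - 1 / real K"
proof -
  note \<alpha> = cyclic_channel_CTIN[OF K]
  have pos: "2 - 1 / real K > 0" using K by (simp add: divide_simps)
  have IC_le: "D_sum_IC K (cyclic_channel K) Gm \<le> 1"
    by (rule D_sum_IC_le[OF \<alpha> adm cyclic_channel_IC_sum_le[OF K adm]])
  have "(2 - 1 / real K) * 1 \<le> (2 - 1 / real K) * D_sum_TINA K (cyclic_channel K)"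
    using cyclic_channel_D_sum_BC_ge[OF K adm] D_sum_BC_le[OF \<alpha> K adm] by simp
  then have "1 \<le> D_sum_TINA K (cyclic_channel K)"
    using pos by (simp only: mult_le_cancel_left_pos)
  then show TINA: "D_sum_TINA K (cyclic_channel K) = 1" and "D_sum_IC K (cyclic_channel K) Gm = 1"
    using D_sum_TINA_le_IC[OF \<alpha> K adm] IC_le by linarith+
  show "D_sum_BC K (cyclic_channel K) Gm = 2 - 1 / real K"
    using cyclic_channel_D_sum_BC_ge[OF K adm] D_sum_BC_le[OF \<alpha> K adm] TINA by simp
qed

theorem theorem3:
  fixes K :: nat
    and Gm :: "real \<Rightarrow> (nat \<Rightarrow> nat \<Rightarrow> nat \<Rightarrow> complex) measure"
  assumes "K \<ge> 1"
    and "admissible_channel K Gm"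
  shows "is_max {D_sum_BC K \<alpha> Gm / D_sum_TINA K \<alpha> | \<alpha>.
                   \<alpha> \<in> A_CTIN K \<and> (\<exists>i<K. \<alpha> i i \<noteq> 0)} (2 - 1 / real K) \<and>
         is_max {D_sum_BC K \<alpha> Gm / D_sum_IC K \<alpha> Gm | \<alpha>.
                   \<alpha> \<in> A_CTIN K \<and> (\<exists>i<K. \<alpha> i i \<noteq> 0)} (2 - 1 / real K)"
proof -
  have bounds: "D_sum_BC K \<alpha> Gm / D_sum_TINA K \<alpha> \<le> 2 - 1 / real K"
      "D_sum_BC K \<alpha> Gm / D_sum_IC K \<alpha> Gm \<le> 2 - 1 / real K" if "\<alpha> \<in> A_CTIN K" for \<alpha>
    using broadcast_ratio_le[OF that assms] D_sum_TINA_le_IC[OF that assms] by simp_all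
  have "cyclic_channel K \<in> A_CTIN K" by (rule cyclic_channel_CTIN[OF assms(1)])
  moreover have "\<exists>i<K. cyclic_channel K i i \<noteq> 0" using assms(1) by (intro exI[of _ 0]) simp
  moreover have "2 - 1 / real K = D_sum_BC K (cyclic_channel K) Gm / D_sum_TINA K (cyclic_channel K)"
      "2 - 1 / real K = D_sum_BC K (cyclic_channel K) Gm / D_sum_IC K (cyclic_channel K) Gm"
    by (simp_all add: cyclic_channel_sum_GDoF[OF assms])
  ultimately show ?thesis
    unfolding is_max_def using bounds by blast
qed

end
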